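(* Let $r\ge 2$ and let $g: D_{r,r}\to D_{r+1,r+1}$ be a proper monomial rational map (with components having no common factor). Then, up to automorphisms of $D_{r,r}$ and $D_{r+1,r+1}$ (that is, after replacing $g$ by $A\circ g\circ B$ for suitable $B\in \mathrm{Aut}(D_{r,r})$ and $A\in \mathrm{Aut}(D_{r+1,r+1})$), $g$ is rationally equivalent to one of the following. (1) In case $\mathrm{degree}(g)=1$: $g([z_1,\dots,z_{2r}])=[z_1,\dots,z_r,\phi(z),z_{r+1},\dots,z_{2r},\phi(z)]$, where $\phi(z)$ is a degree one homogeneous polynomial in $z_1,\dots,z_{2r}$ (the zero polynomial being allowed). (2) In case $\mathrm{degree}(g)=2$ (this occurs only for $r=2$), one of: (a) $g([z_1,z_2,z_3,z_4])=[z_1^2,\,z_1z_2,\,z_2z_3,\,z_3^2,\,z_1z_4,\,z_3z_4]$; (b) $g([z_1,z_2,z_3,z_4])=[z_1^2,\,\sqrt2 z_1z_2,\,z_2^2,\,z_3^2,\,\sqrt2 z_3z_4,\,z_4^2]$. (3) In case $\mathrm{degree}(g)\ge 3$: if $Q_P(x)$ has degree $1$, or the coefficients of the polynomial $Q_P(x)$ are nonnegative, there is no such proper monomial rational map.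
   Context: For positive integers $r,s$, the generalized ball is $D_{r,s}=\{[z_1,\dots,z_{r+s}]\in\mathbb{P}^{r+s-1}: |z_1|^2+\dots+|z_r|^2>|z_{r+1}|^2+\dots+|z_{r+s}|^2\}$, where $\mathbb{P}^{n}$ is complex projective space. $\mathrm{Aut}(D)$ is the group of holomorphic automorphisms of $D$. A rational map $g:D_{r,s}\to D_{r',s'}$ is a rational map $\mathbb{P}^{r+s-1}\to\mathbb{P}^{r'+s'-1}$ sending points of $D_{r,s}$ outside its indeterminacy into $D_{r',s'}$. It is called proper if for any point $x\in\partial D_{r,s}$ and any open neighborhood $U$ of $x$ which does not intersect the indeterminacy of $g$, $g$ is proper on $U\cap D_{r,s}$ (i.e. boundary points of $D_{r,s}$ in $U$ are approached only with images approaching $\partial D_{r',s'}$). Write $g([z_1,\dots,z_{r+s}])=[g_1,\dots,g_{r'+s'}]$ in homogeneous coordinates. $g$ is monomial if each $g_i$ is a (constant multiple of a) monomial in $z_1,\dots,z_{r+s}$, all of the same degree, which is $\mathrm{degree}(g)$; it is assumed throughout that the components $g_i$ have no common factor. Two rational maps $g_1,g_2:\mathbb{P}^n\to\mathbb{P}^N$ are rationally equivalent if there is a rational map $\mathbb{P}^n\to\mathbb{P}^N$ which is a common extension of $g_1$ and $g_2$. For a proper monomial rational map $g:D_{r,s}\to D_{r',s'}$, let $P:\mathbb{R}^{r+s}\to\mathbb{R}$ be the homogeneous polynomial with $P(|z_1|^2,\dots,|z_{r+s}|^2)=\sum_{k=1}^{r'}|g_k|^2-\sum_{k=r'+1}^{r'+s'}|g_k|^2$.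 By properness $P(x)=0$ whenever $\sum_{j=1}^r x_j=\sum_{j=r+1}^{r+s}x_j$, so $P(x)=\left(\sum_{j=1}^r x_j-\sum_{j=r+1}^{r+s}x_j\right)^m Q_P(x)$ for a positive integer $m$ and a homogeneous polynomial $Q_P$ which is not identically zero on the hyperplane $\sum_{j=1}^r x_j=\sum_{j=r+1}^{r+s}x_j$; this defines $m$ and $Q_P$. *)

theory Defs
  imports "HOL-Analysis.Analysis" "HOL-Library.Poly_Mapping"
begin

text \<open>
  Conventions.  Coordinates are numbered from 0: the paper's \<open>z\<^sub>1, \<dots>, z\<^sub>n\<close> are \<open>z 0, \<dots>, z (n - 1)\<close>.
  The parameter \<open>n\<close> always counts homogeneous coordinates, so \<open>proj_space n\<close> is \<open>P\<^sup>n\<^sup>-\<^sup>1\<close>.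
  Maps that need not be defined everywhere are partial functions \<open>\<rightharpoonup>\<close>, and ``is an extension of''
  is \<open>\<subseteq>\<^sub>m\<close>.
\<close>


subsection \<open>Polynomials in the variables indexed by natural numbers\<close>

type_synonym 'a mpoly = "(nat \<Rightarrow>\<^sub>0 nat) \<Rightarrow>\<^sub>0 'a"

definition Var :: "nat \<Rightarrow> 'a::comm_semiring_1 mpoly" where
  "Var i = Poly_Mapping.single (Poly_Mapping.single i 1) 1"

definition Const :: "'a::comm_semiring_1 \<Rightarrow> 'a mpoly" where
  "Const c = Poly_Mapping.single 0 c"

definition eval_mpoly :: "'a::comm_semiring_1 mpoly \<Rightarrow> (nat \<Rightarrow> 'a) \<Rightarrow> 'a" where
  "eval_mpoly p x =
     (\<Sum>e\<in>Poly_Mapping.keys p. Poly_Mapping.lookup p e *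
        (\<Prod>i\<in>Poly_Mapping.keys e. x i ^ Poly_Mapping.lookup e i))"

definition mon_degree :: "(nat \<Rightarrow>\<^sub>0 nat) \<Rightarrow> nat" where
  "mon_degree e = (\<Sum>i\<in>Poly_Mapping.keys e. Poly_Mapping.lookup e i)"

definition total_degree :: "'a::zero mpoly \<Rightarrow> nat" where
  "total_degree p = Max (insert 0 (mon_degree ` Poly_Mapping.keys p))"

text \<open>Homogeneous of degree \<open>d\<close> in the first \<open>n\<close> variables; this includes the zero polynomial.\<close>

definition homog_poly :: "nat \<Rightarrow> nat \<Rightarrow> 'a::zero mpoly \<Rightarrow> bool" where
  "homog_poly n d p \<longleftrightarrow>
     (\<forall>e\<in>Poly_Mapping.keys p. Poly_Mapping.keys e \<subseteq> {..<n} \<and> mon_degree e = d)"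


subsection \<open>Complex projective space\<close>

definition cspace :: "nat \<Rightarrow> (nat \<Rightarrow> complex) set" where
  "cspace n = {z. \<forall>i\<ge>n. z i = 0}"

definition punctured :: "nat \<Rightarrow> (nat \<Rightarrow> complex) set" where
  "punctured n = {z \<in> cspace n. \<exists>i. z i \<noteq> 0}"

text \<open>A point of projective space is the set of all its homogeneous coordinate vectors.\<close>

type_synonym point = "(nat \<Rightarrow> complex) set"

definition proj_pt :: "(nat \<Rightarrow> complex) \<Rightarrow> point" where
  "proj_pt z = {(\<lambda>i. c * z i) | c. c \<noteq> 0}"

definition proj_space :: "nat \<Rightarrow> point set" where
  "proj_space n = proj_pt ` punctured n"

text \<open>
  The quotient topology.  The product topology of \<open>nat \<Rightarrow> complex\<close> induces on
  \<open>cspace n\<close> the usual topology of \<open>\<complex>\<^sup>n\<close>.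
\<close>

definition proj_topology :: "nat \<Rightarrow> point topology" where
  "proj_topology n =
     topology (\<lambda>U. U \<subseteq> proj_space n \<and>
       openin (top_of_set (punctured n)) {z \<in> punctured n. proj_pt z \<in> U})"

lemma openin_proj_topology:
  "openin (proj_topology n) U \<longleftrightarrow>
     U \<subseteq> proj_space n \<and> openin (top_of_set (punctured n)) {z \<in> punctured n. proj_pt z \<in> U}"
proof -
  have "istopology (\<lambda>U. U \<subseteq> proj_space n \<and>
      openin (top_of_set (punctured n)) {z \<in> punctured n. proj_pt z \<in> U})"
    unfolding istopology_def
  proof (intro conjI allI impI)
    fix S T
    assume S: "S \<subseteq> proj_space n \<and>
        openin (top_of_set (punctured n)) {z \<in> punctured n. proj_pt z \<in> S}"
      and T: "T \<subseteq> proj_space n \<and>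
        openin (top_of_set (punctured n)) {z \<in> punctured n. proj_pt z \<in> T}"
    show "S \<inter> T \<subseteq> proj_space n"
      using S by blast
    have "{z \<in> punctured n. proj_pt z \<in> S \<inter> T} =
        {z \<in> punctured n. proj_pt z \<in> S} \<inter> {z \<in> punctured n. proj_pt z \<in> T}"
      by blast
    then show "openin (top_of_set (punctured n)) {z \<in> punctured n. proj_pt z \<in> S \<inter> T}"
      using openin_Int[OF conjunct2[OF S] conjunct2[OF T]] by (simp only:)
  next
    fix K
    assume K: "\<forall>S\<in>K. S \<subseteq> proj_space n \<and>
        openin (top_of_set (punctured n)) {z \<in> punctured n. proj_pt z \<in> S}"
    show "\<Union>K \<subseteq> proj_space n"
      using K by blast
    have "{z \<in> punctured n. proj_pt z \<in> \<Union>K} = (\<Union>S\<in>K. {z \<in> punctured n. proj_pt z \<in> S})"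
      by blast
    moreover have "openin (top_of_set (punctured n)) (\<Union>S\<in>K. {z \<in> punctured n. proj_pt z \<in> S})"
      by (rule openin_Union) (use K in fast)
    ultimately show "openin (top_of_set (punctured n)) {z \<in> punctured n. proj_pt z \<in> \<Union>K}"
      by (simp only:)
  qed
  then show ?thesis
    by (simp add: proj_topology_def topology_inverse')
qed


subsection \<open>Generalized balls and their automorphisms\<close>

definition gball :: "nat \<Rightarrow> nat \<Rightarrow> point set" where
  "gball r s = {proj_pt z | z. z \<in> cspace (r + s) \<and>
     (\<Sum>i<r. (cmod (z i))\<^sup>2) > (\<Sum>i=r..<r+s. (cmod (z i))\<^sup>2)}"

definition gball_boundary :: "nat \<Rightarrow> nat \<Rightarrow> point set" where
  "gball_boundary r s = proj_topology (r + s) frontier_of gball r s"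

text \<open>
  Holomorphic functions on an open subset \<open>W\<close> of \<open>\<complex>\<^sup>n\<close>: continuous and holomorphic in each variable
  separately.
\<close>

definition holomorphic_fun_on :: "nat \<Rightarrow> (nat \<Rightarrow> complex) set \<Rightarrow> ((nat \<Rightarrow> complex) \<Rightarrow> complex) \<Rightarrow> bool" where
  "holomorphic_fun_on n W F \<longleftrightarrow> continuous_on W F \<and>
     (\<forall>z\<in>W. \<forall>i<n. (\<lambda>w. F (z(i := w))) field_differentiable (at (z i)))"

text \<open>
  A map from an open subset \<open>D\<close> of \<open>proj_space n\<close> to \<open>proj_space N\<close> is holomorphic iff it is locally
  given by holomorphic homogeneous coordinates, as functions of the homogeneous coordinates.
\<close>

definition holomorphic_map_on :: "nat \<Rightarrow> nat \<Rightarrow> point set \<Rightarrow> (point \<rightharpoonup> point) \<Rightarrow> bool" where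
  "holomorphic_map_on n N D f \<longleftrightarrow> dom f = D \<and>
     (\<forall>z\<in>punctured n. proj_pt z \<in> D \<longrightarrow>
        (\<exists>W F. openin (top_of_set (punctured n)) W \<and> z \<in> W \<and>
           (\<forall>k<N. holomorphic_fun_on n W (\<lambda>w. F w k)) \<and>
           (\<forall>w\<in>W. F w \<in> punctured N \<and> f (proj_pt w) = Some (proj_pt (F w)))))"

definition Aut :: "nat \<Rightarrow> point set \<Rightarrow> (point \<rightharpoonup> point) set" where
  "Aut n D = {f. holomorphic_map_on n n D f \<and>
     (\<exists>h. holomorphic_map_on n n D h \<and> h \<circ>\<^sub>m f = Some |` D \<and> f \<circ>\<^sub>m h = Some |` D)}"


subsection \<open>Rational maps\<close>

definition homog_tuple :: "nat \<Rightarrow> nat \<Rightarrow> nat \<Rightarrow> complex mpoly list \<Rightarrow> bool" where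
  "homog_tuple n N d gs \<longleftrightarrow>
     length gs = N \<and> (\<forall>p\<in>set gs. homog_poly n d p) \<and> (\<exists>p\<in>set gs. p \<noteq> 0)"

definition eval_tuple :: "complex mpoly list \<Rightarrow> (nat \<Rightarrow> complex) \<Rightarrow> (nat \<Rightarrow> complex)" where
  "eval_tuple gs z = (\<lambda>k. if k < length gs then eval_mpoly (gs ! k) z else 0)"

text \<open>
  The map \<open>[g\<^sub>1, \<dots>, g\<^sub>N]\<close>, undefined exactly where all components vanish.  For homogeneous components
  of equal degree the choice of the representative is immaterial.
\<close>

definition rat_map :: "nat \<Rightarrow> complex mpoly list \<Rightarrow> (point \<rightharpoonup> point)" where
  "rat_map n gs x =
     (let w = eval_tuple gs (SOME z. z \<in> x)
      in if x \<in> proj_space n \<and> w \<in> punctured (length gs) then Some (proj_pt w) else None)"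

definition is_rational_map :: "nat \<Rightarrow> nat \<Rightarrow> (point \<rightharpoonup> point) \<Rightarrow> bool" where
  "is_rational_map n N f \<longleftrightarrow> (\<exists>d gs. homog_tuple n N d gs \<and> f = rat_map n gs)"

text \<open>
  The arguments may also be restrictions of rational maps, such as \<open>A \<circ>\<^sub>m g \<circ>\<^sub>m B\<close> for automorphisms
  \<open>A\<close>, \<open>B\<close> defined on generalized balls only.
\<close>

definition rationally_equivalent :: "nat \<Rightarrow> nat \<Rightarrow> (point \<rightharpoonup> point) \<Rightarrow> (point \<rightharpoonup> point) \<Rightarrow> bool" where
  "rationally_equivalent n N f h \<longleftrightarrow>
     (\<exists>F. is_rational_map n N F \<and> f \<subseteq>\<^sub>m F \<and> h \<subseteq>\<^sub>m F)"

definition no_common_factor :: "complex mpoly list \<Rightarrow> bool" where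
  "no_common_factor gs \<longleftrightarrow> (\<forall>h. (\<forall>p\<in>set gs. h dvd p) \<longrightarrow> h dvd 1)"

text \<open>All components are constant multiples of monomials of degree \<open>d\<close>; some constants may be 0.\<close>

definition monomial_tuple :: "nat \<Rightarrow> nat \<Rightarrow> nat \<Rightarrow> complex mpoly list \<Rightarrow> bool" where
  "monomial_tuple n N d gs \<longleftrightarrow>
     homog_tuple n N d gs \<and> (\<forall>p\<in>set gs. \<exists>e c. p = Poly_Mapping.single e c)"

text \<open>
  This is the indeterminacy locus of \<open>f = [g\<^sub>1, \<dots>, g\<^sub>N]\<close> only if the components have no common factor.
\<close>

definition indeterminacy :: "nat \<Rightarrow> (point \<rightharpoonup> point) \<Rightarrow> point set" where
  "indeterminacy n f = proj_space n - dom f"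

definition rational_gball_map :: "nat \<Rightarrow> nat \<Rightarrow> nat \<Rightarrow> nat \<Rightarrow> (point \<rightharpoonup> point) \<Rightarrow> bool" where
  "rational_gball_map r s r' s' f \<longleftrightarrow> is_rational_map (r + s) (r' + s') f \<and>
     (\<forall>x \<in> gball r s - indeterminacy (r + s) f. the (f x) \<in> gball r' s')"

text \<open>
  Properness on \<open>U \<inter> D\<^sub>r\<^sub>,\<^sub>s\<close>: when points of \<open>U \<inter> D\<^sub>r\<^sub>,\<^sub>s\<close> approach a boundary point lying in \<open>U\<close>, their
  images approach the (compact) boundary of \<open>D\<^sub>r\<^sub>'\<^sub>,\<^sub>s\<^sub>'\<close>, i.e. enter each of its neighbourhoods.
\<close>

definition proper_on :: "nat \<Rightarrow> nat \<Rightarrow> nat \<Rightarrow> nat \<Rightarrow> point set \<Rightarrow> (point \<rightharpoonup> point) \<Rightarrow> bool" where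
  "proper_on r s r' s' U f \<longleftrightarrow>
     (\<forall>x \<in> gball_boundary r s \<inter> U. \<forall>V. openin (proj_topology (r' + s')) V \<and> gball_boundary r' s' \<subseteq> V \<longrightarrow>
        (\<exists>W. openin (proj_topology (r + s)) W \<and> x \<in> W \<and> W \<subseteq> U \<and>
           (\<forall>y \<in> W \<inter> gball r s. the (f y) \<in> V)))"

definition proper_gball_map :: "nat \<Rightarrow> nat \<Rightarrow> nat \<Rightarrow> nat \<Rightarrow> (point \<rightharpoonup> point) \<Rightarrow> bool" where
  "proper_gball_map r s r' s' f \<longleftrightarrow> rational_gball_map r s r' s' f \<and>
     (\<forall>x \<in> gball_boundary r s. \<forall>U.
        openin (proj_topology (r + s)) U \<and> x \<in> U \<and> U \<inter> indeterminacy (r + s) f = {} \<longrightarrow>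
        proper_on r s r' s' U f)"


subsection \<open>The polynomials \<open>P\<close> and \<open>Q\<^sub>P\<close>\<close>

definition is_assoc_poly ::
  "nat \<Rightarrow> nat \<Rightarrow> nat \<Rightarrow> nat \<Rightarrow> complex mpoly list \<Rightarrow> real mpoly \<Rightarrow> bool" where
  "is_assoc_poly r s r' s' gs P \<longleftrightarrow> (\<exists>d. homog_poly (r + s) d P) \<and>
     (\<forall>z\<in>cspace (r + s). eval_mpoly P (\<lambda>i. (cmod (z i))\<^sup>2) =
        (\<Sum>k<r'. (cmod (eval_mpoly (gs ! k) z))\<^sup>2) -
        (\<Sum>k=r'..<r'+s'. (cmod (eval_mpoly (gs ! k) z))\<^sup>2))"

definition hyperplane_form :: "nat \<Rightarrow> nat \<Rightarrow> real mpoly" where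
  "hyperplane_form r s = (\<Sum>j<r. Var j) - (\<Sum>j=r..<r+s. Var j)"

text \<open>
  \<open>P\<close> is determined by \<open>gs\<close>, and \<open>m\<close>, \<open>Q\<close> are determined by \<open>P\<close>: since \<open>Q\<close> does not vanish identically on
  the hyperplane, it is not divisible by \<open>hyperplane_form r s\<close>.
\<close>

definition is_Q_decomp :: "nat \<Rightarrow> nat \<Rightarrow> real mpoly \<Rightarrow> nat \<Rightarrow> real mpoly \<Rightarrow> bool" where
  "is_Q_decomp r s P m Q \<longleftrightarrow>
     m > 0 \<and> P = hyperplane_form r s ^ m * Q \<and> (\<exists>d. homog_poly (r + s) d Q) \<and>
     (\<exists>x. (\<Sum>j<r. x j) = (\<Sum>j=r..<r+s. x j) \<and> eval_mpoly Q x \<noteq> 0)"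

definition nonneg_coeffs :: "real mpoly \<Rightarrow> bool" where
  "nonneg_coeffs Q \<longleftrightarrow> (\<forall>e. Poly_Mapping.lookup Q e \<ge> 0)"

end

theory Submission
  imports Defs "HOL-Computational_Algebra.Polynomial"
begin

text \<open>
  Let \<open>g\<close> be the map and \<open>P\<close> its polynomial in the variables \<open>x\<^sub>i = \<bar>z\<^sub>i\<bar>\<^sup>2\<close> for \<open>i < r\<close> and
  \<open>y\<^sub>j = \<bar>z\<^sub>j\<bar>\<^sup>2\<close> for \<open>r \<le> j < 2 r\<close>, and let \<open>h = \<Sum> x\<^sub>i - \<Sum> y\<^sub>j\<close>.  Every
  component of \<open>g\<close> contributes to one monomial of \<open>P\<close> only, so \<open>P\<close> has at most \<open>r + 1\<close> positive and at
  most \<open>r + 1\<close> negative coefficients.  Properness makes \<open>P\<close> vanish for \<open>h = 0\<close> (\<open>proper_hnorm_zero\<close>), and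
  \<open>P\<close> is positive at the points of the ball where \<open>g\<close> is defined.  As the components have no common
  factor, the latter implies that no variable divides \<open>P\<close> (\<open>P_no_variable\<close>).

  In degree 1 it follows that \<open>P = c h\<close> with \<open>c > 0\<close>, and in degree 2 that \<open>P = h L\<close> with a linear form
  \<open>L\<close>.  In general, let \<open>P = h\<^sup>m Q\<close> with \<open>m \<ge> 1\<close> have degree at least 2, where \<open>Q\<close> is linear or has nonnegative
  coefficients.  A linear \<open>Q\<close> with a negative coefficient has to be positive on all the \<open>x\<close>-variables,
  and then \<open>P\<close> has too many positive terms: all the monomials in the \<open>x\<close>-variables alone and, for \<open>m = 1\<close>,
  the square of some \<open>y\<close>-variable (\<open>linear_multiple_many_terms\<close>).  So \<open>Q\<close> has nonnegative coefficients.  If \<open>m \<ge> 2\<close>, then the part of \<open>P\<close> of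
  highest degree in the \<open>x\<close>-variables, together with the part of lowest degree if \<open>r = m = 2\<close>, has too many
  positive terms (\<open>power_multiple_many_terms\<close>).  If \<open>m = 1\<close>, then sorting the monomials of \<open>Q\<close> by their
  degree in the \<open>x\<close>-variables and following the cancellations in \<open>h Q\<close> shows that \<open>r = 2\<close> and that \<open>Q\<close> is
  proportional to \<open>x\<^sub>i + y\<^sub>j\<close> or to \<open>x\<^sub>0 + x\<^sub>1 + y\<^sub>2 + y\<^sub>3\<close> (theorem \<open>classification\<close>).  In particular the
  degree of \<open>P\<close> is 2.

  It remains to recover \<open>g\<close> from \<open>P\<close>.  Write \<open>g\<close> as \<open>\<Sum>\<^sub>M z\<^sup>M u\<^sub>M\<close> with vectors \<open>u\<^sub>M\<close>.  Since the components are
  monomials, the \<open>u\<^sub>M\<close> are orthogonal for the Hermitian form of signature \<open>(r + 1, r + 1)\<close>, and the norm of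
  \<open>u\<^sub>M\<close> is the coefficient of \<open>P\<close> at \<open>M\<close>.  In degree 1 these norms are \<open>c\<close> or \<open>- c\<close>, and in degree 2 all
  \<open>2 r + 2\<close> components are used up by the terms of \<open>P\<close>; in both cases no \<open>u\<^sub>M\<close> that occurs is isotropic.
  Hence Witt's theorem (\<open>witt_extension\<close>) provides a linear isometry, and with it an automorphism of the
  target, that carries \<open>g\<close> to a multiple of any other such monomial tuple with a proportional polynomial
  (\<open>mono_tuples_isometric\<close>), in particular of the normal form, after a permutation of the variables.
\<close>

section \<open>Polynomials\<close>

abbreviation lookup where "lookup \<equiv> Poly_Mapping.lookup"
abbreviation keys where "keys \<equiv> Poly_Mapping.keys"
abbreviation single where "single \<equiv> Poly_Mapping.single"

text \<open>
  The exponent of the variable numbered \<open>a\<close>.  Monomials are identified with their exponents, which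
  are multiplied by addition.
\<close>

definition unit_mon :: "nat \<Rightarrow> nat \<Rightarrow>\<^sub>0 nat" where
  "unit_mon a = single a 1"

lemma Var_eq_single: "Var a = single (unit_mon a) 1"
  by (simp add: Var_def unit_mon_def)

lemma lookup_unit_mon [simp]: "lookup (unit_mon a) b = (if a = b then 1 else 0)"
  by (simp add: unit_mon_def lookup_single when_def)

lemma keys_unit_mon [simp]: "keys (unit_mon a) = {a}"
  by (simp add: unit_mon_def)

abbreviation mon_eval :: "(nat \<Rightarrow>\<^sub>0 nat) \<Rightarrow> (nat \<Rightarrow> 'a::comm_semiring_1) \<Rightarrow> 'a" where
  "mon_eval e x \<equiv> (\<Prod>i\<in>keys e. x i ^ lookup e i)"

lemma mon_eval_superset:
  assumes "finite I" "keys e \<subseteq> I"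
  shows "mon_eval e (x :: nat \<Rightarrow> 'a::comm_semiring_1) = (\<Prod>i\<in>I. x i ^ lookup e i)"
  using assms by (intro prod.mono_neutral_left) (auto simp: in_keys_iff)

lemma mon_eval_add:
  fixes x :: "nat \<Rightarrow> 'a::comm_semiring_1"
  shows "mon_eval (d + e) x =
    mon_eval d x * mon_eval e x"
proof -
  let ?I = "keys d \<union> keys e"
  have "mon_eval (d + e) x = (\<Prod>i\<in>?I. x i ^ lookup (d + e) i)"
    by (rule mon_eval_superset) (auto simp: Poly_Mapping.keys_add)
  also have "\<dots> = (\<Prod>i\<in>?I. x i ^ lookup d i) * (\<Prod>i\<in>?I. x i ^ lookup e i)"
    by (simp add: lookup_add power_add prod.distrib)
  finally show ?thesis
    by (simp add: mon_eval_superset[of ?I d] mon_eval_superset[of ?I e])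
qed

lemma eval_mpoly_superset:
  assumes "finite A" "keys p \<subseteq> A"
  shows "eval_mpoly p x = (\<Sum>e\<in>A. lookup p e * mon_eval e x)"
  unfolding eval_mpoly_def
  using assms by (intro sum.mono_neutral_left) (auto simp: in_keys_iff)

lemma eval_mpoly_zero [simp]: "eval_mpoly 0 x = 0"
  by (simp add: eval_mpoly_def)

lemma eval_mpoly_single: "eval_mpoly (single e c) x = c * mon_eval e x"
  by (subst eval_mpoly_superset[of "{e}"]) auto

lemma eval_mpoly_Var [simp]: "eval_mpoly (Var i) x = x i"
  by (simp add: Var_def eval_mpoly_single)

lemma eval_mpoly_Const [simp]: "eval_mpoly (Const c) x = c"
  by (simp add: Const_def eval_mpoly_single)

lemma eval_mpoly_one [simp]: "eval_mpoly 1 x = 1"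
  using eval_mpoly_single[of 0 1 x] by simp

lemma eval_mpoly_add [simp]: "eval_mpoly (p + q) x = eval_mpoly p x + eval_mpoly q x"
proof -
  let ?A = "keys p \<union> keys q"
  have "eval_mpoly (p + q) x =
      (\<Sum>e\<in>?A. lookup (p + q) e * mon_eval e x)"
    by (rule eval_mpoly_superset) (auto simp: Poly_Mapping.keys_add)
  then show ?thesis
    by (simp add: lookup_add distrib_right sum.distrib
        eval_mpoly_superset[of ?A p] eval_mpoly_superset[of ?A q])
qed

lemma eval_mpoly_uminus [simp]:
  fixes p :: "'a::comm_ring_1 mpoly"
  shows "eval_mpoly (- p) x = - eval_mpoly p x"
  by (simp add: eval_mpoly_def sum_negf)

lemma eval_mpoly_diff [simp]:
  fixes p :: "'a::comm_ring_1 mpoly"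
  shows "eval_mpoly (p - q) x = eval_mpoly p x - eval_mpoly q x"
  using eval_mpoly_add[of p "- q" x] by simp

lemma eval_mpoly_sum [simp]: "eval_mpoly (\<Sum>a\<in>A. f a) x = (\<Sum>a\<in>A. eval_mpoly (f a) x)"
  by (induction A rule: infinite_finite_induct) auto

lemma mpoly_as_sum: "(\<Sum>e\<in>keys p. single e (lookup p e)) = p"
  by (rule poly_mapping_eqI)
    (auto simp: lookup_sum lookup_single when_def in_keys_iff sum.delta)

lemma eval_mpoly_mult [simp]: "eval_mpoly (p * q) x = eval_mpoly p x * eval_mpoly q x"
proof -
  let ?s = "\<lambda>p e. single e (lookup p e)"
  have "p * q = (\<Sum>d\<in>keys p. ?s p d) * (\<Sum>e\<in>keys q. ?s q e)"
    by (simp only: mpoly_as_sum)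
  also have "\<dots> = (\<Sum>d\<in>keys p. \<Sum>e\<in>keys q. single (d + e) (lookup p d * lookup q e))"
    by (simp add: sum_product mult_single)
  finally show ?thesis
    unfolding eval_mpoly_def[of p] eval_mpoly_def[of q]
    by (simp add: eval_mpoly_single mon_eval_add sum_product mult_ac)
qed

lemma eval_mpoly_power [simp]: "eval_mpoly (p ^ k) x = eval_mpoly p x ^ k"
  by (induction k) auto

lemma mon_degree_superset:
  assumes "finite I" "keys e \<subseteq> I"
  shows "mon_degree e = (\<Sum>i\<in>I. lookup e i)"
  unfolding mon_degree_def
  using assms by (intro sum.mono_neutral_left) (auto simp: in_keys_iff)

lemma mon_degree_add [simp]: "mon_degree (d + e) = mon_degree d + mon_degree e"
  by (simp add: mon_degree_superset[of "keys d \<union> keys e"] Poly_Mapping.keys_add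
      lookup_add sum.distrib)

lemma mon_degree_unit_mon [simp]: "mon_degree (unit_mon a) = 1"
  by (simp add: mon_degree_def)

lemma keys_add_nat: "keys (d + e :: nat \<Rightarrow>\<^sub>0 nat) = keys d \<union> keys e"
  by (auto simp: in_keys_iff lookup_add)

lemma mon_pos_split:
  assumes "lookup M a > 0"
  obtains M' where "M = unit_mon a + M'"
proof -
  have "M = unit_mon a + (M - unit_mon a)"
    using assms by (intro poly_mapping_eqI) (auto simp: lookup_add lookup_minus)
  then show thesis
    using that by blast
qed

lemma mon_degree_Suc_split:
  assumes "mon_degree M = Suc k" "keys M \<subseteq> I"
  obtains a M' where "a \<in> I" "M = unit_mon a + M'" "mon_degree M' = k" "keys M' \<subseteq> I"
proof -
  have "keys M \<noteq> {}"
    using assms(1) by (auto simp: mon_degree_def)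
  then obtain a where "a \<in> keys M" by blast
  moreover from this have "lookup M a > 0"
    by (simp add: in_keys_iff)
  then obtain M' where M': "M = unit_mon a + M'"
    by (rule mon_pos_split)
  ultimately show thesis
    using assms by (intro that[of a M']) (auto simp: keys_add_nat)
qed

lemma mon_degree_0_iff: "mon_degree M = 0 \<longleftrightarrow> M = 0"
proof
  assume "mon_degree M = 0"
  then have "\<forall>i\<in>keys M. lookup M i = 0"
    by (simp add: mon_degree_def)
  then show "M = 0"
    by (intro poly_mapping_eqI) (auto simp: in_keys_iff)
qed (simp add: mon_degree_def)

text \<open>
  The coefficients of \<open>x\<^sub>a q\<close> are those of \<open>q\<close>, moved by the exponent of \<open>x\<^sub>a\<close>.
\<close>

lemma lookup_Var_mult:
  fixes q :: "'a::comm_semiring_1 mpoly"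
  shows "lookup (Var a * q) (unit_mon a + M) = lookup q M"
proof -
  have "Var a * q = (\<Sum>e\<in>keys q. single (unit_mon a + e) (lookup q e))"
    by (subst (1) mpoly_as_sum[of q, symmetric]) (simp add: Var_eq_single sum_distrib_left mult_single)
  then show ?thesis
    by (auto simp: lookup_sum lookup_single when_def in_keys_iff sum.delta)
qed

lemma lookup_Var_mult_eq_0:
  fixes q :: "'a::comm_semiring_1 mpoly"
  assumes "\<And>M'. M' \<in> keys q \<Longrightarrow> M \<noteq> unit_mon a + M'"
  shows "lookup (Var a * q) M = 0"
proof -
  have "Var a * q = (\<Sum>e\<in>keys q. single (unit_mon a + e) (lookup q e))"
    by (subst (1) mpoly_as_sum[of q, symmetric]) (simp add: Var_eq_single sum_distrib_left mult_single)
  moreover have "\<forall>e\<in>keys q. unit_mon a + e \<noteq> M"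
    using assms by blast
  ultimately show ?thesis
    by (simp add: lookup_sum lookup_single when_def)
qed

lemma lookup_Var_mult_cases:
  fixes q :: "'a::comm_semiring_1 mpoly"
  assumes "lookup (Var a * q) M \<noteq> 0"
  obtains M' where "M' \<in> keys q" "M = unit_mon a + M'" "lookup (Var a * q) M = lookup q M'"
  using lookup_Var_mult_eq_0[of q M a] assms lookup_Var_mult[of a q] by metis

subsection \<open>Polynomials that agree on the nonnegative orthant\<close>

lemma univariate_grouped_zero:
  fixes c :: "'a \<Rightarrow> real"
  assumes "finite A" and z: "\<And>t. t \<ge> 0 \<Longrightarrow> (\<Sum>a\<in>A. c a * t ^ f a) = 0"
  shows "(\<Sum>a\<in>{a\<in>A. f a = k}. c a) = 0"
proof -
  define p where "p = (\<Sum>a\<in>A. monom (c a) (f a))"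
  have "poly p t = 0" if "t \<ge> 0" for t
    using z[OF that] by (simp add: p_def poly_sum poly_monom)
  then have "{0..} \<subseteq> {t. poly p t = 0}" by auto
  then have "infinite {t. poly p t = 0}"
    using infinite_Ici[of "0::real"] finite_subset by blast
  then have "p = 0"
    using poly_roots_finite by blast
  then have "coeff p k = 0" by simp
  then show ?thesis
    using assms(1) by (simp add: p_def coeff_sum sum.If_cases Int_def)
qed

text \<open>
  Induction on the number of variables: the last variable splits the sum by its exponent, and each
  part vanishes by the univariate case.
\<close>

lemma multivariate_grouped_zero:
  fixes c :: "'a \<Rightarrow> real" and n :: nat
  assumes "finite A"
    and "\<forall>x. (\<forall>i. x i \<ge> 0) \<longrightarrow> (\<Sum>a\<in>A. c a * (\<Prod>i<n. x i ^ f a i)) = 0"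
  shows "(\<Sum>a\<in>{a\<in>A. \<forall>i<n. f a i = k i}. c a) = 0"
  using assms
proof (induction n arbitrary: A)
  case 0
  from "0.prems"(2)[rule_format, of "\<lambda>_. 0"] show ?case by simp
next
  case (Suc n)
  have "(\<Sum>a\<in>{a\<in>A. f a n = k n}. c a * (\<Prod>i<n. x i ^ f a i)) = 0" if x: "\<And>i. x i \<ge> 0" for x
  proof (rule univariate_grouped_zero[OF Suc.prems(1)])
    fix t :: real assume t: "t \<ge> 0"
    have "(\<Sum>a\<in>A. c a * (\<Prod>i<Suc n. (x(n := t)) i ^ f a i)) = 0"
      using x t by (intro Suc.prems(2)[rule_format]) auto
    then show "(\<Sum>a\<in>A. c a * (\<Prod>i<n. x i ^ f a i) * t ^ f a n) = 0"
      by (simp add: mult_ac)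
  qed
  then have "(\<Sum>a\<in>{a\<in>{a\<in>A. f a n = k n}. \<forall>i<n. f a i = k i}. c a) = 0"
    using Suc.prems(1) by (intro Suc.IH) auto
  moreover have "{a\<in>{a\<in>A. f a n = k n}. \<forall>i<n. f a i = k i} = {a\<in>A. \<forall>i<Suc n. f a i = k i}"
    by (auto simp: less_Suc_eq)
  ultimately show ?case by simp
qed

lemma mpoly_eqI_nonneg_orthant:
  fixes p q :: "real mpoly"
  assumes p: "\<And>e. e \<in> keys p \<Longrightarrow> keys e \<subseteq> {..<n}" and q: "\<And>e. e \<in> keys q \<Longrightarrow> keys e \<subseteq> {..<n}"
    and eq: "\<And>x. (\<And>i. x i \<ge> 0) \<Longrightarrow> (\<And>i. i \<ge> n \<Longrightarrow> x i = 0) \<Longrightarrow> eval_mpoly p x = eval_mpoly q x"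
  shows "p = q"
proof (rule poly_mapping_eqI)
  fix e
  let ?A = "keys p \<union> keys q"
  have keys: "keys d \<subseteq> {..<n}" if "d \<in> ?A" for d
    using that p q by blast
  show "lookup p e = lookup q e"
  proof (cases "e \<in> ?A")
    case True
    have "(\<Sum>d\<in>?A. (lookup p d - lookup q d) * (\<Prod>i<n. x i ^ lookup d i)) = 0"
      if x: "\<And>i. x i \<ge> 0" for x
    proof -
      define y where "y i = (if i < n then x i else 0)" for i
      have "(\<Prod>i<n. x i ^ lookup d i) = (\<Prod>i\<in>keys d. y i ^ lookup d i)" if "d \<in> ?A" for d
        using keys[OF that] by (simp add: mon_eval_superset[of "{..<n}"] y_def)
      then have "(\<Sum>d\<in>?A. (lookup p d - lookup q d) * (\<Prod>i<n. x i ^ lookup d i)) =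
          eval_mpoly p y - eval_mpoly q y"
        by (simp add: eval_mpoly_superset[of ?A] left_diff_distrib sum_subtractf)
      also have "\<dots> = 0"
        using x by (simp add: eq y_def)
      finally show ?thesis .
    qed
    then have "(\<Sum>d\<in>{d\<in>?A. \<forall>i<n. lookup d i = lookup e i}. lookup p d - lookup q d) = 0"
      by (intro multivariate_grouped_zero) auto
    moreover have "d = e" if "d \<in> ?A" "\<forall>i<n. lookup d i = lookup e i" for d
    proof (rule poly_mapping_eqI)
      fix i
      show "lookup d i = lookup e i"
      proof (cases "i < n")
        case False
        then have "i \<notin> keys d" "i \<notin> keys e"
          using keys[OF that(1)] keys[OF True] by auto
        then show ?thesis by (simp add: in_keys_iff)
      qed (use that in auto)
    qed
    then have "{d\<in>?A. \<forall>i<n. lookup d i = lookup e i} = {e}"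
      using True by blast
    ultimately show ?thesis by simp
  qed (auto simp: in_keys_iff)
qed

section \<open>Multiples of the hyperplane form with few terms\<close>

text \<open>
  The degree of a monomial in the first \<open>r\<close> variables, called the \<open>x\<close>-variables; the remaining ones
  are called the \<open>y\<close>-variables.
\<close>

definition xdeg :: "nat \<Rightarrow> (nat \<Rightarrow>\<^sub>0 nat) \<Rightarrow> nat" where
  "xdeg r M = (\<Sum>i<r. lookup M i)"

lemma xdeg_add [simp]: "xdeg r (M + N) = xdeg r M + xdeg r N"
  by (simp add: xdeg_def lookup_add sum.distrib)

lemma xdeg_unit_mon [simp]: "xdeg r (unit_mon a) = (if a < r then 1 else 0)"
  by (simp add: xdeg_def)

text \<open>
  The monomials that occur in \<open>P\<close> with a positive, respectively a negative, coefficient.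
\<close>

definition pos_terms :: "real mpoly \<Rightarrow> (nat \<Rightarrow>\<^sub>0 nat) set" where
  "pos_terms P = {M. lookup P M > 0}"

definition neg_terms :: "real mpoly \<Rightarrow> (nat \<Rightarrow>\<^sub>0 nat) set" where
  "neg_terms P = {M. lookup P M < 0}"

lemma finite_pos_terms [simp]: "finite (pos_terms P)"
  by (rule finite_subset[of _ "keys P"]) (auto simp: pos_terms_def in_keys_iff)

lemma finite_neg_terms [simp]: "finite (neg_terms P)"
  by (rule finite_subset[of _ "keys P"]) (auto simp: neg_terms_def in_keys_iff)

lemma lookup_hyperplane_mult:
  "lookup (hyperplane_form r s * Q) M =
    (\<Sum>i<r. lookup (Var i * Q) M) - (\<Sum>j=r..<r+s. lookup (Var j * Q) M)"
  by (simp add: hyperplane_form_def left_diff_distrib sum_distrib_right lookup_minus lookup_sum)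

lemma lookup_Var_mult_nonneg:
  assumes "\<And>M. lookup (Q :: real mpoly) M \<ge> 0"
  shows "lookup (Var a * Q) M \<ge> 0"
proof (cases "lookup (Var a * Q) M = 0")
  case False
  then show ?thesis
    by (rule lookup_Var_mult_cases) (simp add: assms)
qed simp

text \<open>
  For \<open>Q\<close> with nonnegative coefficients, a term \<open>x\<^sub>i M\<close> of the product with \<open>\<Sum> x\<^sub>i - \<Sum> y\<^sub>j\<close> can only
  be cancelled by a term \<open>y\<^sub>j M'\<close>.
\<close>

lemma pos_term_hyperplane_mult:
  assumes nonneg: "\<And>M. lookup Q M \<ge> 0" and M: "M \<in> keys Q" and "i < r"
    and no: "\<And>j M'. \<lbrakk>r \<le> j; j < r + s; M' \<in> keys Q\<rbrakk> \<Longrightarrow> unit_mon i + M \<noteq> unit_mon j + M'"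
  shows "unit_mon i + M \<in> pos_terms (hyperplane_form r s * Q)"
proof -
  have "(\<Sum>j=r..<r+s. lookup (Var j * Q) (unit_mon i + M)) = 0"
    using no by (intro sum.neutral ballI lookup_Var_mult_eq_0) auto
  moreover have "lookup (Var i * Q) (unit_mon i + M) \<le> (\<Sum>i'<r. lookup (Var i' * Q) (unit_mon i + M))"
    using \<open>i < r\<close> by (intro member_le_sum) (auto intro: lookup_Var_mult_nonneg nonneg)
  moreover have "lookup Q M > 0"
    using M nonneg[of M] by (simp add: in_keys_iff)
  ultimately show ?thesis
    by (simp add: pos_terms_def lookup_hyperplane_mult lookup_Var_mult)
qed

lemma neg_term_hyperplane_mult:
  assumes nonneg: "\<And>M. lookup Q M \<ge> 0" and M: "M \<in> keys Q" and j: "r \<le> j" "j < r + s"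
    and no: "\<And>i M'. \<lbrakk>i < r; M' \<in> keys Q\<rbrakk> \<Longrightarrow> unit_mon j + M \<noteq> unit_mon i + M'"
  shows "unit_mon j + M \<in> neg_terms (hyperplane_form r s * Q)"
proof -
  have "(\<Sum>i<r. lookup (Var i * Q) (unit_mon j + M)) = 0"
    using no by (intro sum.neutral ballI lookup_Var_mult_eq_0) auto
  moreover have "lookup (Var j * Q) (unit_mon j + M) \<le>
      (\<Sum>j'=r..<r+s. lookup (Var j' * Q) (unit_mon j + M))"
    using j by (intro member_le_sum) (auto intro: lookup_Var_mult_nonneg nonneg)
  moreover have "lookup Q M > 0"
    using M nonneg[of M] by (simp add: in_keys_iff)
  ultimately show ?thesis
    by (simp add: neg_terms_def lookup_hyperplane_mult lookup_Var_mult)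
qed

lemma mon_eq_lookup: "M = (N :: nat \<Rightarrow>\<^sub>0 nat) \<Longrightarrow> lookup M v = lookup N v"
  by simp

lemma at_most_one_outside:
  assumes "finite P" "card P \<le> Suc n" "A \<subseteq> P" "card A = n" "x \<in> P - A" "y \<in> P - A"
  shows "x = y"
proof (rule ccontr)
  assume "x \<noteq> y"
  have "finite A"
    using assms finite_subset by blast
  then have "card (insert x (insert y A)) = Suc (Suc n)"
    using assms \<open>x \<noteq> y\<close> by (simp add: card_insert_if)
  moreover have "insert x (insert y A) \<subseteq> P"
    using assms by auto
  ultimately show False
    using card_mono[OF assms(1), of "insert x (insert y A)"] assms(2) by simp
qed

text \<open>
  A nonconstant polynomial \<open>Q\<close> with nonnegative coefficients and not divisible by any variable, such
  that its product with the form \<open>\<Sum> x\<^sub>i - \<Sum> y\<^sub>j\<close> has at most \<open>r + 1\<close> positive and at most \<open>r + 1\<close>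
  negative terms.  The analysis below sorts the monomials of \<open>Q\<close> by their degree in the
  \<open>x\<close>-variables, called their level.  For a monomial \<open>M\<close> of the top level the \<open>r\<close> terms \<open>x\<^sub>i M\<close> survive
  with a positive sign, and for one of the bottom level the \<open>r\<close> terms \<open>y\<^sub>j M\<close> survive with a negative
  sign.  So only one further positive and one further negative term are left for all the
  cancellations between consecutive levels.
\<close>

locale few_term_multiple =
  fixes r :: nat and Q :: "real mpoly"
  assumes r: "r \<ge> 2"
    and nonneg: "\<And>M. lookup Q M \<ge> 0"
    and card_pos: "card (pos_terms (hyperplane_form r r * Q)) \<le> r + 1"
    and card_neg: "card (neg_terms (hyperplane_form r r * Q)) \<le> r + 1"
    and vars: "\<And>M. M \<in> keys Q \<Longrightarrow> keys M \<subseteq> {..<2*r}"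
    and no_var: "\<And>a. a < 2 * r \<Longrightarrow> \<exists>M\<in>keys Q. lookup M a = 0"
    and nonconst: "keys Q \<noteq> {0}" and nonzero: "keys Q \<noteq> {}"
begin

abbreviation Pos where "Pos \<equiv> pos_terms (hyperplane_form r r * Q)"
abbreviation Neg where "Neg \<equiv> neg_terms (hyperplane_form r r * Q)"

lemma Pos_or_cancelled:
  assumes "M \<in> keys Q" "i < r" "unit_mon i + M \<notin> Pos"
  obtains j M' where "r \<le> j" "j < 2 * r" "M' \<in> keys Q" "unit_mon i + M = unit_mon j + M'"
    "xdeg r M' = Suc (xdeg r M)"
proof -
  have "\<exists>j M'. r \<le> j \<and> j < r + r \<and> M' \<in> keys Q \<and> unit_mon i + M = unit_mon j + M'"
    using pos_term_hyperplane_mult[OF nonneg assms(1,2), of r] assms(3) by blast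
  then obtain j M' where *: "r \<le> j" "j < r + r" "M' \<in> keys Q" "unit_mon i + M = unit_mon j + M'"
    by blast
  from arg_cong[OF *(4), of "xdeg r"] have "xdeg r M' = Suc (xdeg r M)"
    using *(1) assms(2) by simp
  then show thesis
    using *(1,2) by (intro that[OF _ _ *(3,4)]) simp_all
qed

lemma Neg_or_cancelled:
  assumes "M \<in> keys Q" "r \<le> j" "j < 2 * r" "unit_mon j + M \<notin> Neg"
  obtains i M' where "i < r" "M' \<in> keys Q" "unit_mon j + M = unit_mon i + M'"
    "xdeg r M = Suc (xdeg r M')"
proof -
  have j: "j < r + r"
    using assms(3) by simp
  have "\<exists>i M'. i < r \<and> M' \<in> keys Q \<and> unit_mon j + M = unit_mon i + M'"
    using neg_term_hyperplane_mult[OF nonneg assms(1,2) j] assms(4) by blast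
  then obtain i M' where *: "i < r" "M' \<in> keys Q" "unit_mon j + M = unit_mon i + M'"
    by blast
  from arg_cong[OF *(3), of "xdeg r"] have "xdeg r M = Suc (xdeg r M')"
    using *(1) assms(2) by simp
  then show thesis
    by (intro that[OF *])
qed

text \<open>
  The top and the bottom level.
\<close>

definition xtop where "xtop = Max (xdeg r ` keys Q)"
definition xbot where "xbot = Min (xdeg r ` keys Q)"

lemma le_top: "M \<in> keys Q \<Longrightarrow> xdeg r M \<le> xtop"
  by (simp add: xtop_def)

lemma bot_le: "M \<in> keys Q \<Longrightarrow> xbot \<le> xdeg r M"
  by (simp add: xbot_def)

lemma top_attained: obtains M where "M \<in> keys Q" "xdeg r M = xtop"
proof -
  have "xtop \<in> xdeg r ` keys Q"
    unfolding xtop_def by (rule Max_in) (use nonzero in auto)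
  then show thesis
    by (rule imageE) (simp add: that)
qed

lemma bot_attained: obtains M where "M \<in> keys Q" "xdeg r M = xbot"
proof -
  have "xbot \<in> xdeg r ` keys Q"
    unfolding xbot_def by (rule Min_in) (use nonzero in auto)
  then show thesis
    by (rule imageE) (simp add: that)
qed

lemma top_Pos:
  assumes "M \<in> keys Q" "xdeg r M = xtop" "i < r"
  shows "unit_mon i + M \<in> Pos"
proof (rule ccontr)
  assume "unit_mon i + M \<notin> Pos"
  from assms(1,3) this show False
  proof (rule Pos_or_cancelled)
    fix M' assume "M' \<in> keys Q" "xdeg r M' = Suc (xdeg r M)"
    then show False using le_top[of M'] assms(2) by simp
  qed
qed

lemma bot_Neg:
  assumes "M \<in> keys Q" "xdeg r M = xbot" "r \<le> j" "j < 2 * r"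
  shows "unit_mon j + M \<in> Neg"
proof (rule ccontr)
  assume "unit_mon j + M \<notin> Neg"
  from assms(1,3,4) this show False
  proof (rule Neg_or_cancelled)
    fix M' assume "M' \<in> keys Q" "xdeg r M = Suc (xdeg r M')"
    then show False using bot_le[of M'] assms(2) by simp
  qed
qed

lemma unit_mon_add_inj: "inj_on (\<lambda>a. unit_mon a + M) A"
proof (rule inj_onI)
  fix a b assume "unit_mon a + M = unit_mon b + M"
  then have "lookup (unit_mon a) a = lookup (unit_mon b) a" by simp
  then show "a = b" by (simp split: if_splits)
qed

lemma extra_Pos_unique:
  assumes "M \<in> keys Q" "xdeg r M = xtop"
    and "x \<in> Pos" "x \<notin> (\<lambda>i. unit_mon i + M) ` {..<r}"
    and "y \<in> Pos" "y \<notin> (\<lambda>i. unit_mon i + M) ` {..<r}"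
  shows "x = y"
proof (rule at_most_one_outside)
  show "card ((\<lambda>i. unit_mon i + M) ` {..<r}) = r"
    by (simp add: card_image unit_mon_add_inj)
qed (use assms card_pos top_Pos in auto)

lemma extra_Neg_unique:
  assumes "x \<in> Neg" "xdeg r x \<noteq> xbot" "y \<in> Neg" "xdeg r y \<noteq> xbot"
  shows "x = y"
proof -
  obtain M where M: "M \<in> keys Q" "xdeg r M = xbot"
    by (rule bot_attained)
  show ?thesis
  proof (rule at_most_one_outside)
    show "card ((\<lambda>j. unit_mon j + M) ` {r..<2*r}) = r"
      by (simp add: card_image unit_mon_add_inj)
  qed (use assms card_neg bot_Neg M in auto)
qed

end

context few_term_multiple
begin

lemma mon_left_cancel:
  fixes a b M N :: "nat \<Rightarrow>\<^sub>0 nat"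
  assumes "a + M = b + (a + N)"
  shows "M = b + N"
proof -
  have "a + M = a + (b + N)"
    using assms by (simp only: ac_simps)
  then show ?thesis by simp
qed

lemma two_others:
  fixes n i :: nat
  assumes "n \<ge> 3"
  obtains k l where "k < n" "k \<noteq> i" "l < n" "l \<noteq> i" "k \<noteq> l"
proof (cases "i = 0")
  case True
  then show thesis using assms by (intro that[of 1 2]) auto
next
  case False
  then show thesis using assms by (intro that[of 0 "if i = 1 then 2 else 1"]) auto
qed

lemma no_var_mon:
  assumes "M \<in> keys Q" "\<And>a. a < 2 * r \<Longrightarrow> lookup M a = 0"
  shows "M = 0"
proof (rule poly_mapping_eqI)
  fix a
  show "lookup M a = lookup 0 a"
    using assms(2)[of a] vars[OF assms(1)] by (cases "a < 2 * r") (auto simp: in_keys_iff subset_eq)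
qed

text \<open>
  If \<open>M0\<close> is alone on its level and the term \<open>y\<^sub>j M0\<close> is not negative, then it equals some \<open>x\<^sub>i M\<close>
  with \<open>M\<close> one level below.  The other products of \<open>M\<close> with \<open>x\<close>-variables survive: they could be
  cancelled only by products of \<open>M0\<close> with a \<open>y\<close>-variable, and these all have the same \<open>x\<close>-part.
\<close>

lemma cancelled_level:
  assumes M0: "M0 \<in> keys Q"
    and uniq: "\<And>M. \<lbrakk>M \<in> keys Q; xdeg r M = xdeg r M0\<rbrakk> \<Longrightarrow> M = M0"
    and j: "r \<le> j" "j < 2 * r" and "unit_mon j + M0 \<notin> Neg"
  obtains i M where "i < r" "M \<in> keys Q" "unit_mon j + M0 = unit_mon i + M"
    "xdeg r M0 = Suc (xdeg r M)"
    "\<And>i'. \<lbrakk>i' < r; i' \<noteq> i\<rbrakk> \<Longrightarrow> unit_mon i' + M \<in> Pos"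
proof -
  from M0 j \<open>unit_mon j + M0 \<notin> Neg\<close> obtain i M where iM: "i < r" "M \<in> keys Q"
    "unit_mon j + M0 = unit_mon i + M" "xdeg r M0 = Suc (xdeg r M)"
    by (rule Neg_or_cancelled)
  show thesis
  proof (rule that[OF iM])
    fix i' assume i': "i' < r" "i' \<noteq> i"
    show "unit_mon i' + M \<in> Pos"
    proof (rule ccontr)
      assume "unit_mon i' + M \<notin> Pos"
      with iM(2) i'(1) obtain j' M' where j': "r \<le> j'" "j' < 2 * r" "M' \<in> keys Q"
        "unit_mon i' + M = unit_mon j' + M'" "xdeg r M' = Suc (xdeg r M)"
        by (rule Pos_or_cancelled)
      have "M' = M0"
        using uniq[OF j'(3)] j'(5) iM(4) by simp
      with mon_eq_lookup[OF j'(4), of i] mon_eq_lookup[OF iM(3), of i] i' iM(1) j(1) j'(1)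
      show False by (simp add: lookup_add split: if_splits)
    qed
  qed
qed

text \<open>
  If the top level consists of a single monomial \<open>M0\<close>, then \<open>Q = c (x\<^sub>i + y\<^sub>j)\<close>.
\<close>

lemma single_top:
  assumes M0: "M0 \<in> keys Q" "xdeg r M0 = xtop"
    and uniq: "\<And>M. \<lbrakk>M \<in> keys Q; xdeg r M = xtop\<rbrakk> \<Longrightarrow> M = M0"
  shows "r = 2 \<and> (\<exists>i j c. i < 2 \<and> 2 \<le> j \<and> j < 4 \<and> c > 0 \<and>
    (\<forall>M. lookup Q M = (if M = unit_mon i \<or> M = unit_mon j then c else 0)))"
proof -
  have uniq': "M = M0" if "M \<in> keys Q" "xdeg r M = xdeg r M0" for M
    using uniq that M0(2) by simp
  have "xbot \<noteq> xtop"
  proof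
    assume eq: "xbot = xtop"
    have "M = M0" if "M \<in> keys Q" for M
      using uniq[OF that] bot_le[OF that] le_top[OF that] eq by simp
    then have "keys Q = {M0}"
      using M0(1) by blast
    moreover from this have "M0 = 0"
      using no_var by (intro no_var_mon) auto
    ultimately show False
      using nonconst by simp
  qed
  define PA where "PA = (\<lambda>i. unit_mon i + M0) ` {..<r}"
  have xdeg_PA: "xdeg r M = Suc xtop" if "M \<in> PA" for M
    using that M0(2) by (auto simp: PA_def)
  have extra_Pos: "x = y" if "x \<in> Pos" "xdeg r x \<noteq> Suc xtop" "y \<in> Pos" "xdeg r y \<noteq> Suc xtop" for x y
    using extra_Pos_unique[OF M0, folded PA_def, of x y] that xdeg_PA by blast
  \<comment> \<open>At most one of the terms \<open>y\<^sub>j M0\<close> is negative, since they lie above the bottom level.\<close>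
  have "\<exists>j0. r \<le> j0 \<and> j0 < 2 * r \<and> unit_mon j0 + M0 \<notin> Neg"
  proof (rule ccontr)
    assume "\<nexists>j0. r \<le> j0 \<and> j0 < 2 * r \<and> unit_mon j0 + M0 \<notin> Neg"
    then have "unit_mon r + M0 \<in> Neg" "unit_mon (Suc r) + M0 \<in> Neg"
      using r by auto
    then have "unit_mon r + M0 = unit_mon (Suc r) + M0"
      using \<open>xbot \<noteq> xtop\<close> M0(2) by (intro extra_Neg_unique) auto
    from mon_eq_lookup[OF this, of r] show False by (simp add: lookup_add)
  qed
  then obtain j0 where j0: "r \<le> j0" "j0 < 2 * r" "unit_mon j0 + M0 \<notin> Neg"
    by blast
  with M0(1) uniq' obtain i0 M1 where i0: "i0 < r" and M1: "M1 \<in> keys Q"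
    and eq0: "unit_mon j0 + M0 = unit_mon i0 + M1" and xdeg_M1: "xdeg r M0 = Suc (xdeg r M1)"
    and posM1: "\<And>i'. \<lbrakk>i' < r; i' \<noteq> i0\<rbrakk> \<Longrightarrow> unit_mon i' + M1 \<in> Pos"
    by (rule cancelled_level) blast+
  have "r = 2"
  proof (rule ccontr)
    assume "r \<noteq> 2"
    with r have "r \<ge> 3" by simp
    then obtain i' i'' where i': "i' < r" "i' \<noteq> i0" and i'': "i'' < r" "i'' \<noteq> i0" "i' \<noteq> i''"
      by (rule two_others)
    have "unit_mon i' + M1 = unit_mon i'' + M1"
      using posM1 i' i'' xdeg_M1 M0(2) by (intro extra_Pos) auto
    from mon_eq_lookup[OF this, of i'] i''(3) show False by (simp add: lookup_add)
  qed
  \<comment> \<open>The other variables: \<open>{i0, i1} = {0, 1}\<close> and \<open>{j0, j1} = {2, 3}\<close>.\<close>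
  define i1 :: nat where "i1 = 1 - i0"
  define j1 :: nat where "j1 = 5 - j0"
  have i1: "i1 < r" "i1 \<noteq> i0" and i01: "\<And>i. i < r \<longleftrightarrow> i = i0 \<or> i = i1"
    using i0 unfolding i1_def \<open>r = 2\<close> by presburger+
  have j1: "r \<le> j1" "j1 < 2 * r" "j1 \<noteq> j0" and j01: "\<And>j. r \<le> j \<and> j < 2 * r \<longleftrightarrow> j = j0 \<or> j = j1"
    using j0(1,2) unfolding j1_def \<open>r = 2\<close> by presburger+
  have ij: "i0 \<noteq> j0" "i0 \<noteq> j1" "i1 \<noteq> j0" "i1 \<noteq> j1"
    using i0 i1 j0 j1 by auto
  \<comment> \<open>The one further positive term is \<open>x\<^sub>i\<^sub>1 M1\<close>, and the one further negative term is \<open>y\<^sub>j\<^sub>1 M0\<close>.\<close>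
  have Z: "x = unit_mon i1 + M1" if "x \<in> Pos" "xdeg r x \<noteq> Suc xtop" for x
    using extra_Pos[OF that posM1[OF i1]] xdeg_M1 M0(2) i1(1) by simp
  have negj1: "unit_mon j1 + M0 \<in> Neg"
  proof (rule ccontr)
    assume "unit_mon j1 + M0 \<notin> Neg"
    with M0(1) uniq' j1(1,2) obtain i M where i: "i < r" and M: "M \<in> keys Q"
      and eq: "unit_mon j1 + M0 = unit_mon i + M" and xdeg_M: "xdeg r M0 = Suc (xdeg r M)"
      and pos: "\<And>i'. \<lbrakk>i' < r; i' \<noteq> i\<rbrakk> \<Longrightarrow> unit_mon i' + M \<in> Pos"
      by (rule cancelled_level) blast+
    define i' where "i' = 1 - i"
    have i': "i' < r" "i' \<noteq> i"
      using i unfolding i'_def \<open>r = 2\<close> by presburger+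
    have "unit_mon i' + M = unit_mon i1 + M1"
      using pos[OF i'] xdeg_M M0(2) i' by (intro Z) auto
    from mon_eq_lookup[OF this, of j0] mon_eq_lookup[OF eq, of j0] mon_eq_lookup[OF eq0, of j0]
    show False using ij i i' j0 j1 by (auto simp: lookup_add split: if_splits)
  qed
  have extra_Neg: "x = unit_mon j1 + M0" if "x \<in> Neg" "xdeg r x \<noteq> xbot" for x
    using extra_Neg_unique[OF that negj1] \<open>xbot \<noteq> xtop\<close> M0(2) j1(1) by simp
  have uniq1: "M = M1" if M: "M \<in> keys Q" "xdeg r M = xdeg r M1" for M
  proof -
    have step: "unit_mon i + M = unit_mon i1 + M1 \<or> (\<exists>j. r \<le> j \<and> j < 2 * r \<and> unit_mon i + M = unit_mon j + M0)"
      if i: "i < r" for i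
    proof (cases "unit_mon i + M \<in> Pos")
      case True
      then show ?thesis
        using Z[OF True] M(2) xdeg_M1 M0(2) i by simp
    next
      case False
      with M(1) i obtain j M' where jM: "r \<le> j" "j < 2 * r" "M' \<in> keys Q"
        "unit_mon i + M = unit_mon j + M'" "xdeg r M' = Suc (xdeg r M)"
        by (rule Pos_or_cancelled)
      then have "M' = M0"
        using uniq' M(2) xdeg_M1 by simp
      then show ?thesis
        using jM by blast
    qed
    have e0: "lookup M0 i0 = Suc (lookup M1 i0)" "lookup M0 i1 = lookup M1 i1"
      using mon_eq_lookup[OF eq0, of i0] mon_eq_lookup[OF eq0, of i1] ij i1 j0
      by (auto simp: lookup_add)
    from step[OF i1(1)] show ?thesis
    proof (elim disjE exE conjE)
      assume "unit_mon i1 + M = unit_mon i1 + M1"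
      then show ?thesis by simp
    next
      fix j assume j: "r \<le> j" "j < 2 * r" and eq: "unit_mon i1 + M = unit_mon j + M0"
      have ji: "j \<noteq> i0" "j \<noteq> i1" using j i0 i1 by auto
      from mon_eq_lookup[OF eq, of i0] mon_eq_lookup[OF eq, of i1]
      have e1: "lookup M i0 = lookup M0 i0" "Suc (lookup M i1) = lookup M0 i1"
        using ji i1 by (auto simp: lookup_add)
      from step[OF i0] show ?thesis
      proof (elim disjE exE conjE)
        assume eq': "unit_mon i0 + M = unit_mon i1 + M1"
        from mon_eq_lookup[OF eq', of i0] e0 e1 i1(2) show ?thesis
          by (simp add: lookup_add)
      next
        fix j' assume j': "r \<le> j'" "j' < 2 * r" and eq': "unit_mon i0 + M = unit_mon j' + M0"
        have ji': "j' \<noteq> i0" using j' i0 by auto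
        from mon_eq_lookup[OF eq', of i0] e1 ji' show ?thesis
          by (simp add: lookup_add)
      qed
    qed
  qed
  \<comment> \<open>The term \<open>y\<^sub>j\<^sub>0 M0 = x\<^sub>i\<^sub>0 M1\<close> has to cancel completely.\<close>
  have "lookup Q M1 = lookup Q M0"
  proof -
    have "unit_mon j0 + M0 \<notin> Pos"
    proof
      assume "unit_mon j0 + M0 \<in> Pos"
      then have "unit_mon j0 + M0 = unit_mon i1 + M1"
        using M0(2) j0(1) by (intro Z) auto
      with eq0 have "unit_mon i0 + M1 = unit_mon i1 + M1" by simp
      from mon_eq_lookup[OF this, of i0] i1(2) show False by (simp add: lookup_add)
    qed
    with j0(3) have "lookup (hyperplane_form r r * Q) (unit_mon j0 + M0) = 0"
      by (simp add: pos_terms_def neg_terms_def)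
    moreover have "lookup (Var i1 * Q) (unit_mon j0 + M0) = 0"
    proof (rule lookup_Var_mult_eq_0)
      fix M' assume M': "M' \<in> keys Q"
      show "unit_mon j0 + M0 \<noteq> unit_mon i1 + M'"
      proof
        assume eq: "unit_mon j0 + M0 = unit_mon i1 + M'"
        from arg_cong[OF eq, of "xdeg r"] have "xdeg r M' = xdeg r M1"
          using xdeg_M1 i1 j0 by simp
        then have "M' = M1" by (rule uniq1[OF M'])
        with mon_eq_lookup[OF eq, of i0] mon_eq_lookup[OF eq0, of i0] i1(2) show False
          by (simp add: lookup_add)
      qed
    qed
    moreover have "lookup (Var j1 * Q) (unit_mon j0 + M0) = 0"
    proof (rule lookup_Var_mult_eq_0)
      fix M' assume M': "M' \<in> keys Q"
      show "unit_mon j0 + M0 \<noteq> unit_mon j1 + M'"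
      proof
        assume eq: "unit_mon j0 + M0 = unit_mon j1 + M'"
        from arg_cong[OF eq, of "xdeg r"] have "xdeg r M' = xdeg r M0"
          using j1 j0 by simp
        then have "M' = M0" by (rule uniq'[OF M'])
        with mon_eq_lookup[OF eq, of j0] j1(3) show False
          by (simp add: lookup_add)
      qed
    qed
    moreover have "{..<r} = {i0, i1}"
      using i01 by blast
    moreover have "x \<in> {r..<r+r} \<longleftrightarrow> x \<in> {j0, j1}" for x
      using j01[of x] by (simp add: mult_2)
    then have "{r..<r+r} = {j0, j1}"
      by blast
    ultimately show ?thesis
      using i1(2) j1(3) by (simp add: lookup_hyperplane_mult lookup_Var_mult)
        (simp add: eq0 lookup_Var_mult)
  qed
  \<comment> \<open>If there were a third level, the cancellation of \<open>y\<^sub>j\<^sub>0 M1\<close> would create one more positive term.\<close>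
  have "xdeg r M1 = xbot"
  proof (rule ccontr)
    assume nb: "xdeg r M1 \<noteq> xbot"
    have "unit_mon j0 + M1 \<notin> Neg"
    proof
      assume "unit_mon j0 + M1 \<in> Neg"
      then have "unit_mon j0 + M1 = unit_mon j1 + M0"
        using nb j0 by (intro extra_Neg) auto
      from arg_cong[OF this, of "xdeg r"] show False
        using xdeg_M1 j0 j1 by simp
    qed
    with M1 uniq1 j0(1,2) obtain i M where i: "i < r" and M: "M \<in> keys Q"
      and eq: "unit_mon j0 + M1 = unit_mon i + M" and xdeg_M: "xdeg r M1 = Suc (xdeg r M)"
      and pos: "\<And>i'. \<lbrakk>i' < r; i' \<noteq> i\<rbrakk> \<Longrightarrow> unit_mon i' + M \<in> Pos"
      by (rule cancelled_level) blast+
    define i' where "i' = 1 - i"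
    have i': "i' < r" "i' \<noteq> i"
      using i unfolding i'_def \<open>r = 2\<close> by presburger+
    have "unit_mon i' + M = unit_mon i1 + M1"
      using pos[OF i'] xdeg_M xdeg_M1 M0(2) i' by (intro Z) auto
    from arg_cong[OF this, of "xdeg r"] show False
      using xdeg_M i' i1 by simp
  qed
  have keysQ: "keys Q = {M0, M1}"
  proof (intro equalityI subsetI)
    fix M assume M: "M \<in> keys Q"
    have "xdeg r M = xdeg r M0 \<or> xdeg r M = xdeg r M1"
      using le_top[OF M] bot_le[OF M] \<open>xdeg r M1 = xbot\<close> xdeg_M1 M0(2) by linarith
    then show "M \<in> {M0, M1}"
      using uniq' uniq1 M by blast
  qed (use M0 M1 in auto)
  have novar: "lookup M0 a = 0 \<or> lookup M1 a = 0" if "a < 2 * r" for a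
    using no_var[OF that] keysQ by auto
  have "M0 = unit_mon i0 \<and> M1 = unit_mon j0"
  proof -
    have "lookup M0 i0 > 0"
      using mon_eq_lookup[OF eq0, of i0] ij(1) by (simp add: lookup_add)
    then obtain \<mu> where \<mu>: "M0 = unit_mon i0 + \<mu>"
      by (rule mon_pos_split)
    with eq0 have M1': "M1 = unit_mon j0 + \<mu>"
      by (simp add: add.left_commute)
    have "lookup \<mu> a = 0" for a
    proof (cases "a < 2 * r")
      case True
      then show ?thesis
        using novar[OF True] by (auto simp: \<mu> M1' lookup_add)
    next
      case False
      then show ?thesis
        using vars[OF M0(1)] by (auto simp: \<mu> keys_add_nat in_keys_iff)
    qed
    then have "\<mu> = 0"
      by (intro poly_mapping_eqI) simp
    then show ?thesis
      by (simp add: \<mu> M1')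
  qed
  then have keysQ': "keys Q = {unit_mon i0, unit_mon j0}" and "lookup Q (unit_mon i0) = lookup Q (unit_mon j0)"
    using keysQ \<open>lookup Q M1 = lookup Q M0\<close> by auto
  moreover have "lookup Q (unit_mon i0) > 0"
    using keysQ' nonneg[of "unit_mon i0"] in_keys_iff[of "unit_mon i0" Q] by fastforce
  moreover have "lookup Q M = 0" if "M \<noteq> unit_mon i0" "M \<noteq> unit_mon j0" for M
    using keysQ' that in_keys_iff[of M Q] by auto
  ultimately have "\<forall>M. lookup Q M =
      (if M = unit_mon i0 \<or> M = unit_mon j0 then lookup Q (unit_mon i0) else 0)"
    by auto
  moreover have "i0 < 2" "2 \<le> j0" "j0 < 4"
    using \<open>r = 2\<close> i0 j0(1,2) by auto
  ultimately show ?thesis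
    using \<open>r = 2\<close> \<open>lookup Q (unit_mon i0) > 0\<close> by blast
qed

text \<open>
  Two monomials \<open>M0\<close>, \<open>M1\<close> on the top level yield at least \<open>2 r - 1\<close> positive terms, because
  \<open>x\<^sub>i M1 = x\<^sub>k M0\<close> determines \<open>i\<close> and \<open>k\<close>.
\<close>

lemma double_top_shape:
  assumes M0: "M0 \<in> keys Q" "xdeg r M0 = xtop" and M1: "M1 \<in> keys Q" "xdeg r M1 = xtop"
    and "M0 \<noteq> M1"
  obtains \<mu> where "r = 2" "unit_mon 0 + \<mu> \<in> keys Q" "unit_mon 1 + \<mu> \<in> keys Q" "Suc (xdeg r \<mu>) = xtop"
proof -
  define PA where "PA = (\<lambda>i. unit_mon i + M0) ` {..<r}"
  have extra: "unit_mon i + M1 \<in> PA \<or> unit_mon k + M1 \<in> PA" if ik: "i < r" "k < r" "i \<noteq> k" for i k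
  proof (rule ccontr)
    assume no: "\<not> (unit_mon i + M1 \<in> PA \<or> unit_mon k + M1 \<in> PA)"
    have "unit_mon i + M1 = unit_mon k + M1"
      using extra_Pos_unique[OF M0, folded PA_def, of "unit_mon i + M1" "unit_mon k + M1"]
        no top_Pos[OF M1] ik by blast
    from mon_eq_lookup[OF this, of i] ik(3) show False by (simp add: lookup_add)
  qed
  have "unit_mon 0 + M1 \<in> PA \<or> unit_mon 1 + M1 \<in> PA"
    using r by (intro extra) auto
  moreover have "0 < r" "1 < r"
    using r by auto
  ultimately obtain i where i: "i < r" "unit_mon i + M1 \<in> PA"
    by blast
  then obtain i' where i': "i' < r" "unit_mon i + M1 = unit_mon i' + M0"
    by (auto simp: PA_def)
  have ne: "i \<noteq> i'"
    using i'(2) \<open>M0 \<noteq> M1\<close> by auto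
  have only: "k = i" if k: "k < r" "unit_mon k + M1 \<in> PA" for k
  proof -
    obtain k' where k': "k' < r" "unit_mon k + M1 = unit_mon k' + M0"
      using k by (auto simp: PA_def)
    show "k = i"
      using mon_eq_lookup[OF i'(2), of i] mon_eq_lookup[OF k'(2), of i] ne
      by (auto simp: lookup_add split: if_splits)
  qed
  have "r = 2"
  proof (rule ccontr)
    assume "r \<noteq> 2"
    with r have "r \<ge> 3" by simp
    then obtain k l where "k < r" "k \<noteq> i" "l < r" "l \<noteq> i" "k \<noteq> l"
      by (rule two_others)
    then show False
      using extra[of k l] only[of k] only[of l] by blast
  qed
  have "lookup M0 i > 0"
    using mon_eq_lookup[OF i'(2), of i] ne by (simp add: lookup_add)
  then obtain \<mu> where \<mu>: "M0 = unit_mon i + \<mu>"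
    by (rule mon_pos_split)
  have \<mu>': "M1 = unit_mon i' + \<mu>"
    using mon_left_cancel[OF i'(2)[unfolded \<mu>]] .
  have "i = 0 \<and> i' = 1 \<or> i = 1 \<and> i' = 0"
    using i(1) i'(1) ne \<open>r = 2\<close> by linarith
  then show thesis
    using \<open>r = 2\<close> M0 M1 \<mu> \<mu>' by (intro that[of \<mu>]) auto
qed

text \<open>
  If the top level has at least two monomials, then \<open>Q = c (x\<^sub>0 + x\<^sub>1 + y\<^sub>2 + y\<^sub>3)\<close>.  The top level
  already accounts for all the positive terms, so every product of an \<open>x\<close>-variable with a monomial of
  a lower level is cancelled by the level above it.
\<close>

lemma double_top:
  assumes M0: "M0 \<in> keys Q" "xdeg r M0 = xtop" and M1: "M1 \<in> keys Q" "xdeg r M1 = xtop"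
    and "M0 \<noteq> M1"
  shows "r = 2 \<and> (\<exists>c>0. \<forall>M. lookup Q M = (if \<exists>a<4. M = unit_mon a then c else 0))"
proof -
  from assms obtain \<mu> where "r = 2" and \<mu>: "unit_mon 0 + \<mu> \<in> keys Q" "unit_mon 1 + \<mu> \<in> keys Q"
    and xdeg_\<mu>: "Suc (xdeg r \<mu>) = xtop"
    by (rule double_top_shape)
  have \<mu>i: "unit_mon i + \<mu> \<in> keys Q" if "i < 2" for i
    using \<mu> that by (auto simp: less_2_cases_iff)
  let ?Z = "{unit_mon 0 + (unit_mon 0 + \<mu>), unit_mon 0 + (unit_mon 1 + \<mu>), unit_mon 1 + (unit_mon 1 + \<mu>)}"
  have ZPos: "?Z \<subseteq> Pos"
    using top_Pos \<mu> xdeg_\<mu> \<open>r = 2\<close> by auto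
  have "card ?Z = 3"
  proof -
    have "unit_mon 0 + (unit_mon 0 + \<mu>) \<noteq> unit_mon 0 + (unit_mon 1 + \<mu>)"
      "unit_mon 0 + (unit_mon 0 + \<mu>) \<noteq> unit_mon 1 + (unit_mon 1 + \<mu>)"
      "unit_mon 0 + (unit_mon 1 + \<mu>) \<noteq> unit_mon 1 + (unit_mon 1 + \<mu>)"
      by (auto dest!: mon_eq_lookup[where v = 0] simp: lookup_add)
    then show ?thesis by (simp add: card_insert_if)
  qed
  then have PosZ: "?Z = Pos"
    using card_pos \<open>r = 2\<close> by (intro card_seteq finite_pos_terms ZPos) simp
  have xdeg_Pos: "xdeg r M = Suc xtop" if "M \<in> Pos" for M
    using that xdeg_\<mu> \<open>r = 2\<close> unfolding PosZ[symmetric] by auto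
  have topset: "\<exists>i<2. M = unit_mon i + \<mu>" if M: "M \<in> keys Q" "xdeg r M = xtop" for M
  proof -
    have "unit_mon 0 + M \<in> ?Z" "unit_mon 1 + M \<in> ?Z"
      unfolding PosZ using top_Pos[OF M] \<open>r = 2\<close> by auto
    moreover have "unit_mon 1 + M = unit_mon 0 + (unit_mon 1 + \<mu>) \<longleftrightarrow> M = unit_mon 0 + \<mu>"
      by (metis add.left_commute add_left_cancel)
    ultimately consider "M = unit_mon 0 + \<mu>" | "M = unit_mon 1 + \<mu>"
      | "unit_mon 0 + M = unit_mon 1 + (unit_mon 1 + \<mu>)" "unit_mon 1 + M = unit_mon 0 + (unit_mon 0 + \<mu>)"
      by auto
    then show ?thesis
    proof cases
      case 3
      from mon_eq_lookup[OF 3(1), of 0] mon_eq_lookup[OF 3(2), of 0] show ?thesis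
        by (simp add: lookup_add)
    qed (auto intro: exI[of _ 0] exI[of _ 1])
  qed
  have "xbot \<noteq> xtop"
  proof
    assume eq: "xbot = xtop"
    let ?A = "(\<lambda>j. unit_mon j + (unit_mon 0 + \<mu>)) ` {r..<2*r}"
    have neg: "unit_mon j + (unit_mon i + \<mu>) \<in> Neg" if "i < 2" "r \<le> j" "j < 2 * r" for i j
      using that \<mu>i[OF that(1)] xdeg_\<mu> \<open>r = 2\<close> eq by (intro bot_Neg) auto
    have out: "unit_mon j + (unit_mon 1 + \<mu>) \<notin> ?A" if "r \<le> j" for j
      using \<open>r = 2\<close> that by (auto dest!: mon_eq_lookup[where v = 0] simp: lookup_add)
    have "unit_mon 2 + (unit_mon 1 + \<mu>) = unit_mon 3 + (unit_mon 1 + \<mu>)"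
    proof (rule at_most_one_outside)
      show "card ?A = r"
        by (simp add: card_image unit_mon_add_inj)
      show "?A \<subseteq> Neg"
        using neg[of 0] by auto
      show "unit_mon 2 + (unit_mon 1 + \<mu>) \<in> Neg - ?A" "unit_mon 3 + (unit_mon 1 + \<mu>) \<in> Neg - ?A"
        using neg[of 1] out \<open>r = 2\<close> by simp_all
    qed (use card_neg in auto)
    from mon_eq_lookup[OF this, of 2] show False by (simp add: lookup_add)
  qed
  have lower: "\<exists>j M'. 2 \<le> j \<and> j < 4 \<and> M' \<in> keys Q \<and> unit_mon i + M = unit_mon j + M' \<and> xdeg r M' = Suc (xdeg r M)"
    if M: "M \<in> keys Q" "xdeg r M \<noteq> xtop" "i < 2" for M i
  proof -
    have "unit_mon i + M \<notin> Pos"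
      using xdeg_Pos[of "unit_mon i + M"] M(2,3) \<open>r = 2\<close> by auto
    moreover have "i < r"
      using M(3) \<open>r = 2\<close> by simp
    ultimately obtain j M' where "r \<le> j" "j < 2 * r" "M' \<in> keys Q" "unit_mon i + M = unit_mon j + M'"
      "xdeg r M' = Suc (xdeg r M)"
      using Pos_or_cancelled[OF M(1)] by metis
    with \<open>r = 2\<close> show ?thesis
      by (intro exI[of _ j] exI[of _ M']) simp
  qed
  have level1: "\<exists>j. 2 \<le> j \<and> j < 4 \<and> M = unit_mon j + \<mu>" if M: "M \<in> keys Q" "Suc (xdeg r M) = xtop" for M
  proof -
    obtain j M' where j: "2 \<le> j" "j < 4" "M' \<in> keys Q" "unit_mon 0 + M = unit_mon j + M'"
      "xdeg r M' = xtop"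
      using lower[of M 0] M by auto
    obtain k M'' where k: "2 \<le> k" "k < 4" "M'' \<in> keys Q" "unit_mon 1 + M = unit_mon k + M''"
      "xdeg r M'' = xtop"
      using lower[of M 1] M by auto
    have "M' = unit_mon 0 + \<mu> \<or> M' = unit_mon 1 + \<mu>"
      using topset[OF j(3,5)] by (auto simp: less_2_cases_iff)
    moreover have "M'' = unit_mon 0 + \<mu> \<or> M'' = unit_mon 1 + \<mu>"
      using topset[OF k(3,5)] by (auto simp: less_2_cases_iff)
    moreover have False if M': "M' = unit_mon 1 + \<mu>" and M'': "M'' = unit_mon 0 + \<mu>"
    proof -
      have "Suc (lookup M 0) = lookup \<mu> 0"
        using mon_eq_lookup[OF j(4), of 0] j(1) unfolding M' by (simp add: lookup_add)
      moreover have "lookup M 0 = Suc (lookup \<mu> 0)"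
        using mon_eq_lookup[OF k(4), of 0] k(1) unfolding M'' by (simp add: lookup_add)
      ultimately show False by simp
    qed
    moreover have "M = unit_mon j + \<mu>" if "M' = unit_mon 0 + \<mu>"
      using mon_left_cancel[OF j(4)[unfolded that]] .
    moreover have "M = unit_mon k + \<mu>" if "M'' = unit_mon 1 + \<mu>"
      using mon_left_cancel[OF k(4)[unfolded that]] .
    ultimately show ?thesis
      using j(1,2) k(1,2) by blast
  qed
  have uncancelled: "unit_mon j + (unit_mon i + \<mu>) \<noteq> unit_mon k + (unit_mon l + \<mu>)"
    if "j \<noteq> k" "j \<noteq> l" for i j k l
    using that by (auto dest!: mon_eq_lookup[where v = j] simp: lookup_add)
  have in_keys: "unit_mon j + \<mu> \<in> keys Q" if j: "2 \<le> j" "j < 4" for j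
  proof (rule ccontr)
    assume no: "unit_mon j + \<mu> \<notin> keys Q"
    have neg: "unit_mon j + (unit_mon i + \<mu>) \<in> Neg" if i: "i < 2" for i
    proof (rule ccontr)
      assume n: "unit_mon j + (unit_mon i + \<mu>) \<notin> Neg"
      have j': "r \<le> j" "j < 2 * r" using j \<open>r = 2\<close> by auto
      from \<mu>i[OF i] j' n obtain k M where k: "k < r" "M \<in> keys Q"
        "unit_mon j + (unit_mon i + \<mu>) = unit_mon k + M" "xdeg r (unit_mon i + \<mu>) = Suc (xdeg r M)"
        by (rule Neg_or_cancelled)
      have "Suc (xdeg r M) = xtop"
        using k(4) i \<open>r = 2\<close> xdeg_\<mu> by simp
      then obtain l where l: "2 \<le> l" "l < 4" "M = unit_mon l + \<mu>"
        using level1[OF k(2)] by blast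
      have "j \<noteq> k" "j \<noteq> l"
        using j k(1) \<open>r = 2\<close> no l(3) k(2) by auto
      with k(3) l(3) uncancelled show False by blast
    qed
    have "unit_mon j + (unit_mon 0 + \<mu>) = unit_mon j + (unit_mon 1 + \<mu>)"
      using neg[of 0] neg[of 1] j \<open>xbot \<noteq> xtop\<close> xdeg_\<mu> \<open>r = 2\<close> by (intro extra_Neg_unique) auto
    then show False
      by (auto dest!: mon_eq_lookup[where v = 0] simp: lookup_add)
  qed
  have coeff_eq: "lookup (hyperplane_form r r * Q) (unit_mon j + (unit_mon i + \<mu>)) =
      lookup Q (unit_mon j + \<mu>) - lookup Q (unit_mon i + \<mu>)"
    if i: "i < 2" and j: "2 \<le> j" "j < 4" for i j
  proof -
    let ?M = "unit_mon j + (unit_mon i + \<mu>)"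
    have xz: "lookup (Var k * Q) ?M = (if k = i then lookup Q (unit_mon j + \<mu>) else 0)" if k: "k < r" for k
    proof (cases "k = i")
      case True
      then show ?thesis
        using lookup_Var_mult[of i Q "unit_mon j + \<mu>"] by (simp add: add.left_commute)
    next
      case False
      have "?M \<noteq> unit_mon k + M'" if M': "M' \<in> keys Q" for M'
      proof
        assume eq: "?M = unit_mon k + M'"
        from arg_cong[OF eq, of "xdeg r"] have "Suc (xdeg r M') = xtop"
          using xdeg_\<mu> k i j \<open>r = 2\<close> by simp
        then obtain l where l: "2 \<le> l" "M' = unit_mon l + \<mu>"
          using level1[OF M'] by blast
        from mon_eq_lookup[OF eq, of i] show False
          using l False i j by (simp add: lookup_add)
      qed
      then show ?thesis
        using False by (simp add: lookup_Var_mult_eq_0)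
    qed
    have yz: "lookup (Var k * Q) ?M = (if k = j then lookup Q (unit_mon i + \<mu>) else 0)"
      if k: "r \<le> k" for k
    proof (cases "k = j")
      case True
      then show ?thesis
        using lookup_Var_mult[of j Q "unit_mon i + \<mu>"] by simp
    next
      case False
      have "?M \<noteq> unit_mon k + M'" if M': "M' \<in> keys Q" for M'
      proof
        assume eq: "?M = unit_mon k + M'"
        from arg_cong[OF eq, of "xdeg r"] have "xdeg r M' = xtop"
          using xdeg_\<mu> k i j \<open>r = 2\<close> by simp
        then obtain l where l: "l < 2" "M' = unit_mon l + \<mu>"
          using topset[OF M'] by blast
        from mon_eq_lookup[OF eq, of j] show False
          using l False i j by (simp add: lookup_add)
      qed
      then show ?thesis
        using False by (simp add: lookup_Var_mult_eq_0)
    qed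
    have "(\<Sum>k<r. lookup (Var k * Q) ?M) = lookup Q (unit_mon j + \<mu>)"
      using i \<open>r = 2\<close> by (simp add: xz)
    moreover have "(\<Sum>k=r..<r+r. lookup (Var k * Q) ?M) = lookup Q (unit_mon i + \<mu>)"
      using j \<open>r = 2\<close> by (simp add: yz)
    ultimately show ?thesis
      by (simp add: lookup_hyperplane_mult)
  qed
  have le: "lookup Q (unit_mon j + \<mu>) \<le> lookup Q (unit_mon i + \<mu>)"
    if i: "i < 2" and j: "2 \<le> j" "j < 4" for i j
  proof (rule ccontr)
    assume "\<not> ?thesis"
    then have "unit_mon j + (unit_mon i + \<mu>) \<in> Pos"
      using coeff_eq[OF that] by (simp add: pos_terms_def)
    from xdeg_Pos[OF this] show False
      using xdeg_\<mu> i j \<open>r = 2\<close> by simp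
  qed
  have unique_less: "i = i' \<and> j = j'"
    if "i < 2" "2 \<le> j" "j < 4" "lookup Q (unit_mon j + \<mu>) < lookup Q (unit_mon i + \<mu>)"
      and "i' < 2" "2 \<le> j'" "j' < 4" "lookup Q (unit_mon j' + \<mu>) < lookup Q (unit_mon i' + \<mu>)"
    for i j i' j'
  proof -
    have "unit_mon j + (unit_mon i + \<mu>) \<in> Neg" "unit_mon j' + (unit_mon i' + \<mu>) \<in> Neg"
      using coeff_eq[of i j] coeff_eq[of i' j'] that by (auto simp: neg_terms_def)
    then have eq: "unit_mon j + (unit_mon i + \<mu>) = unit_mon j' + (unit_mon i' + \<mu>)"
      using that \<open>xbot \<noteq> xtop\<close> xdeg_\<mu> \<open>r = 2\<close> by (intro extra_Neg_unique) auto
    have "j \<noteq> i" "j' \<noteq> i" "i' \<noteq> j"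
      using that(1-3,5-7) by auto
    have "i = i'"
    proof (rule ccontr)
      assume "i \<noteq> i'"
      then show False
        using mon_eq_lookup[OF eq, of i] \<open>j \<noteq> i\<close> \<open>j' \<noteq> i\<close> by (simp add: lookup_add)
    qed
    moreover have "j = j'"
    proof (rule ccontr)
      assume "j \<noteq> j'"
      then show False
        using mon_eq_lookup[OF eq, of j] \<open>i' \<noteq> j\<close> by (simp add: lookup_add)
    qed
    ultimately show ?thesis by simp
  qed
  define c where "c = lookup Q (unit_mon 0 + \<mu>)"
  have eqs: "lookup Q (unit_mon 1 + \<mu>) = c" "lookup Q (unit_mon 2 + \<mu>) = c" "lookup Q (unit_mon 3 + \<mu>) = c"
  proof -
    let ?q = "\<lambda>a. lookup Q (unit_mon a + \<mu>)"
    have "?q 0 \<le> ?q 2 \<or> ?q 0 \<le> ?q 3" "?q 0 \<le> ?q 2 \<or> ?q 1 \<le> ?q 2" "?q 0 \<le> ?q 2 \<or> ?q 1 \<le> ?q 3"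
      "?q 0 \<le> ?q 3 \<or> ?q 1 \<le> ?q 2" "?q 0 \<le> ?q 3 \<or> ?q 1 \<le> ?q 3" "?q 1 \<le> ?q 2 \<or> ?q 1 \<le> ?q 3"
      using unique_less[of 0 2 0 3] unique_less[of 0 2 1 2] unique_less[of 0 2 1 3]
        unique_less[of 0 3 1 2] unique_less[of 0 3 1 3] unique_less[of 1 2 1 3]
      by (auto simp: not_less[symmetric])
    moreover have "?q 2 \<le> ?q 0" "?q 3 \<le> ?q 0" "?q 2 \<le> ?q 1" "?q 3 \<le> ?q 1"
      using le by simp_all
    ultimately show "?q 1 = c" "?q 2 = c" "?q 3 = c"
      unfolding c_def by linarith+
  qed
  \<comment> \<open>With a third level both \<open>y\<^sub>2\<^sup>2 \<mu>\<close> and \<open>y\<^sub>3\<^sup>2 \<mu>\<close> would be negative terms above the bottom level.\<close>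
  have "xbot = xdeg r \<mu>"
  proof (rule ccontr)
    assume nb: "xbot \<noteq> xdeg r \<mu>"
    have neg: "unit_mon j + (unit_mon j + \<mu>) \<in> Neg" if j: "2 \<le> j" "j < 4" for j
    proof (rule ccontr)
      assume n: "unit_mon j + (unit_mon j + \<mu>) \<notin> Neg"
      have j': "r \<le> j" "j < 2 * r" using j \<open>r = 2\<close> by auto
      from in_keys[OF j] j' n obtain i M where i: "i < r" "M \<in> keys Q"
        "unit_mon j + (unit_mon j + \<mu>) = unit_mon i + M" "xdeg r (unit_mon j + \<mu>) = Suc (xdeg r M)"
        by (rule Neg_or_cancelled)
      have i': "1 - i < 2" "1 - i \<noteq> i" using i(1) \<open>r = 2\<close> by presburger+
      have "xdeg r M \<noteq> xtop" "Suc (Suc (xdeg r M)) = xtop"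
        using i(4) j xdeg_\<mu> \<open>r = 2\<close> by auto
      then obtain k M' where k: "2 \<le> k" "k < 4" "M' \<in> keys Q" "unit_mon (1 - i) + M = unit_mon k + M'"
        "Suc (xdeg r M') = xtop"
        using lower[OF i(2) _ i'(1)] by auto
      then obtain l where l: "2 \<le> l" "M' = unit_mon l + \<mu>"
        using level1[OF k(3,5)] by blast
      from mon_eq_lookup[OF i(3), of i] mon_eq_lookup[OF k(4), of i] l show False
        using i' i(1) j k(1) \<open>r = 2\<close> by (simp add: lookup_add)
    qed
    have "unit_mon 2 + (unit_mon 2 + \<mu>) = unit_mon 3 + (unit_mon 3 + \<mu>)"
      using neg[of 2] neg[of 3] nb \<open>r = 2\<close> by (intro extra_Neg_unique) auto
    then show False
      by (auto dest!: mon_eq_lookup[where v = 2] simp: lookup_add)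
  qed
  have keysQ: "M \<in> keys Q \<longleftrightarrow> (\<exists>a<4. M = unit_mon a + \<mu>)" for M
  proof
    assume M: "M \<in> keys Q"
    have "xdeg r M = xtop \<or> Suc (xdeg r M) = xtop"
      using le_top[OF M] bot_le[OF M] \<open>xbot = xdeg r \<mu>\<close> xdeg_\<mu> by linarith
    then show "\<exists>a<4. M = unit_mon a + \<mu>"
    proof
      assume "xdeg r M = xtop"
      from topset[OF M this] obtain i where "i < 2" "M = unit_mon i + \<mu>" by blast
      then show ?thesis by (intro exI[of _ i]) simp
    next
      assume "Suc (xdeg r M) = xtop"
      from level1[OF M this] show ?thesis by blast
    qed
  next
    assume "\<exists>a<4. M = unit_mon a + \<mu>"
    then obtain a where "a < 4" "M = unit_mon a + \<mu>" by blast
    then show "M \<in> keys Q"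
      using \<mu>i[of a] in_keys[of a] by (cases "a < 2") auto
  qed
  have "lookup \<mu> a = 0" for a
  proof (cases "a < 2 * r")
    case True
    then show ?thesis
      using no_var[OF True] by (auto simp: keysQ lookup_add)
  next
    case False
    then show ?thesis
      using vars[OF \<mu>(1)] by (auto simp: keys_add_nat in_keys_iff)
  qed
  then have "\<mu> = 0"
    by (intro poly_mapping_eqI) simp
  have "c > 0"
    using \<mu>(1) nonneg[of "unit_mon 0 + \<mu>"] by (simp add: c_def in_keys_iff)
  moreover have "lookup Q M = (if \<exists>a<4. M = unit_mon a then c else 0)" for M
  proof (cases "M \<in> keys Q")
    case True
    then obtain a where a: "a < 4" "M = unit_mon a"
      using keysQ \<open>\<mu> = 0\<close> by auto
    then have "a = 0 \<or> a = 1 \<or> a = 2 \<or> a = 3"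
      by linarith
    then have "lookup Q (unit_mon a) = c"
      using eqs \<open>\<mu> = 0\<close> by (auto simp: c_def)
    with a show ?thesis by auto
  next
    case False
    then show ?thesis
      using keysQ[of M] \<open>\<mu> = 0\<close> by (auto simp: in_keys_iff)
  qed
  ultimately show ?thesis
    using \<open>r = 2\<close> by blast
qed

theorem classification:
  "r = 2 \<and> ((\<exists>i j c. i < 2 \<and> 2 \<le> j \<and> j < 4 \<and> c > 0 \<and>
      (\<forall>M. lookup Q M = (if M = unit_mon i \<or> M = unit_mon j then c else 0))) \<or>
    (\<exists>c>0. \<forall>M. lookup Q M = (if \<exists>a<4. M = unit_mon a then c else 0)))"
proof -
  obtain M0 where M0: "M0 \<in> keys Q" "xdeg r M0 = xtop"
    by (rule top_attained)
  show ?thesis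
  proof (cases "\<exists>M1\<in>keys Q. xdeg r M1 = xtop \<and> M0 \<noteq> M1")
    case True
    then show ?thesis
      using double_top[OF M0] by blast
  next
    case False
    then show ?thesis
      using single_top[OF M0] by blast
  qed
qed

end

section \<open>Linear isometries of indefinite Hermitian forms\<close>

text \<open>
  The Hermitian form of signature \<open>(p, q)\<close> on \<open>\<complex>\<^sup>p\<^sup>+\<^sup>q\<close> and the value of its quadratic form.
\<close>

definition hform :: "nat \<Rightarrow> nat \<Rightarrow> (nat \<Rightarrow> complex) \<Rightarrow> (nat \<Rightarrow> complex) \<Rightarrow> complex" where
  "hform p q x y = (\<Sum>i<p. x i * cnj (y i)) - (\<Sum>i=p..<p+q. x i * cnj (y i))"

definition hnorm :: "nat \<Rightarrow> nat \<Rightarrow> (nat \<Rightarrow> complex) \<Rightarrow> real" where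
  "hnorm p q x = (\<Sum>i<p. (cmod (x i))\<^sup>2) - (\<Sum>i=p..<p+q. (cmod (x i))\<^sup>2)"

lemma hform_self: "hform p q x x = of_real (hnorm p q x)"
  by (simp add: hform_def hnorm_def complex_norm_square del: of_real_power)

lemma hform_lin_left:
  "hform p q (\<lambda>i. a * x i + b * y i) z = a * hform p q x z + b * hform p q y z"
  by (simp add: hform_def sum.distrib sum_distrib_left algebra_simps)

lemma hform_cnj: "cnj (hform p q x y) = hform p q y x"
  by (simp add: hform_def mult.commute)

lemma hform_lin_right:
  "hform p q z (\<lambda>i. a * x i + b * y i) = cnj a * hform p q z x + cnj b * hform p q z y"
  by (simp add: hform_def sum.distrib sum_distrib_left algebra_simps)

lemma hform_diff_left: "hform p q (\<lambda>i. x i - c * y i) z = hform p q x z - c * hform p q y z"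
  using hform_lin_left[of p q 1 x "- c" y z] by simp

lemma hform_diff_right: "hform p q z (\<lambda>i. x i - c * y i) = hform p q z x - cnj c * hform p q z y"
  using hform_lin_right[of p q z 1 x "- c" y] by simp

lemma hnorm_scale: "hnorm p q (\<lambda>i. c * x i) = (cmod c)\<^sup>2 * hnorm p q x"
  by (simp add: hnorm_def norm_mult power_mult_distrib sum_distrib_left right_diff_distrib)

text \<open>
  Maps are only considered on \<open>cspace n\<close>; their values elsewhere are irrelevant.
\<close>

definition linear_map :: "nat \<Rightarrow> ((nat \<Rightarrow> complex) \<Rightarrow> nat \<Rightarrow> complex) \<Rightarrow> bool" where
  "linear_map n T \<longleftrightarrow> (\<forall>x\<in>cspace n. T x \<in> cspace n) \<and>
    (\<forall>a b. \<forall>x\<in>cspace n. \<forall>y\<in>cspace n. T (\<lambda>i. a * x i + b * y i) = (\<lambda>i. a * T x i + b * T y i))"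

definition form_isometry :: "nat \<Rightarrow> nat \<Rightarrow> ((nat \<Rightarrow> complex) \<Rightarrow> nat \<Rightarrow> complex) \<Rightarrow> bool" where
  "form_isometry p q T \<longleftrightarrow> linear_map (p + q) T \<and>
    (\<forall>x\<in>cspace (p + q). \<forall>y\<in>cspace (p + q). hform p q (T x) (T y) = hform p q x y)"

text \<open>
  The elements of \<open>U(p, q)\<close>, as isometries with an inverse isometry.
\<close>

definition pseudo_unitary :: "nat \<Rightarrow> nat \<Rightarrow> ((nat \<Rightarrow> complex) \<Rightarrow> nat \<Rightarrow> complex) \<Rightarrow> bool" where
  "pseudo_unitary p q T \<longleftrightarrow> form_isometry p q T \<and>
    (\<exists>T'. form_isometry p q T' \<and> (\<forall>x\<in>cspace (p + q). T' (T x) = x \<and> T (T' x) = x))"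

lemma cspace_scale: "x \<in> cspace n \<Longrightarrow> (\<lambda>i. a * x i) \<in> cspace n"
  by (simp add: cspace_def)

lemma cspace_diff: "x \<in> cspace n \<Longrightarrow> y \<in> cspace n \<Longrightarrow> (\<lambda>i. x i - y i) \<in> cspace n"
  by (simp add: cspace_def)

lemma linear_map_cspace: "linear_map n T \<Longrightarrow> x \<in> cspace n \<Longrightarrow> T x \<in> cspace n"
  by (simp add: linear_map_def)

lemma linear_map_lin:
  "linear_map n T \<Longrightarrow> x \<in> cspace n \<Longrightarrow> y \<in> cspace n \<Longrightarrow>
    T (\<lambda>i. a * x i + b * y i) = (\<lambda>i. a * T x i + b * T y i)"
  by (simp add: linear_map_def)

lemma linear_map_scale:
  assumes "linear_map n T" "x \<in> cspace n"
  shows "T (\<lambda>i. a * x i) = (\<lambda>i. a * T x i)"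
  using linear_map_lin[OF assms assms(2), of a 0] by simp

lemma cspace_sum: "(\<And>a. a \<in> A \<Longrightarrow> v a \<in> cspace n) \<Longrightarrow> (\<lambda>i. \<Sum>a\<in>A. c a * v a i) \<in> cspace n"
  by (simp add: cspace_def)

lemma linear_map_sum:
  assumes T: "linear_map n T" and "finite A" "\<And>a. a \<in> A \<Longrightarrow> v a \<in> cspace n"
  shows "T (\<lambda>i. \<Sum>a\<in>A. c a * v a i) = (\<lambda>i. \<Sum>a\<in>A. c a * T (v a) i)"
  using assms(2,3)
proof (induction A rule: finite_induct)
  case empty
  have "(\<lambda>i. 0 :: complex) \<in> cspace n"
    by (simp add: cspace_def)
  from linear_map_scale[OF T this, of 0] show ?case by simp
next
  case (insert a A)
  have "T (\<lambda>i. \<Sum>a\<in>insert a A. c a * v a i) = T (\<lambda>i. c a * v a i + 1 * (\<Sum>a\<in>A. c a * v a i))"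
    using insert.hyps by simp
  also have "\<dots> = (\<lambda>i. c a * T (v a) i + 1 * T (\<lambda>i. \<Sum>a\<in>A. c a * v a i) i)"
    using insert.prems by (intro linear_map_lin[OF T] cspace_sum) auto
  finally show ?case
    using insert by simp
qed

lemma form_isometry_id: "form_isometry p q (\<lambda>x. x)"
  by (simp add: form_isometry_def linear_map_def)

lemma form_isometry_comp:
  assumes "form_isometry p q S" "form_isometry p q T"
  shows "form_isometry p q (\<lambda>x. S (T x))"
  using assms unfolding form_isometry_def linear_map_def by simp

lemma pseudo_unitary_id: "pseudo_unitary p q (\<lambda>x. x)"
  using form_isometry_id[of p q] by (auto simp: pseudo_unitary_def)

lemma pseudo_unitary_comp:
  assumes S: "pseudo_unitary p q S" and T: "pseudo_unitary p q T"
  shows "pseudo_unitary p q (\<lambda>x. S (T x))"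
proof -
  from S obtain S' where S': "form_isometry p q S'" "\<forall>x\<in>cspace (p + q). S' (S x) = x \<and> S (S' x) = x"
    by (auto simp: pseudo_unitary_def)
  from T obtain T' where T': "form_isometry p q T'" "\<forall>x\<in>cspace (p + q). T' (T x) = x \<and> T (T' x) = x"
    by (auto simp: pseudo_unitary_def)
  have "T x \<in> cspace (p + q)" "S' x \<in> cspace (p + q)" if "x \<in> cspace (p + q)" for x
    using that S' T by (auto simp: pseudo_unitary_def form_isometry_def linear_map_cspace)
  then have "\<forall>x\<in>cspace (p + q). T' (S' (S (T x))) = x \<and> S (T (T' (S' x))) = x"
    using S'(2) T'(2) by simp
  then show ?thesis
    using form_isometry_comp[of p q S T] form_isometry_comp[OF T'(1) S'(1)] S T
    by (auto simp: pseudo_unitary_def)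
qed

text \<open>
  The map \<open>x \<mapsto> x - \<langle>x, w\<rangle> / s \<cdot> w\<close>.  It is an isometry if \<open>\<langle>w, w\<rangle> = s + cnj s\<close>, and its inverse belongs
  to \<open>cnj s\<close>.
\<close>

definition complex_reflection ::
  "nat \<Rightarrow> nat \<Rightarrow> (nat \<Rightarrow> complex) \<Rightarrow> complex \<Rightarrow> (nat \<Rightarrow> complex) \<Rightarrow> nat \<Rightarrow> complex" where
  "complex_reflection p q w s x = (\<lambda>i. x i - hform p q x w / s * w i)"

lemma form_isometry_complex_reflection:
  assumes w: "w \<in> cspace (p + q)" and s: "s \<noteq> 0" "hform p q w w = s + cnj s"
  shows "form_isometry p q (complex_reflection p q w s)"
proof -
  have "linear_map (p + q) (complex_reflection p q w s)"
    using w s(1) by (auto simp: linear_map_def complex_reflection_def cspace_def hform_lin_left field_simps)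
  moreover have "hform p q (complex_reflection p q w s x) (complex_reflection p q w s y) = hform p q x y" for x y
  proof -
    have hwy: "hform p q w y = cnj (hform p q y w)"
      by (simp add: hform_cnj)
    show ?thesis
      unfolding complex_reflection_def hform_diff_left hform_diff_right s(2) hwy
      using s(1) by (simp add: field_simps)
  qed
  ultimately show ?thesis
    by (simp add: form_isometry_def)
qed

lemma complex_reflection_inverse:
  assumes s: "s \<noteq> 0" "hform p q w w = s + cnj s"
  shows "complex_reflection p q w (cnj s) (complex_reflection p q w s x) = x"
proof -
  define y where "y = complex_reflection p q w s x"
  have y: "y i = x i - hform p q x w / s * w i" for i
    by (simp add: y_def complex_reflection_def)
  have "hform p q y w = - hform p q x w * cnj s / s"
    unfolding y_def complex_reflection_def hform_diff_left s(2)
    using s(1) by (simp add: field_simps)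
  then have "hform p q y w / cnj s = - (hform p q x w / s)"
    using s(1) by (simp add: field_simps)
  then have "complex_reflection p q w (cnj s) y = x"
    by (simp add: complex_reflection_def fun_eq_iff y)
  then show ?thesis
    by (simp add: y_def)
qed

lemma pseudo_unitary_complex_reflection:
  assumes w: "w \<in> cspace (p + q)" and s: "s \<noteq> 0" "hform p q w w = s + cnj s"
  shows "pseudo_unitary p q (complex_reflection p q w s)"
  unfolding pseudo_unitary_def
proof (intro conjI exI ballI)
  show "form_isometry p q (complex_reflection p q w s)" "form_isometry p q (complex_reflection p q w (cnj s))"
    using assms by (auto intro!: form_isometry_complex_reflection)
  show "complex_reflection p q w (cnj s) (complex_reflection p q w s x) = x"
    "complex_reflection p q w s (complex_reflection p q w (cnj s) x) = x" for x
    using complex_reflection_inverse[of s p q w x] complex_reflection_inverse[of "cnj s" p q w x] s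
    by (simp_all add: add.commute)
qed

text \<open>
  The reflection with \<open>w = u - v\<close> and \<open>s = \<langle>u, w\<rangle>\<close> moves \<open>u\<close> to \<open>v\<close>.
\<close>

lemma reflection_moving_generic:
  assumes u: "u \<in> cspace (p + q)" and v: "v \<in> cspace (p + q)"
    and eq: "hform p q u u = hform p q v v" and ne: "hform p q u u \<noteq> hform p q u v"
  shows "\<exists>T. pseudo_unitary p q T \<and> T u = v \<and>
    (\<forall>x. hform p q x u = 0 \<and> hform p q x v = 0 \<longrightarrow> T x = x)"
proof -
  define w where "w = (\<lambda>i. u i - 1 * v i)"
  define s where "s = hform p q u w"
  have s_eq: "s = hform p q u u - hform p q u v"
    unfolding s_def w_def hform_diff_right by simp
  have cnj_s: "cnj s = hform p q u u - hform p q v u"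
    unfolding s_eq by (simp add: hform_cnj)
  have "hform p q w w = s + cnj s"
    unfolding s_eq cnj_s[unfolded s_eq] unfolding w_def hform_diff_left hform_diff_right
    by (simp add: eq)
  moreover have "s \<noteq> 0"
    using ne by (simp add: s_eq)
  moreover have "w \<in> cspace (p + q)"
    using u v by (simp add: w_def cspace_diff)
  ultimately have "pseudo_unitary p q (complex_reflection p q w s)"
    by (intro pseudo_unitary_complex_reflection)
  moreover have "complex_reflection p q w s u = v"
    using \<open>s \<noteq> 0\<close> by (simp add: complex_reflection_def s_def[symmetric]) (simp add: w_def)
  moreover have "complex_reflection p q w s x = x" if "hform p q x u = 0" "hform p q x v = 0" for x
  proof -
    have "hform p q x w = 0"
      using that unfolding w_def hform_diff_right by simp
    then show ?thesis by (simp add: complex_reflection_def)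
  qed
  ultimately show ?thesis by blast
qed

text \<open>
  The reflection from \<open>u\<close> to \<open>v\<close> fails to exist only if \<open>\<langle>u, u\<rangle> = \<langle>u, v\<rangle>\<close>; then \<open>u\<close> can be
  reflected to \<open>- v\<close>, and \<open>- v\<close> to \<open>v\<close>.
\<close>

lemma pseudo_unitary_moving:
  assumes u: "u \<in> cspace (p + q)" and v: "v \<in> cspace (p + q)"
    and eq: "hform p q u u = hform p q v v" and nz: "hform p q v v \<noteq> 0"
  shows "\<exists>T. pseudo_unitary p q T \<and> T u = v \<and>
    (\<forall>x. hform p q x u = 0 \<and> hform p q x v = 0 \<longrightarrow> T x = x)"
proof (cases "hform p q u u = hform p q u v")
  case False
  then show ?thesis
    using reflection_moving_generic[OF u v eq] by blast
next
  case True
  define v' where "v' = (\<lambda>i. (-1) * v i)"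
  have v': "v' \<in> cspace (p + q)"
    using v unfolding v'_def by (rule cspace_scale)
  have neg: "hform p q x v' = - hform p q x v" "hform p q v' x = - hform p q v x" for x
    using hform_lin_right[of p q x "-1" v 0 v] hform_lin_left[of p q "-1" v 0 v x]
    by (simp_all add: v'_def)
  have "hform p q u u \<noteq> 0"
    using eq nz by simp
  then obtain S where S: "pseudo_unitary p q S" "S u = v'"
      "\<forall>x. hform p q x u = 0 \<and> hform p q x v' = 0 \<longrightarrow> S x = x"
    using reflection_moving_generic[OF u v'] True eq by (auto simp: neg)
  obtain T where T: "pseudo_unitary p q T" "T v' = v"
      "\<forall>x. hform p q x v' = 0 \<and> hform p q x v = 0 \<longrightarrow> T x = x"
    using reflection_moving_generic[OF v' v] nz by (auto simp: neg)
  have "pseudo_unitary p q (\<lambda>x. T (S x))"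
    using T(1) S(1) by (rule pseudo_unitary_comp)
  then show ?thesis
    using S T by (intro exI[of _ "\<lambda>x. T (S x)"]) (auto simp: neg)
qed

text \<open>
  Witt's theorem for orthogonal systems of nonisotropic vectors.  The vectors are moved one after the
  other: each new reflection fixes the vectors that are already in place, since these are orthogonal
  to both the source and the target of the next one.
\<close>

lemma witt_extension:
  assumes "finite K"
    and "\<And>a. a \<in> K \<Longrightarrow> u a \<in> cspace (p + q)" and "\<And>a. a \<in> K \<Longrightarrow> v a \<in> cspace (p + q)"
    and "\<And>a b. \<lbrakk>a \<in> K; b \<in> K; a \<noteq> b\<rbrakk> \<Longrightarrow> hform p q (u a) (u b) = 0"
    and "\<And>a b. \<lbrakk>a \<in> K; b \<in> K; a \<noteq> b\<rbrakk> \<Longrightarrow> hform p q (v a) (v b) = 0"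
    and "\<And>a. a \<in> K \<Longrightarrow> hform p q (u a) (u a) = hform p q (v a) (v a)"
    and "\<And>a. a \<in> K \<Longrightarrow> hform p q (v a) (v a) \<noteq> 0"
  shows "\<exists>T. pseudo_unitary p q T \<and> (\<forall>a\<in>K. T (u a) = v a)"
  using assms
proof (induction K rule: finite_induct)
  case empty
  show ?case
    by (intro exI[of _ "\<lambda>x. x"]) (simp add: pseudo_unitary_id)
next
  case (insert a K)
  have "\<exists>T. pseudo_unitary p q T \<and> (\<forall>a\<in>K. T (u a) = v a)"
    by (rule insert.IH) (use insert.prems in auto)
  then obtain T where T: "pseudo_unitary p q T" "\<And>b. b \<in> K \<Longrightarrow> T (u b) = v b"
    by blast
  have iso: "form_isometry p q T"
    using T(1) by (simp add: pseudo_unitary_def)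
  have ua: "u a \<in> cspace (p + q)"
    using insert.prems by simp
  have "T (u a) \<in> cspace (p + q)"
    using iso ua by (simp add: form_isometry_def linear_map_cspace)
  moreover have "hform p q (T (u a)) (T (u a)) = hform p q (v a) (v a)"
    using iso ua insert.prems(5)[of a] by (simp add: form_isometry_def)
  moreover have "v a \<in> cspace (p + q)" "hform p q (v a) (v a) \<noteq> 0"
    using insert.prems(2,6) by simp_all
  ultimately have "\<exists>R. pseudo_unitary p q R \<and> R (T (u a)) = v a \<and>
      (\<forall>x. hform p q x (T (u a)) = 0 \<and> hform p q x (v a) = 0 \<longrightarrow> R x = x)"
    by (intro pseudo_unitary_moving)
  then obtain R where R: "pseudo_unitary p q R" "R (T (u a)) = v a"
      "\<And>x. \<lbrakk>hform p q x (T (u a)) = 0; hform p q x (v a) = 0\<rbrakk> \<Longrightarrow> R x = x"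
    by blast
  have "R (T (u b)) = v b" if b: "b \<in> K" for b
  proof -
    have "b \<noteq> a"
      using b insert.hyps by blast
    have "hform p q (v b) (T (u a)) = hform p q (T (u b)) (T (u a))"
      by (simp add: T(2)[OF b])
    also have "\<dots> = hform p q (u b) (u a)"
      using iso ua insert.prems(1)[of b] b by (simp add: form_isometry_def)
    also have "\<dots> = 0"
      using insert.prems(3) b \<open>b \<noteq> a\<close> by simp
    finally have "R (v b) = v b"
      using insert.prems(4) b \<open>b \<noteq> a\<close> by (intro R(3)) auto
    then show ?thesis
      by (simp add: T(2)[OF b])
  qed
  then have "\<forall>b\<in>insert a K. R (T (u b)) = v b"
    using R(2) by simp
  then show ?case
    using pseudo_unitary_comp[OF R(1) T(1)] by (intro exI[of _ "\<lambda>x. R (T x)"]) simp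
qed

section \<open>Generalized balls\<close>

lemma proj_pt_self: "z \<in> proj_pt z"
  by (auto simp: proj_pt_def intro: exI[of _ 1])

lemma proj_pt_scale:
  assumes "c \<noteq> 0"
  shows "proj_pt (\<lambda>i. c * z i) = proj_pt z"
proof (intro equalityI subsetI)
  fix w assume "w \<in> proj_pt (\<lambda>i. c * z i)"
  then obtain a where "w = (\<lambda>i. a * (c * z i))" "a \<noteq> 0"
    by (auto simp: proj_pt_def)
  then show "w \<in> proj_pt z"
    using assms by (auto simp: proj_pt_def intro!: exI[of _ "a * c"])
next
  fix w assume "w \<in> proj_pt z"
  then obtain a where "w = (\<lambda>i. a * z i)" "a \<noteq> 0"
    by (auto simp: proj_pt_def)
  then show "w \<in> proj_pt (\<lambda>i. c * z i)"
    using assms by (auto simp: proj_pt_def intro!: exI[of _ "a / c"])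
qed

lemma proj_pt_eqD:
  assumes "proj_pt z = proj_pt w"
  obtains c where "c \<noteq> 0" "z = (\<lambda>i. c * w i)"
  using proj_pt_self[of z] assms by (auto simp: proj_pt_def)

lemma proj_pt_image:
  assumes "linear_map n T" "z \<in> cspace n"
  shows "T ` proj_pt z = proj_pt (T z)"
proof -
  have "proj_pt z = (\<lambda>c i. c * z i) ` {c. c \<noteq> 0}" "proj_pt (T z) = (\<lambda>c i. c * T z i) ` {c. c \<noteq> 0}"
    by (auto simp: proj_pt_def)
  then show ?thesis
    by (simp add: image_image linear_map_scale[OF assms])
qed

lemma proj_pt_in_gball_iff:
  assumes "z \<in> cspace (p + q)"
  shows "proj_pt z \<in> gball p q \<longleftrightarrow> hnorm p q z > 0"
proof
  assume "proj_pt z \<in> gball p q"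
  then obtain w where w: "proj_pt z = proj_pt w" "hnorm p q w > 0"
    by (auto simp: gball_def hnorm_def)
  from w(1) obtain c where "c \<noteq> 0" "z = (\<lambda>i. c * w i)"
    by (rule proj_pt_eqD)
  then show "hnorm p q z > 0"
    using w(2) by (simp add: hnorm_scale)
next
  assume "hnorm p q z > 0"
  then show "proj_pt z \<in> gball p q"
    using assms by (auto simp: gball_def hnorm_def)
qed

lemma hnorm_pos_punctured:
  assumes "z \<in> cspace (p + q)" "hnorm p q z \<noteq> 0"
  shows "z \<in> punctured (p + q)"
proof -
  have "\<exists>i. z i \<noteq> 0"
  proof (rule ccontr)
    assume "\<nexists>i. z i \<noteq> 0"
    then have "hnorm p q z = 0"
      by (simp add: hnorm_def)
    with assms show False by simp
  qed
  then show ?thesis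
    using assms by (simp add: punctured_def)
qed

lemma gball_cases:
  assumes "x \<in> gball p q"
  obtains z where "z \<in> cspace (p + q)" "z \<in> punctured (p + q)" "hnorm p q z > 0" "x = proj_pt z"
proof -
  from assms obtain z where z: "z \<in> cspace (p + q)" "x = proj_pt z"
    by (auto simp: gball_def)
  with assms have "hnorm p q z > 0"
    by (simp add: proj_pt_in_gball_iff)
  with z show thesis
    by (intro that) (auto intro: hnorm_pos_punctured)
qed

lemma continuous_on_hnorm: "continuous_on A (hnorm p q)"
  unfolding hnorm_def[abs_def]
  by (intro continuous_intros continuous_on_subset[OF continuous_on_product_coordinates]) auto

lemma openin_gball_preimage:
  "openin (top_of_set (punctured (p + q))) {z \<in> punctured (p + q). proj_pt z \<in> gball p q}"
proof -
  have "open {z. 0 < hnorm p q z}"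
    by (intro open_Collect_less continuous_intros continuous_on_hnorm)
  moreover have "{z \<in> punctured (p + q). proj_pt z \<in> gball p q} = punctured (p + q) \<inter> {z. 0 < hnorm p q z}"
    by (auto simp: punctured_def proj_pt_in_gball_iff)
  ultimately show ?thesis
    by (simp add: openin_open_Int)
qed

text \<open>
  The map that a linear map \<open>T\<close> induces on the generalized ball.  A point is the set of its coordinate
  vectors, so that the image of the point \<open>x\<close> is the set \<open>T ` x\<close>.
\<close>

definition induced_map :: "nat \<Rightarrow> nat \<Rightarrow> ((nat \<Rightarrow> complex) \<Rightarrow> nat \<Rightarrow> complex) \<Rightarrow> point \<rightharpoonup> point" where
  "induced_map p q T x = (if x \<in> gball p q then Some (T ` x) else None)"

lemma induced_map_proj_pt:
  assumes "form_isometry p q T" "z \<in> cspace (p + q)" "hnorm p q z > 0"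
  shows "induced_map p q T (proj_pt z) = Some (proj_pt (T z))" "hnorm p q (T z) > 0"
proof -
  show "induced_map p q T (proj_pt z) = Some (proj_pt (T z))"
    using assms
    by (simp add: induced_map_def proj_pt_in_gball_iff form_isometry_def proj_pt_image[of "p + q"])
  have "hform p q (T z) (T z) = hform p q z z"
    using assms by (simp add: form_isometry_def)
  then show "hnorm p q (T z) > 0"
    using assms(3) by (simp add: hform_self)
qed

lemma linear_map_expand:
  assumes "linear_map n T" "z \<in> cspace n"
  shows "T z = (\<lambda>k. \<Sum>l<n. z l * T (\<lambda>i. if i = l then 1 else 0) k)"
proof -
  have "z = (\<lambda>i. \<Sum>l<n. z l * (if i = l then 1 else 0))"
  proof
    fix k
    have "(\<Sum>l<n. z l * (if k = l then 1 else 0)) = (\<Sum>l<n. if k = l then z k else 0)"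
      by (intro sum.cong) auto
    then show "z k = (\<Sum>l<n. z l * (if k = l then 1 else 0))"
      using assms(2) by (simp add: cspace_def)
  qed
  then have "T z = T (\<lambda>i. \<Sum>l<n. z l * (if i = l then 1 else 0))"
    by simp
  also have "\<dots> = (\<lambda>k. \<Sum>l<n. z l * T (\<lambda>i. if i = l then 1 else 0) k)"
    by (intro linear_map_sum[OF assms(1)]) (auto simp: cspace_def)
  finally show ?thesis .
qed

lemma holomorphic_induced_map:
  assumes T: "form_isometry p q T"
  shows "holomorphic_map_on (p + q) (p + q) (gball p q) (induced_map p q T)"
proof -
  let ?n = "p + q"
  let ?W = "{w \<in> punctured ?n. proj_pt w \<in> gball p q}"
  define t where "t l = T (\<lambda>i. if i = l then 1 else 0)" for l :: nat
  have lin: "linear_map ?n T"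
    using T by (simp add: form_isometry_def)
  have T_eq: "T z k = (\<Sum>l<?n. z l * t l k)" if "z \<in> cspace ?n" for z k
    by (subst linear_map_expand[OF lin that]) (simp add: t_def)
  have hol: "holomorphic_fun_on ?n ?W (\<lambda>w. T w k)" for k
    unfolding holomorphic_fun_on_def
  proof (intro conjI ballI allI impI)
    have "continuous_on ?W (\<lambda>w. \<Sum>l<?n. w l * t l k)"
      by (intro continuous_intros continuous_on_subset[OF continuous_on_product_coordinates]) auto
    then show "continuous_on ?W (\<lambda>w. T w k)"
      by (rule continuous_on_eq) (simp add: T_eq punctured_def)
  next
    fix z i assume z: "z \<in> ?W" "i < ?n"
    have upd: "z(i := w) \<in> cspace ?n" for w
      using z by (auto simp: punctured_def cspace_def)
    have "(\<lambda>w. T (z(i := w)) k) = (\<lambda>w. \<Sum>l<?n. (z(i := w)) l * t l k)"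
      by (rule ext) (rule T_eq[OF upd])
    moreover have "(\<lambda>w. (z(i := w)) l * t l k) field_differentiable at (z i)" for l
      by (cases "l = i") (auto intro!: derivative_intros)
    then have "(\<lambda>w. \<Sum>l<?n. (z(i := w)) l * t l k) field_differentiable at (z i)"
      by (intro field_differentiable_sum)
    ultimately show "(\<lambda>w. T (z(i := w)) k) field_differentiable at (z i)"
      by simp
  qed
  have val: "T w \<in> punctured ?n \<and> induced_map p q T (proj_pt w) = Some (proj_pt (T w))"
    if w: "w \<in> ?W" for w
  proof -
    have "w \<in> cspace ?n" "hnorm p q w > 0"
      using w by (auto simp: punctured_def proj_pt_in_gball_iff)
    with induced_map_proj_pt[OF T this] lin show ?thesis
      by (auto intro: hnorm_pos_punctured linear_map_cspace)
  qed
  show ?thesis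
    unfolding holomorphic_map_on_def
  proof (intro conjI ballI impI)
    show "dom (induced_map p q T) = gball p q"
      by (auto simp: dom_def induced_map_def)
    fix z assume "z \<in> punctured ?n" "proj_pt z \<in> gball p q"
    then show "\<exists>W F. openin (top_of_set (punctured ?n)) W \<and> z \<in> W \<and>
        (\<forall>k<?n. holomorphic_fun_on ?n W (\<lambda>w. F w k)) \<and>
        (\<forall>w\<in>W. F w \<in> punctured ?n \<and> induced_map p q T (proj_pt w) = Some (proj_pt (F w)))"
      using openin_gball_preimage[of p q] hol val by (intro exI[of _ ?W] exI[of _ T]) simp
  qed
qed

lemma induced_map_inverse:
  assumes T: "form_isometry p q T" and S: "\<And>x. x \<in> cspace (p + q) \<Longrightarrow> S (T x) = x"
    and S': "form_isometry p q S"
  shows "induced_map p q S \<circ>\<^sub>m induced_map p q T = Some |` gball p q"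
proof
  fix x
  show "(induced_map p q S \<circ>\<^sub>m induced_map p q T) x = (Some |` gball p q) x"
  proof (cases "x \<in> gball p q")
    case True
    then obtain z where z: "z \<in> cspace (p + q)" "hnorm p q z > 0" "x = proj_pt z"
      by (rule gball_cases)
    have Tz: "T z \<in> cspace (p + q)"
      using T z(1) by (simp add: form_isometry_def linear_map_cspace)
    show ?thesis
      using induced_map_proj_pt[OF T z(1,2)] induced_map_proj_pt[OF S' Tz] S[OF z(1)] True
      by (simp add: map_comp_def z(3))
  qed (simp add: induced_map_def map_comp_def)
qed

lemma induced_map_Aut:
  assumes "pseudo_unitary p q T"
  shows "induced_map p q T \<in> Aut (p + q) (gball p q)"
proof -
  from assms obtain T' where T: "form_isometry p q T" "form_isometry p q T'"
    "\<And>x. x \<in> cspace (p + q) \<Longrightarrow> T' (T x) = x" "\<And>x. x \<in> cspace (p + q) \<Longrightarrow> T (T' x) = x"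
    by (auto simp: pseudo_unitary_def)
  then show ?thesis
    unfolding Aut_def
    by (auto intro!: holomorphic_induced_map exI[of _ "induced_map p q T'"] induced_map_inverse)
qed

section \<open>Monomial tuples and their polynomial\<close>

lemma eval_homog_scale:
  assumes "homog_poly n d p"
  shows "eval_mpoly p (\<lambda>i. c * z i) = c ^ d * eval_mpoly p z"
proof -
  have "(\<Prod>i\<in>keys e. (c * z i) ^ lookup e i) = c ^ d * (\<Prod>i\<in>keys e. z i ^ lookup e i)"
    if "e \<in> keys p" for e
  proof -
    have "(\<Prod>i\<in>keys e. c ^ lookup e i) = c ^ d"
      using assms that by (simp add: homog_poly_def mon_degree_def flip: power_sum)
    then show ?thesis
      by (simp add: power_mult_distrib prod.distrib)
  qed
  then show ?thesis
    unfolding eval_mpoly_def sum_distrib_left by (intro sum.cong) (simp_all add: mult_ac)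
qed

lemma eval_tuple_cspace: "eval_tuple gs z \<in> cspace (length gs)"
  by (simp add: eval_tuple_def cspace_def)

lemma eval_tuple_scale:
  assumes "homog_tuple n N d gs"
  shows "eval_tuple gs (\<lambda>i. c * z i) = (\<lambda>k. c ^ d * eval_tuple gs z k)"
  using assms by (auto simp: eval_tuple_def homog_tuple_def fun_eq_iff eval_homog_scale[of n d])

lemma punctured_scale:
  assumes "c \<noteq> 0"
  shows "(\<lambda>i. c * z i) \<in> punctured n \<longleftrightarrow> z \<in> punctured n"
  using assms by (auto simp: punctured_def cspace_def)

text \<open>
  The arbitrary representative in the definition of \<open>rat_map\<close> may be replaced by any other.
\<close>

lemma rat_map_proj_pt:
  assumes gs: "homog_tuple n N d gs" and z: "z \<in> punctured n"
  shows "rat_map n gs (proj_pt z) =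
    (if eval_tuple gs z \<in> punctured N then Some (proj_pt (eval_tuple gs z)) else None)"
proof -
  define w where "w = (SOME w. w \<in> proj_pt z)"
  have "w \<in> proj_pt z"
    unfolding w_def by (rule someI[of _ z]) (rule proj_pt_self)
  then obtain c where c: "c \<noteq> 0" "w = (\<lambda>i. c * z i)"
    by (auto simp: proj_pt_def)
  have "eval_tuple gs w = (\<lambda>k. c ^ d * eval_tuple gs z k)"
    unfolding c(2) by (rule eval_tuple_scale[OF gs])
  moreover have "proj_pt z \<in> proj_space n"
    using z by (simp add: proj_space_def)
  moreover have "length gs = N"
    using gs by (simp add: homog_tuple_def)
  ultimately show ?thesis
    using c(1) by (simp add: rat_map_def w_def[symmetric] Let_def punctured_scale proj_pt_scale)
qed

text \<open>
  The tuple of \<open>N\<close> monomials with exponents \<open>E k\<close> and coefficients \<open>C k\<close>.  It is regarded as the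
  vector-valued polynomial \<open>\<Sum>\<^sub>M z\<^sup>M u\<^sub>M\<close>, where \<open>u\<^sub>M\<close>, defined as \<open>mono_vec\<close>, collects the coefficients
  of the components with exponent \<open>M\<close>.
\<close>

definition mono_tuple :: "nat \<Rightarrow> (nat \<Rightarrow> nat \<Rightarrow>\<^sub>0 nat) \<Rightarrow> (nat \<Rightarrow> complex) \<Rightarrow> complex mpoly list" where
  "mono_tuple N E C = map (\<lambda>k. single (E k) (C k)) [0..<N]"

definition mono_vec :: "nat \<Rightarrow> (nat \<Rightarrow> nat \<Rightarrow>\<^sub>0 nat) \<Rightarrow> (nat \<Rightarrow> complex) \<Rightarrow> (nat \<Rightarrow>\<^sub>0 nat) \<Rightarrow> nat \<Rightarrow> complex" where
  "mono_vec N E C M = (\<lambda>k. if k < N \<and> E k = M then C k else 0)"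

text \<open>
  The polynomial \<open>P\<close> of a monomial tuple with \<open>p\<close> positive and \<open>q\<close> negative components.
\<close>

definition slot_poly :: "nat \<Rightarrow> nat \<Rightarrow> (nat \<Rightarrow> nat \<Rightarrow>\<^sub>0 nat) \<Rightarrow> (nat \<Rightarrow> complex) \<Rightarrow> real mpoly" where
  "slot_poly p q E C =
    (\<Sum>k<p. single (E k) ((cmod (C k))\<^sup>2)) - (\<Sum>k=p..<p+q. single (E k) ((cmod (C k))\<^sup>2))"

lemma monomial_tuple_cases:
  assumes "monomial_tuple n N d gs"
  obtains E C where "gs = mono_tuple N E C"
    "\<And>k. k < N \<Longrightarrow> C k \<noteq> 0 \<Longrightarrow> keys (E k) \<subseteq> {..<n} \<and> mon_degree (E k) = d"
    "\<exists>k<N. C k \<noteq> 0"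
proof -
  have len: "length gs = N" and hom: "\<And>p. p \<in> set gs \<Longrightarrow> homog_poly n d p"
    and nz: "\<exists>p\<in>set gs. p \<noteq> 0"
    and mono: "\<forall>p\<in>set gs. \<exists>e c. p = single e c"
    using assms by (auto simp: monomial_tuple_def homog_tuple_def)
  have "\<forall>k. \<exists>e c. k < N \<longrightarrow> gs ! k = single e c"
    using mono len by (metis nth_mem)
  then obtain E where "\<forall>k. \<exists>c. k < N \<longrightarrow> gs ! k = single (E k) c"
    by metis
  then obtain C where EC: "\<And>k. k < N \<Longrightarrow> gs ! k = single (E k) (C k)"
    by metis
  show thesis
  proof (rule that[of E C])
    show "gs = mono_tuple N E C"
      by (rule nth_equalityI) (simp_all add: mono_tuple_def len EC)
    show "keys (E k) \<subseteq> {..<n} \<and> mon_degree (E k) = d" if "k < N" "C k \<noteq> 0" for k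
    proof -
      have "gs ! k \<in> set gs"
        using that len by simp
      from hom[OF this] show ?thesis
        using that by (simp add: EC homog_poly_def)
    qed
    show "\<exists>k<N. C k \<noteq> 0"
      using nz len EC by (metis in_set_conv_nth single_zero)
  qed
qed

lemma length_mono_tuple [simp]: "length (mono_tuple N E C) = N"
  by (simp add: mono_tuple_def)

lemma eval_mono_tuple:
  "eval_tuple (mono_tuple N E C) z = (\<lambda>k. if k < N then C k * mon_eval (E k) z else 0)"
  by (auto simp: eval_tuple_def mono_tuple_def eval_mpoly_single)

lemma single_eq_0_iff: "single e c = 0 \<longleftrightarrow> c = 0"
  by (metis lookup_single_eq lookup_zero single_zero)

lemma in_set_mono_tuple: "p \<in> set (mono_tuple N E C) \<longleftrightarrow> (\<exists>k<N. p = single (E k) (C k))"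
  by (auto simp: mono_tuple_def)

lemma homog_mono_tuple:
  assumes "\<And>k. k < N \<Longrightarrow> C k \<noteq> 0 \<Longrightarrow> keys (E k) \<subseteq> {..<n} \<and> mon_degree (E k) = d"
    and "\<exists>k<N. C k \<noteq> 0"
  shows "homog_tuple n N d (mono_tuple N E C)"
proof -
  have "homog_poly n d (single (E k) (C k))" if "k < N" for k
    using assms(1)[OF that] by (simp add: homog_poly_def)
  moreover have "\<exists>p\<in>set (mono_tuple N E C). p \<noteq> 0"
    using assms(2) by (auto simp only: in_set_mono_tuple Bex_def single_eq_0_iff)
  ultimately show ?thesis
    by (auto simp only: homog_tuple_def length_mono_tuple in_set_mono_tuple)
qed

lemma mono_vec_cspace: "mono_vec N E C M \<in> cspace N"
  by (simp add: mono_vec_def cspace_def)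

lemma eval_mono_tuple_as_sum:
  assumes "finite K" "\<And>k. k < N \<Longrightarrow> C k \<noteq> 0 \<Longrightarrow> E k \<in> K"
  shows "eval_tuple (mono_tuple N E C) z = (\<lambda>k. \<Sum>M\<in>K. mon_eval M z * mono_vec N E C M k)"
proof
  fix k
  have "(\<Sum>M\<in>K. mon_eval M z * mono_vec N E C M k) =
      (\<Sum>M\<in>K. if E k = M then (if k < N then C k * mon_eval (E k) z else 0) else 0)"
    by (intro sum.cong) (auto simp: mono_vec_def)
  also have "\<dots> = (if E k \<in> K then (if k < N then C k * mon_eval (E k) z else 0) else 0)"
    using assms(1) by simp
  also have "\<dots> = eval_tuple (mono_tuple N E C) z k"
    using assms(2)[of k] by (auto simp: eval_mono_tuple)
  finally show "eval_tuple (mono_tuple N E C) z k = (\<Sum>M\<in>K. mon_eval M z * mono_vec N E C M k)"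
    by simp
qed

lemma hform_mono_vec_distinct:
  "M \<noteq> M' \<Longrightarrow> hform p q (mono_vec (p + q) E C M) (mono_vec (p + q) E C M') = 0"
proof -
  assume "M \<noteq> M'"
  then have zero: "mono_vec (p + q) E C M k * cnj (mono_vec (p + q) E C M' k) = 0" for k
    by (simp add: mono_vec_def)
  show ?thesis
    by (simp only: hform_def zero sum.neutral_const diff_self)
qed

lemma lookup_slot_poly:
  "lookup (slot_poly p q E C) M =
    (\<Sum>k<p. if E k = M then (cmod (C k))\<^sup>2 else 0) - (\<Sum>k=p..<p+q. if E k = M then (cmod (C k))\<^sup>2 else 0)"
  by (simp add: slot_poly_def lookup_minus lookup_sum lookup_single when_def)

text \<open>
  The vectors \<open>u\<^sub>M\<close> are orthogonal because their supports are disjoint, and their norms are the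
  coefficients of \<open>P\<close>.
\<close>

lemma hform_mono_vec_self:
  "hform p q (mono_vec (p + q) E C M) (mono_vec (p + q) E C M) = of_real (lookup (slot_poly p q E C) M)"
  unfolding hform_self lookup_slot_poly hnorm_def
  by (intro arg_cong[where f = of_real] arg_cong2[where f = minus] sum.cong)
    (auto simp: mono_vec_def)

lemma eval_slot_poly:
  "eval_mpoly (slot_poly p q E C) (\<lambda>i. (cmod (z i))\<^sup>2) =
    hnorm p q (eval_tuple (mono_tuple (p + q) E C) z)"
proof -
  have "(cmod (C k))\<^sup>2 * (\<Prod>i\<in>keys (E k). ((cmod (z i))\<^sup>2) ^ lookup (E k) i) =
      (cmod (C k * mon_eval (E k) z))\<^sup>2" for k
    by (simp add: norm_mult norm_power power_mult_distrib prod_power_distrib mult.commute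
        flip: prod_norm power_mult)
  then show ?thesis
    by (simp add: slot_poly_def hnorm_def eval_mono_tuple eval_mpoly_single)
qed

text \<open>
  Two monomial tuples with proportional polynomials differ by a scaled isometry, provided that none of
  the vectors \<open>u\<^sub>M\<close> that occur is isotropic.
\<close>

theorem mono_tuples_isometric:
  assumes c: "c > 0"
    and eq: "\<And>M. lookup (slot_poly p q E C) M = c * lookup (slot_poly p q E' C') M"
    and nz: "\<And>k. k < p + q \<Longrightarrow> C k \<noteq> 0 \<Longrightarrow> lookup (slot_poly p q E C) (E k) \<noteq> 0"
    and nz': "\<And>k. k < p + q \<Longrightarrow> C' k \<noteq> 0 \<Longrightarrow> lookup (slot_poly p q E' C') (E' k) \<noteq> 0"
  shows "\<exists>T. pseudo_unitary p q T \<and> (\<forall>z. T (eval_tuple (mono_tuple (p + q) E C) z) =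
    (\<lambda>i. of_real (sqrt c) * eval_tuple (mono_tuple (p + q) E' C') z i))"
proof -
  let ?N = "p + q"
  define K where "K = E ` {k. k < ?N \<and> C k \<noteq> 0} \<union> E' ` {k. k < ?N \<and> C' k \<noteq> 0}"
  have "finite K"
    by (simp add: K_def)
  have K: "E k \<in> K" if "k < ?N" "C k \<noteq> 0" for k
    using that by (auto simp: K_def)
  have K': "E' k \<in> K" if "k < ?N" "C' k \<noteq> 0" for k
    using that by (auto simp: K_def)
  let ?u = "mono_vec ?N E C" and ?u' = "mono_vec ?N E' C'"
  let ?v = "\<lambda>M i. of_real (sqrt c) * ?u' M i"
  have hv: "hform p q (?v M) (?v M') = of_real c * hform p q (?u' M) (?u' M')" for M M' :: "nat \<Rightarrow>\<^sub>0 nat"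
    using hform_lin_left[of p q "of_real (sqrt c)" "?u' M" 0 "?u' M" "?v M'"]
      hform_lin_right[of p q "?u' M" "of_real (sqrt c)" "?u' M'" 0 "?u' M'"] c
    by (simp flip: of_real_mult)
  have "\<exists>T. pseudo_unitary p q T \<and> (\<forall>M\<in>K. T (?u M) = ?v M)"
  proof (rule witt_extension[OF \<open>finite K\<close>])
    fix M assume M: "M \<in> K"
    show "?u M \<in> cspace ?N" "?v M \<in> cspace ?N"
      by (simp_all add: mono_vec_cspace cspace_scale)
    show "hform p q (?u M) (?u M) = hform p q (?v M) (?v M)"
      by (simp add: hv hform_mono_vec_self eq)
    have "lookup (slot_poly p q E C) M \<noteq> 0"
      using M nz nz' eq c by (auto simp: K_def)
    then show "hform p q (?v M) (?v M) \<noteq> 0"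
      using c by (simp add: hv hform_mono_vec_self eq)
  next
    fix M M' :: "nat \<Rightarrow>\<^sub>0 nat" assume "M \<noteq> M'"
    then show "hform p q (?u M) (?u M') = 0" "hform p q (?v M) (?v M') = 0"
      by (simp_all add: hv hform_mono_vec_distinct)
  qed
  then obtain T where T: "pseudo_unitary p q T" "\<And>M. M \<in> K \<Longrightarrow> T (?u M) = ?v M"
    by blast
  have lin: "linear_map ?N T"
    using T(1) by (simp add: pseudo_unitary_def form_isometry_def)
  have "T (eval_tuple (mono_tuple ?N E C) z) =
      (\<lambda>i. of_real (sqrt c) * eval_tuple (mono_tuple ?N E' C') z i)" for z
  proof -
    have "T (eval_tuple (mono_tuple ?N E C) z) = T (\<lambda>i. \<Sum>M\<in>K. mon_eval M z * ?u M i)"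
      by (subst eval_mono_tuple_as_sum[OF \<open>finite K\<close> K]) auto
    also have "\<dots> = (\<lambda>i. \<Sum>M\<in>K. mon_eval M z * T (?u M) i)"
      by (rule linear_map_sum[OF lin \<open>finite K\<close> mono_vec_cspace])
    also have "\<dots> = (\<lambda>i. \<Sum>M\<in>K. mon_eval M z * ?v M i)"
      by (simp add: T(2))
    also have "\<dots> = (\<lambda>i. of_real (sqrt c) * (\<Sum>M\<in>K. mon_eval M z * ?u' M i))"
      by (simp add: sum_distrib_left mult_ac)
    also have "\<dots> = (\<lambda>i. of_real (sqrt c) * eval_tuple (mono_tuple ?N E' C') z i)"
      by (subst eval_mono_tuple_as_sum[OF \<open>finite K\<close> K', where z = z]) auto
    finally show ?thesis .
  qed
  with T(1) show ?thesis by blast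
qed

lemma slot_poly_pos_terms: "pos_terms (slot_poly p q E C) \<subseteq> E ` {..<p}"
proof
  fix M assume "M \<in> pos_terms (slot_poly p q E C)"
  moreover have "0 \<le> (\<Sum>k=p..<p+q. if E k = M then (cmod (C k))\<^sup>2 else 0)"
    by (intro sum_nonneg) auto
  ultimately have "0 < (\<Sum>k<p. if E k = M then (cmod (C k))\<^sup>2 else 0)"
    by (simp add: pos_terms_def lookup_slot_poly)
  then show "M \<in> E ` {..<p}"
    by (rule contrapos_pp) (auto simp: not_less intro!: sum_nonpos)
qed

lemma slot_poly_neg_terms: "neg_terms (slot_poly p q E C) \<subseteq> E ` {p..<p+q}"
proof
  fix M assume "M \<in> neg_terms (slot_poly p q E C)"
  moreover have "0 \<le> (\<Sum>k<p. if E k = M then (cmod (C k))\<^sup>2 else 0)"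
    by (intro sum_nonneg) auto
  ultimately have "0 < (\<Sum>k=p..<p+q. if E k = M then (cmod (C k))\<^sup>2 else 0)"
    by (simp add: neg_terms_def lookup_slot_poly)
  then show "M \<in> E ` {p..<p+q}"
    by (rule contrapos_pp) (auto simp: not_less intro!: sum_nonpos)
qed

lemma card_pos_terms_slot_poly: "card (pos_terms (slot_poly p q E C)) \<le> p"
  using card_mono[OF _ slot_poly_pos_terms[of p q E C]] card_image_le[of "{..<p}" E] by simp

lemma card_neg_terms_slot_poly: "card (neg_terms (slot_poly p q E C)) \<le> q"
  using card_mono[OF _ slot_poly_neg_terms[of p q E C]] card_image_le[of "{p..<p+q}" E] by simp

text \<open>
  If \<open>P\<close> has as many positive and negative terms as there are components, then the components have
  distinct exponents and nothing cancels in \<open>P\<close>.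
\<close>

lemma slot_poly_all_used:
  assumes "card (pos_terms (slot_poly p q E C)) \<ge> p" "card (neg_terms (slot_poly p q E C)) \<ge> q"
    and "k < p + q"
  shows "lookup (slot_poly p q E C) (E k) \<noteq> 0"
proof (cases "k < p")
  case True
  have "card (E ` {..<p}) \<le> card (pos_terms (slot_poly p q E C))"
    using card_image_le[of "{..<p}" E] assms(1) by simp
  then have "pos_terms (slot_poly p q E C) = E ` {..<p}"
    by (intro card_seteq slot_poly_pos_terms) auto
  then have "E k \<in> pos_terms (slot_poly p q E C)"
    using True by simp
  then show ?thesis
    by (simp add: pos_terms_def)
next
  case False
  have "card (E ` {p..<p+q}) \<le> card (neg_terms (slot_poly p q E C))"
    using card_image_le[of "{p..<p+q}" E] assms(2) by simp
  then have "neg_terms (slot_poly p q E C) = E ` {p..<p+q}"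
    by (intro card_seteq slot_poly_neg_terms) auto
  then have "E k \<in> neg_terms (slot_poly p q E C)"
    using False assms(3) by simp
  then show ?thesis
    by (simp add: neg_terms_def)
qed

lemma lookup_slot_poly_inj:
  assumes inj: "inj_on E {..<p+q}" and k: "k < p + q"
  shows "lookup (slot_poly p q E C) (E k) = (if k < p then 1 else -1) * (cmod (C k))\<^sup>2"
proof -
  have eq: "E l = E k \<longleftrightarrow> l = k" if "l < p + q" for l
    using inj_onD[OF inj, of l k] that k by auto
  have "(\<Sum>l<p. if E l = E k then (cmod (C l))\<^sup>2 else 0) = (\<Sum>l<p. if l = k then (cmod (C l))\<^sup>2 else 0)"
    by (intro sum.cong) (auto simp: eq)
  moreover have "(\<Sum>l=p..<p+q. if E l = E k then (cmod (C l))\<^sup>2 else 0) =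
      (\<Sum>l=p..<p+q. if l = k then (cmod (C l))\<^sup>2 else 0)"
    by (intro sum.cong) (auto simp: eq)
  ultimately show ?thesis
    using k by (simp add: lookup_slot_poly)
qed

lemma card_terms_slot_poly_inj:
  assumes inj: "inj_on E {..<p+q}" and C: "\<And>k. k < p + q \<Longrightarrow> C k \<noteq> 0"
  shows "card (pos_terms (slot_poly p q E C)) \<ge> p" "card (neg_terms (slot_poly p q E C)) \<ge> q"
proof -
  have "E ` {..<p} \<subseteq> pos_terms (slot_poly p q E C)"
    using C by (auto simp: pos_terms_def lookup_slot_poly_inj[OF inj])
  from card_mono[OF finite_pos_terms this] show "card (pos_terms (slot_poly p q E C)) \<ge> p"
    using inj_on_subset[OF inj, of "{..<p}"] by (simp add: card_image)
  have "E ` {p..<p+q} \<subseteq> neg_terms (slot_poly p q E C)"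
    using C by (auto simp: neg_terms_def lookup_slot_poly_inj[OF inj])
  from card_mono[OF finite_neg_terms this] show "card (neg_terms (slot_poly p q E C)) \<ge> q"
    using inj_on_subset[OF inj, of "{p..<p+q}"] by (simp add: card_image subset_iff)
qed

text \<open>
  If \<open>T \<circ> g \<circ> S\<close> is proportional to \<open>h\<close>, then the rational map of \<open>h\<close> is itself a common extension of
  \<open>h\<close> and of the composition of \<open>g\<close> with the automorphisms induced by \<open>T\<close> and \<open>S\<close>.
\<close>

lemma rationally_equivalent_by_isometries:
  assumes gs: "homog_tuple (r + s) (p + q) d gs" and hs: "homog_tuple (r + s) (p + q) e hs"
    and T: "form_isometry p q T" and S: "form_isometry r s S" and "a \<noteq> 0"
    and eq: "\<And>z. z \<in> cspace (r + s) \<Longrightarrow> T (eval_tuple gs (S z)) = (\<lambda>i. a * eval_tuple hs z i)"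
  shows "rationally_equivalent (r + s) (p + q)
    (induced_map p q T \<circ>\<^sub>m rat_map (r + s) gs \<circ>\<^sub>m induced_map r s S) (rat_map (r + s) hs)"
  unfolding rationally_equivalent_def
proof (intro exI conjI)
  show "is_rational_map (r + s) (p + q) (rat_map (r + s) hs)"
    using hs by (auto simp: is_rational_map_def)
  show "rat_map (r + s) hs \<subseteq>\<^sub>m rat_map (r + s) hs"
    by simp
  show "induced_map p q T \<circ>\<^sub>m rat_map (r + s) gs \<circ>\<^sub>m induced_map r s S \<subseteq>\<^sub>m rat_map (r + s) hs"
    unfolding map_le_def
  proof
    fix x assume x: "x \<in> dom (induced_map p q T \<circ>\<^sub>m rat_map (r + s) gs \<circ>\<^sub>m induced_map r s S)"
    then have "x \<in> gball r s"
      by (auto simp: map_comp_def induced_map_def split: option.splits if_splits)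
    then obtain z where z: "z \<in> cspace (r + s)" "z \<in> punctured (r + s)" "hnorm r s z > 0" "x = proj_pt z"
      by (rule gball_cases)
    let ?w = "eval_tuple gs (S z)"
    note Sz = induced_map_proj_pt[OF S z(1,3)]
    have "S z \<in> cspace (r + s)"
      using S z(1) by (simp add: form_isometry_def linear_map_cspace)
    then have "S z \<in> punctured (r + s)"
      using Sz(2) by (auto intro: hnorm_pos_punctured)
    note g = rat_map_proj_pt[OF gs this]
    have comp: "(induced_map p q T \<circ>\<^sub>m rat_map (r + s) gs \<circ>\<^sub>m induced_map r s S) x =
        (if ?w \<in> punctured (p + q) then induced_map p q T (proj_pt ?w) else None)"
      by (simp add: map_comp_def z(4) Sz(1) g)
    have "proj_pt ?w \<in> gball p q"
      using x unfolding dom_def mem_Collect_eq comp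
      by (auto simp: induced_map_def split: if_splits)
    have w: "?w \<in> cspace (p + q)"
      using eval_tuple_cspace[of gs "S z"] gs by (simp add: homog_tuple_def)
    with \<open>proj_pt ?w \<in> gball p q\<close> have hw: "hnorm p q ?w > 0"
      by (simp add: proj_pt_in_gball_iff)
    note Tw = induced_map_proj_pt[OF T w hw]
    have "T ?w \<in> cspace (p + q)"
      using T w by (simp add: form_isometry_def linear_map_cspace)
    then have "T ?w \<in> punctured (p + q)"
      using Tw(2) by (auto intro: hnorm_pos_punctured)
    then have "eval_tuple hs z \<in> punctured (p + q)"
      unfolding eq[OF z(1)] using \<open>a \<noteq> 0\<close> by (simp add: punctured_scale)
    moreover have "?w \<in> punctured (p + q)"
      using w hw by (auto intro: hnorm_pos_punctured)
    ultimately have "(induced_map p q T \<circ>\<^sub>m rat_map (r + s) gs \<circ>\<^sub>m induced_map r s S) x = Some (proj_pt (T ?w))"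
      and "rat_map (r + s) hs x = Some (proj_pt (eval_tuple hs z))"
      unfolding comp by (simp_all add: Tw(1) z(4) rat_map_proj_pt[OF hs z(2)])
    then show "(induced_map p q T \<circ>\<^sub>m rat_map (r + s) gs \<circ>\<^sub>m induced_map r s S) x = rat_map (r + s) hs x"
      by (simp only: eq[OF z(1)] proj_pt_scale[OF \<open>a \<noteq> 0\<close>])
  qed
qed

section \<open>Consequences of properness\<close>

lemma topspace_proj_topology: "topspace (proj_topology n) = proj_space n"
proof -
  have "{z \<in> punctured n. proj_pt z \<in> proj_space n} = punctured n"
    by (auto simp: proj_space_def)
  then have "openin (proj_topology n) (proj_space n)"
    by (simp add: openin_proj_topology)
  then show ?thesis
    by (intro equalityI openin_subset) (auto simp: topspace_def openin_proj_topology)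
qed

lemma openin_proj_topologyI:
  assumes "U \<subseteq> proj_space n" "open S" "\<And>z. z \<in> punctured n \<Longrightarrow> proj_pt z \<in> U \<longleftrightarrow> z \<in> S"
  shows "openin (proj_topology n) U"
proof -
  have "{z \<in> punctured n. proj_pt z \<in> U} = punctured n \<inter> S"
    using assms(3) by blast
  then show ?thesis
    using assms(1,2) by (simp add: openin_proj_topology openin_open_Int)
qed

lemma openin_proj_topologyD:
  assumes "openin (proj_topology n) U"
  obtains S where "open S" "\<And>z. z \<in> punctured n \<Longrightarrow> proj_pt z \<in> U \<longleftrightarrow> z \<in> S"
proof -
  from assms obtain S where "open S" "{z \<in> punctured n. proj_pt z \<in> U} = punctured n \<inter> S"
    by (auto simp: openin_proj_topology openin_open)
  then show thesis
    by (intro that[of S]) auto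
qed

lemma hnorm_zero_approximable:
  assumes z: "z \<in> punctured (r + s)" "hnorm r s z = 0" and S: "open S" "z \<in> S"
  obtains w where "w \<in> S" "w \<in> cspace (r + s)" "hnorm r s w > 0"
proof -
  \<comment> \<open>Enlarging the first \<open>r\<close> coordinates moves the point into the ball.\<close>
  define f :: "real \<Rightarrow> nat \<Rightarrow> complex" where
    "f t = (\<lambda>i. (if i < r then of_real (1 + t) else 1) * z i)" for t
  have "continuous_on UNIV (\<lambda>t. f t i)" for i
    by (cases "i < r") (auto simp: f_def intro!: continuous_intros)
  then have "continuous_on UNIV f"
    by (rule continuous_on_coordinatewise_then_product)
  then have "open (f -` S)"
    using S(1) by (intro open_vimage)
  moreover have "f 0 = z"
    by (simp add: f_def fun_eq_iff)
  ultimately obtain e where e: "e > 0" "ball 0 e \<subseteq> f -` S"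
    using S(2) by (metis openE vimageI2)
  define t where "t = e / 2"
  have t: "t > 0" "f t \<in> S"
    using e by (auto simp: t_def dist_real_def subset_iff)
  have sums: "(\<Sum>i<r. (cmod (z i))\<^sup>2) = (\<Sum>i=r..<r+s. (cmod (z i))\<^sup>2)"
    using z(2) by (simp add: hnorm_def)
  have "(\<Sum>i<r. (cmod (z i))\<^sup>2) > 0"
  proof (rule ccontr)
    assume "\<not> ?thesis"
    then have "(\<Sum>i<r. (cmod (z i))\<^sup>2) = 0"
      by (metis sum_power2_ge_zero not_less order_antisym sum_nonneg zero_le_power2)
    then have "z i = 0" if "i < r + s" for i
      using that sums by (cases "i < r") (auto simp: sum_nonneg_eq_0_iff)
    then show False
      using z(1) by (auto simp: punctured_def cspace_def not_less) (metis not_less)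
  qed
  moreover have "(\<Sum>i<r. (cmod (f t i))\<^sup>2) = (1 + t)\<^sup>2 * (\<Sum>i<r. (cmod (z i))\<^sup>2)"
  proof -
    have "cmod (f t i) = (1 + t) * cmod (z i)" if "i < r" for i
      using that t(1) unfolding f_def norm_mult if_P[OF that] norm_of_real by simp
    then have "(cmod (f t i))\<^sup>2 = (1 + t)\<^sup>2 * (cmod (z i))\<^sup>2" if "i < r" for i
      using that by (simp add: power_mult_distrib)
    then show ?thesis by (simp add: sum_distrib_left)
  qed
  moreover have "(\<Sum>i=r..<r+s. (cmod (f t i))\<^sup>2) = (\<Sum>i=r..<r+s. (cmod (z i))\<^sup>2)"
    by (intro sum.cong) (auto simp: f_def)
  moreover have "(1 + t)\<^sup>2 > 1"
    using t(1) by (simp add: power2_eq_square algebra_simps add_pos_pos)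
  ultimately have "hnorm r s (f t) > 0"
    by (simp add: hnorm_def sums)
  moreover have "f t \<in> cspace (r + s)"
    using z(1) by (simp add: f_def cspace_def punctured_def)
  ultimately show thesis
    using t(2) that by blast
qed

lemma boundary_if_hnorm_zero:
  assumes z: "z \<in> punctured (r + s)" "hnorm r s z = 0"
  shows "proj_pt z \<in> gball_boundary r s"
proof -
  have "z \<in> cspace (r + s)"
    using z(1) by (simp add: punctured_def)
  then have "proj_pt z \<notin> gball r s"
    using z(2) by (simp add: proj_pt_in_gball_iff)
  then have "proj_pt z \<notin> proj_topology (r + s) interior_of gball r s"
    using interior_of_subset by fast
  moreover have "\<exists>y. y \<in> gball r s \<and> y \<in> T" if T: "proj_pt z \<in> T" "openin (proj_topology (r + s)) T" for T
  proof -
    from T(2) obtain S where S: "open S" "\<And>z. z \<in> punctured (r + s) \<Longrightarrow> proj_pt z \<in> T \<longleftrightarrow> z \<in> S"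
      by (rule openin_proj_topologyD) blast
    then have "z \<in> S"
      using z(1) T(1) by blast
    with z S(1) obtain w where w: "w \<in> S" "w \<in> cspace (r + s)" "hnorm r s w > 0"
      by (rule hnorm_zero_approximable)
    then have "w \<in> punctured (r + s)"
      by (auto intro: hnorm_pos_punctured)
    with w S(2) show ?thesis
      by (intro exI[of _ "proj_pt w"]) (simp add: proj_pt_in_gball_iff)
  qed
  ultimately show ?thesis
    using z(1) by (auto simp: gball_boundary_def frontier_of_def in_closure_of
        topspace_proj_topology proj_space_def)
qed

lemma openin_gball: "openin (proj_topology (p + q)) (gball p q)"
  unfolding openin_proj_topology using openin_gball_preimage[of p q]
  by (auto simp: proj_space_def elim!: gball_cases)

lemma hnorm_zero_if_boundary:
  assumes "x \<in> gball_boundary p q"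
  obtains w where "w \<in> punctured (p + q)" "hnorm p q w = 0" "x = proj_pt w"
proof -
  let ?X = "proj_topology (p + q)"
  have x: "x \<in> ?X closure_of gball p q" "x \<notin> gball p q"
    using assms openin_gball[of p q]
    by (auto simp: gball_boundary_def frontier_of_def interior_of_openin)
  then obtain w where w: "w \<in> punctured (p + q)" "x = proj_pt w"
    by (auto simp: in_closure_of topspace_proj_topology proj_space_def)
  then have w_cspace: "w \<in> cspace (p + q)"
    by (simp add: punctured_def)
  have "\<not> hnorm p q w < 0"
  proof
    assume neg: "hnorm p q w < 0"
    let ?T = "proj_pt ` {v \<in> punctured (p + q). hnorm p q v < 0}"
    have T: "proj_pt v \<in> ?T \<longleftrightarrow> hnorm p q v < 0" if v: "v \<in> punctured (p + q)" for v
    proof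
      assume "proj_pt v \<in> ?T"
      then obtain u where u: "proj_pt v = proj_pt u" "hnorm p q u < 0"
        by auto
      from u(1) obtain c where "c \<noteq> 0" "v = (\<lambda>i. c * u i)"
        by (rule proj_pt_eqD)
      then show "hnorm p q v < 0"
        using u(2) by (simp add: hnorm_scale mult_pos_neg)
    qed (use v in auto)
    have "openin ?X ?T"
    proof (rule openin_proj_topologyI)
      show "open {v. hnorm p q v < 0}"
        by (intro open_Collect_less continuous_intros continuous_on_hnorm)
    qed (use T in \<open>auto simp: proj_space_def\<close>)
    moreover have "x \<in> ?T"
      using w neg by auto
    ultimately have "\<exists>y. y \<in> gball p q \<and> y \<in> ?T"
      using x(1)[unfolded in_closure_of, THEN conjunct2, rule_format, of ?T] by blast
    then obtain y where y: "y \<in> gball p q" "y \<in> ?T"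
      by (elim exE conjE)
    from y(1) obtain v where "v \<in> punctured (p + q)" "hnorm p q v > 0" "y = proj_pt v"
      by (rule gball_cases)
    with y(2) T[of v] show False by simp
  qed
  moreover have "\<not> hnorm p q w > 0"
    using x(2) w(2) w_cspace by (simp add: proj_pt_in_gball_iff)
  ultimately show thesis
    using w by (intro that) auto
qed

lemma continuous_on_eval_mpoly: "continuous_on A (eval_mpoly (p :: complex mpoly))"
  unfolding eval_mpoly_def[abs_def]
  by (intro continuous_intros continuous_on_subset[OF continuous_on_product_coordinates]) auto

lemma continuous_on_eval_tuple: "continuous_on A (\<lambda>z. eval_tuple gs z k)"
  by (cases "k < length gs") (auto simp: eval_tuple_def intro: continuous_on_eval_mpoly)

lemma hnorm_zero_not_punctured:
  assumes "z \<in> cspace (p + q)" "z \<notin> punctured (p + q)"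
  shows "hnorm p q z = 0"
  using assms by (auto simp: punctured_def hnorm_def)

text \<open>
  Properness means that points with \<open>\<langle>z, z\<rangle> = 0\<close> are mapped to points with this property.  Otherwise
  the points where \<open>\<bar>\<langle>w, w\<rangle>\<bar>\<close> is small in comparison with the Euclidean norm form a neighbourhood of the
  boundary of the target that the images of the points near \<open>z\<close> do not enter.
\<close>

lemma proper_hnorm_zero:
  assumes gs: "homog_tuple (r + s) (p + q) d gs"
    and proper: "proper_gball_map r s p q (rat_map (r + s) gs)"
    and z: "z \<in> punctured (r + s)" "hnorm r s z = 0"
  shows "hnorm p q (eval_tuple gs z) = 0"
proof (rule ccontr)
  let ?G = "eval_tuple gs" and ?g = "rat_map (r + s) gs"
  let ?X = "proj_topology (r + s)" and ?Y = "proj_topology (p + q)"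
  assume nz: "hnorm p q (?G z) \<noteq> 0"
  have len: "length gs = p + q"
    using gs by (simp add: homog_tuple_def)
  have G_cspace: "?G w \<in> cspace (p + q)" for w
    using eval_tuple_cspace[of gs w] by (simp add: len)
  have Gz: "?G z \<in> punctured (p + q)"
    using nz G_cspace hnorm_zero_not_punctured by blast
  define nsq where "nsq w = (\<Sum>i<p+q. (cmod (w i))\<^sup>2)" for w :: "nat \<Rightarrow> complex"
  have nsq_pos: "nsq w > 0" if w: "w \<in> punctured (p + q)" for w
  proof -
    obtain i where i: "w i \<noteq> 0"
      using w by (auto simp: punctured_def)
    then have "i < p + q"
      using w by (auto simp: punctured_def cspace_def not_less[symmetric])
    with i show ?thesis
      unfolding nsq_def by (intro sum_pos2[of _ i]) auto
  qed
  have nsq_scale: "nsq (\<lambda>i. c * w i) = (cmod c)\<^sup>2 * nsq w" for c w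
    by (simp add: nsq_def norm_mult power_mult_distrib sum_distrib_left)
  have cont_nsq: "continuous_on A nsq" for A
    unfolding nsq_def[abs_def]
    by (intro continuous_intros continuous_on_subset[OF continuous_on_product_coordinates]) auto
  define \<delta> where "\<delta> = \<bar>hnorm p q (?G z)\<bar> / (2 * nsq (?G z))"
  have \<delta>: "\<delta> > 0" "\<delta> * nsq (?G z) < \<bar>hnorm p q (?G z)\<bar>"
    using nz nsq_pos[OF Gz] by (auto simp: \<delta>_def)
  define V where "V = proj_pt ` {w \<in> punctured (p + q). \<bar>hnorm p q w\<bar> < \<delta> * nsq w}"
  have V_iff: "proj_pt w \<in> V \<longleftrightarrow> \<bar>hnorm p q w\<bar> < \<delta> * nsq w" if w: "w \<in> punctured (p + q)" for w
  proof
    assume "proj_pt w \<in> V"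
    then obtain u where u: "proj_pt w = proj_pt u" "\<bar>hnorm p q u\<bar> < \<delta> * nsq u"
      by (auto simp: V_def)
    from u(1) obtain c where "c \<noteq> 0" "w = (\<lambda>i. c * u i)"
      by (rule proj_pt_eqD)
    then show "\<bar>hnorm p q w\<bar> < \<delta> * nsq w"
      using u(2) by (simp add: hnorm_scale nsq_scale abs_mult mult.left_commute)
  qed (use w in \<open>auto simp: V_def\<close>)
  have "openin ?Y V"
  proof (rule openin_proj_topologyI)
    show "open {w. \<bar>hnorm p q w\<bar> < \<delta> * nsq w}"
      by (intro open_Collect_less continuous_intros continuous_on_hnorm cont_nsq)
  qed (use V_iff in \<open>auto simp: V_def proj_space_def\<close>)
  moreover have "gball_boundary p q \<subseteq> V"
  proof
    fix x assume "x \<in> gball_boundary p q"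
    then obtain w where "w \<in> punctured (p + q)" "hnorm p q w = 0" "x = proj_pt w"
      by (rule hnorm_zero_if_boundary)
    then show "x \<in> V"
      using V_iff[of w] \<delta>(1) nsq_pos[of w] by simp
  qed
  moreover have dom_iff: "proj_pt w \<in> dom ?g \<longleftrightarrow> ?G w \<in> punctured (p + q)"
    if "w \<in> punctured (r + s)" for w
    using rat_map_proj_pt[OF gs that] by (auto simp: dom_def)
  have "openin ?X (dom ?g)"
  proof (rule openin_proj_topologyI)
    show "dom ?g \<subseteq> proj_space (r + s)"
      by (auto simp: rat_map_def Let_def split: if_splits)
    have "open {w. ?G w k \<noteq> 0}" for k
      by (intro open_Collect_neq continuous_on_eval_tuple continuous_intros)
    then show "open (\<Union>k. {w. ?G w k \<noteq> 0})"
      by blast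
    fix w assume "w \<in> punctured (r + s)"
    then show "proj_pt w \<in> dom ?g \<longleftrightarrow> w \<in> (\<Union>k. {w. ?G w k \<noteq> 0})"
      using G_cspace by (simp add: dom_iff punctured_def)
  qed
  moreover have "proj_pt z \<in> gball_boundary r s"
    using z by (rule boundary_if_hnorm_zero)
  moreover have z_dom: "proj_pt z \<in> dom ?g"
    using dom_iff[OF z(1)] Gz by simp
  moreover have "dom ?g \<inter> indeterminacy (r + s) ?g = {}"
    by (auto simp: indeterminacy_def)
  ultimately obtain W where W: "openin ?X W" "proj_pt z \<in> W" "W \<subseteq> dom ?g"
    "\<And>y. y \<in> W \<inter> gball r s \<Longrightarrow> the (?g y) \<in> V"
    using proper unfolding proper_gball_map_def proper_on_def by (metis IntI)
  from W(1) obtain S where S: "open S" "\<And>w. w \<in> punctured (r + s) \<Longrightarrow> proj_pt w \<in> W \<longleftrightarrow> w \<in> S"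
    by (rule openin_proj_topologyD) blast
  let ?S' = "{w. \<delta> * nsq (?G w) < \<bar>hnorm p q (?G w)\<bar>}"
  have "continuous_on UNIV ?G"
    by (rule continuous_on_coordinatewise_then_product) (rule continuous_on_eval_tuple)
  then have "continuous_on UNIV (\<lambda>w. nsq (?G w))" "continuous_on UNIV (\<lambda>w. hnorm p q (?G w))"
    by (auto intro!: continuous_on_compose2[OF cont_nsq[of UNIV]] continuous_on_compose2[OF continuous_on_hnorm[of UNIV]])
  then have "open ?S'"
    by (intro open_Collect_less continuous_intros)
  then have "open (S \<inter> ?S')"
    using S(1) by blast
  moreover have "z \<in> S \<inter> ?S'"
    using S(2)[OF z(1)] W(2) \<delta>(2) by simp
  ultimately obtain w where w: "w \<in> S \<inter> ?S'" "w \<in> cspace (r + s)" "hnorm r s w > 0"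
    by (rule hnorm_zero_approximable[OF z])
  have wp: "w \<in> punctured (r + s)"
    using w by (auto intro: hnorm_pos_punctured)
  have wW: "proj_pt w \<in> W \<inter> gball r s"
    using S(2)[OF wp] w by (simp add: proj_pt_in_gball_iff)
  then have "?G w \<in> punctured (p + q)"
    using W(3) dom_iff[OF wp] by blast
  then show False
    using W(4)[OF wW] V_iff w(1) by (simp add: rat_map_proj_pt[OF gs wp])
qed

lemma gball_map_hnorm_pos:
  assumes gs: "homog_tuple (r + s) (p + q) d gs"
    and g: "rational_gball_map r s p q (rat_map (r + s) gs)"
    and z: "z \<in> cspace (r + s)" "hnorm r s z > 0" and Gz: "eval_tuple gs z \<in> punctured (p + q)"
  shows "hnorm p q (eval_tuple gs z) > 0"
proof -
  have "z \<in> punctured (r + s)"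
    using z by (auto intro: hnorm_pos_punctured)
  then have eq: "rat_map (r + s) gs (proj_pt z) = Some (proj_pt (eval_tuple gs z))"
    using Gz by (simp add: rat_map_proj_pt[OF gs])
  have "proj_pt z \<in> gball r s - indeterminacy (r + s) (rat_map (r + s) gs)"
    using z eq by (auto simp: proj_pt_in_gball_iff indeterminacy_def)
  then have "proj_pt (eval_tuple gs z) \<in> gball p q"
    using g eq unfolding rational_gball_map_def by (metis option.sel)
  then show ?thesis
    using Gz by (simp add: proj_pt_in_gball_iff punctured_def)
qed

section \<open>Products with powers of the hyperplane form\<close>

text \<open>
  The degree of \<open>P\<close> in the \<open>x\<close>-variables is at most \<open>a\<close>, and the part of this degree has nonnegative
  coefficients.  Multiplying by \<open>\<Sum> x\<^sub>i - \<Sum> y\<^sub>j\<close> multiplies this part by \<open>\<Sum> x\<^sub>i\<close>, so that nothing cancels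
  in it.
\<close>

definition lead_nonneg :: "nat \<Rightarrow> nat \<Rightarrow> real mpoly \<Rightarrow> bool" where
  "lead_nonneg r a P \<longleftrightarrow> (\<forall>M\<in>keys P. xdeg r M \<le> a) \<and> (\<forall>M. xdeg r M = a \<longrightarrow> lookup P M \<ge> 0)"

lemma lead_nonneg_hyperplane_mult:
  assumes P: "lead_nonneg r a P"
  shows "lead_nonneg r (Suc a) (hyperplane_form r s * P)"
    and "\<lbrakk>xdeg r M = a; lookup P M > 0; i < r\<rbrakk> \<Longrightarrow> lookup (hyperplane_form r s * P) (unit_mon i + M) > 0"
proof -
  have y: "lookup (Var j * P) M = 0" if "r \<le> j" "xdeg r M = Suc a" for j M
  proof (rule lookup_Var_mult_eq_0)
    fix M' assume "M' \<in> keys P"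
    then have "xdeg r M' \<le> a"
      using P by (simp add: lead_nonneg_def)
    then show "M \<noteq> unit_mon j + M'"
      using that by auto
  qed
  have x: "lookup (Var i * P) M \<ge> 0" if "i < r" "xdeg r M = Suc a" for i M
  proof (cases "lookup (Var i * P) M = 0")
    case False
    then obtain M' where "M = unit_mon i + M'" "lookup (Var i * P) M = lookup P M'"
      by (rule lookup_Var_mult_cases)
    with that P show ?thesis
      by (simp add: lead_nonneg_def)
  qed simp
  have eq: "lookup (hyperplane_form r s * P) M = (\<Sum>i<r. lookup (Var i * P) M)" if "xdeg r M = Suc a" for M
    using that by (simp add: lookup_hyperplane_mult y)
  have "xdeg r M \<le> Suc a" if "M \<in> keys (hyperplane_form r s * P)" for M
  proof (rule ccontr)
    assume "\<not> ?thesis"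
    have "lookup (Var b * P) M = 0" for b
    proof (rule lookup_Var_mult_eq_0)
      fix M' assume "M' \<in> keys P"
      then have "xdeg r M' \<le> a"
        using P by (simp add: lead_nonneg_def)
      then show "M \<noteq> unit_mon b + M'"
        using \<open>\<not> xdeg r M \<le> Suc a\<close> by (auto split: if_splits)
    qed
    then have "lookup (hyperplane_form r s * P) M = 0"
      by (simp add: lookup_hyperplane_mult)
    with that show False
      by (simp add: in_keys_iff)
  qed
  then show "lead_nonneg r (Suc a) (hyperplane_form r s * P)"
    unfolding lead_nonneg_def by (auto simp: eq intro!: sum_nonneg x)
  assume M: "xdeg r M = a" "lookup P M > 0" "i < r"
  then have deg: "xdeg r (unit_mon i + M) = Suc a"
    by simp
  have "lookup (Var i * P) (unit_mon i + M) \<le> (\<Sum>i'<r. lookup (Var i' * P) (unit_mon i + M))"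
    using M(3) deg by (intro member_le_sum) (auto intro: x)
  then show "lookup (hyperplane_form r s * P) (unit_mon i + M) > 0"
    using M(2) by (simp add: eq[OF deg] lookup_Var_mult)
qed

lemma lead_nonneg_hyperplane_power:
  assumes "lead_nonneg r a Q" and M: "xdeg r M = a" "lookup Q M > 0"
    and "keys N \<subseteq> {..<r}" "mon_degree N = m"
  shows "lead_nonneg r (a + m) (hyperplane_form r s ^ m * Q) \<and>
    lookup (hyperplane_form r s ^ m * Q) (N + M) > 0"
  using assms(4,5)
proof (induction m arbitrary: N)
  case 0
  then show ?case
    using assms(1-3) by (simp add: mon_degree_0_iff)
next
  case (Suc m)
  from Suc.prems(2,1) obtain i N' where N': "i \<in> {..<r}" "N = unit_mon i + N'" "mon_degree N' = m" "keys N' \<subseteq> {..<r}"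
    by (rule mon_degree_Suc_split)
  have IH: "lead_nonneg r (a + m) (hyperplane_form r s ^ m * Q)"
    "lookup (hyperplane_form r s ^ m * Q) (N' + M) > 0"
    using Suc.IH[OF N'(4,3)] by auto
  have "xdeg r N' = m"
    using N'(3) mon_degree_superset[of "{..<r}" N'] N'(4) by (simp add: xdeg_def)
  then have "xdeg r (N' + M) = a + m"
    using M(1) by simp
  with lead_nonneg_hyperplane_mult[OF IH(1)] IH(2) N'(1) show ?case
    by (simp add: N'(2) mult.assoc add.assoc)
qed

text \<open>
  The counterpart for the part of lowest degree \<open>b\<close> in the \<open>x\<close>-variables, whose coefficients have the
  sign \<open>e\<close>: it is multiplied by \<open>- \<Sum> y\<^sub>j\<close>, and its sign changes.
\<close>

lemma tail_hyperplane_mult: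
  assumes low: "\<And>M. M \<in> keys P \<Longrightarrow> b \<le> xdeg r M"
    and sgn: "\<And>M. xdeg r M = b \<Longrightarrow> e * lookup P M \<ge> 0"
  shows "M \<in> keys (hyperplane_form r s * P) \<Longrightarrow> b \<le> xdeg r M"
    and "xdeg r M = b \<Longrightarrow> e * lookup (hyperplane_form r s * P) M \<le> 0"
    and "\<lbrakk>xdeg r M = b; e * lookup P M > 0; r \<le> j; j < r + s\<rbrakk> \<Longrightarrow>
      e * lookup (hyperplane_form r s * P) (unit_mon j + M) < 0"
proof -
  have x: "lookup (Var i * P) M = 0" if "i < r" "xdeg r M = b" for i M
  proof (rule lookup_Var_mult_eq_0)
    fix M' assume "M' \<in> keys P"
    then show "M \<noteq> unit_mon i + M'"
      using that low[of M'] by auto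
  qed
  have y: "e * lookup (Var j * P) M \<ge> 0" if "r \<le> j" "xdeg r M = b" for j M
  proof (cases "lookup (Var j * P) M = 0")
    case False
    then obtain M' where "M = unit_mon j + M'" "lookup (Var j * P) M = lookup P M'"
      by (rule lookup_Var_mult_cases)
    with that sgn show ?thesis by simp
  qed simp
  have eq: "e * lookup (hyperplane_form r s * P) M = - (\<Sum>j=r..<r+s. e * lookup (Var j * P) M)"
    if "xdeg r M = b" for M
    using that by (simp add: lookup_hyperplane_mult x sum_distrib_left)
  show "b \<le> xdeg r M" if "M \<in> keys (hyperplane_form r s * P)"
  proof (rule ccontr)
    assume "\<not> ?thesis"
    have "lookup (Var b' * P) M = 0" for b'
    proof (rule lookup_Var_mult_eq_0)
      fix M' assume "M' \<in> keys P"
      then show "M \<noteq> unit_mon b' + M'"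
        using \<open>\<not> b \<le> xdeg r M\<close> low[of M'] by auto
    qed
    then have "lookup (hyperplane_form r s * P) M = 0"
      by (simp add: lookup_hyperplane_mult)
    with that show False
      by (simp add: in_keys_iff)
  qed
  show "xdeg r M = b \<Longrightarrow> e * lookup (hyperplane_form r s * P) M \<le> 0"
    by (auto simp: eq intro!: sum_nonneg y)
  assume M: "xdeg r M = b" "e * lookup P M > 0" "r \<le> j" "j < r + s"
  then have deg: "xdeg r (unit_mon j + M) = b"
    by simp
  have "e * lookup (Var j * P) (unit_mon j + M) \<le> (\<Sum>j'=r..<r+s. e * lookup (Var j' * P) (unit_mon j + M))"
    using M(3,4) deg by (intro member_le_sum[of j _ "\<lambda>j'. e * lookup (Var j' * P) (unit_mon j + M)"])
      (auto intro: y)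
  then show "e * lookup (hyperplane_form r s * P) (unit_mon j + M) < 0"
    using M(2) by (simp add: eq[OF deg] lookup_Var_mult)
qed

lemma many_pure_monomials:
  assumes "r \<ge> 2" "m \<ge> 2"
  obtains S where "finite S" "\<And>N. N \<in> S \<Longrightarrow> keys N \<subseteq> {..<r} \<and> mon_degree N = m"
    "card S \<ge> 2 * r - 1" "m \<ge> 3 \<Longrightarrow> card S \<ge> 2 * r"
proof -
  \<comment> \<open>The monomials \<open>x\<^sub>0\<^sup>m\<^sup>-\<^sup>1 x\<^sub>i\<close> and \<open>x\<^sub>1\<^sup>m\<^sup>-\<^sup>1 x\<^sub>i\<close>; the only possible repetition is \<open>x\<^sub>0 x\<^sub>1\<close> for \<open>m = 2\<close>.\<close>
  define N where "N a = single a (m - 1)" for a :: nat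
  have lookup_N: "lookup (N a) b = (if a = b then m - 1 else 0)" for a b
    by (simp add: N_def lookup_single when_def)
  have keys_N: "keys (N a) = {a}" and deg_N: "mon_degree (N a) = m - 1" for a
    using assms by (simp_all add: N_def mon_degree_def)
  let ?A = "\<lambda>a. (\<lambda>i. unit_mon i + N a) ` {..<r}"
  have inj: "inj_on (\<lambda>i. unit_mon i + N a) {..<r}" for a
    by (rule inj_onI) (metis add_right_cancel lookup_unit_mon zero_neq_one)
  have card_A: "card (?A a) = r" for a
    by (simp add: card_image inj)
  have inter: "x = unit_mon 0 + N 1 \<and> m = 2" if x: "x \<in> ?A 0 \<inter> ?A 1" for x
  proof -
    obtain i where "x = unit_mon i + N 0"
      using IntD1[OF x] by blast
    moreover obtain k where k: "x = unit_mon k + N 1"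
      using IntD2[OF x] by blast
    ultimately have eq: "unit_mon i + N 0 = unit_mon k + N 1"
      by simp
    from mon_eq_lookup[OF eq, of 0] assms have "k = 0 \<and> m = 2"
      by (auto simp: lookup_add lookup_N split: if_splits)
    with k show ?thesis by simp
  qed
  have "card (?A 0 \<inter> ?A 1) \<le> card {unit_mon 0 + N 1}"
    using inter by (intro card_mono) auto
  moreover have "?A 0 \<inter> ?A 1 = {}" if "m \<ge> 3"
    using inter that by fastforce
  moreover have "card (?A 0) + card (?A 1) = card (?A 0 \<union> ?A 1) + card (?A 0 \<inter> ?A 1)"
    by (rule card_Un_Int) auto
  ultimately show thesis
    using assms card_A
    by (intro that[of "?A 0 \<union> ?A 1"]) (auto simp: keys_add_nat keys_N deg_N)
qed

text \<open>
  The top part of \<open>Q\<close> yields more than \<open>r + 1\<close> positive terms, except for \<open>r = m = 2\<close>.  In this case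
  the bottom part contributes another positive term, since it is multiplied by \<open>(y\<^sub>2 + y\<^sub>3)\<^sup>2\<close>.
\<close>

lemma power_multiple_many_terms:
  assumes r: "r \<ge> 2" and m: "m \<ge> 2" and nonneg: "\<And>M. lookup Q M \<ge> 0" and nz: "Q \<noteq> 0"
  shows "card (pos_terms (hyperplane_form r r ^ m * Q)) > r + 1"
proof -
  let ?P = "hyperplane_form r r ^ m * Q"
  have ne: "xdeg r ` keys Q \<noteq> {}"
    using nz by simp
  define a where "a = Max (xdeg r ` keys Q)"
  define b where "b = Min (xdeg r ` keys Q)"
  have a: "xdeg r M \<le> a" and b: "b \<le> xdeg r M" if "M \<in> keys Q" for M
    using that by (simp_all add: a_def b_def)
  obtain M where M: "M \<in> keys Q" "xdeg r M = a"
    using Max_in[OF _ ne] unfolding a_def[symmetric] by auto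
  obtain M' where M': "M' \<in> keys Q" "xdeg r M' = b"
    using Min_in[OF _ ne] unfolding b_def[symmetric] by auto
  have pos: "lookup Q M > 0" "lookup Q M' > 0"
    using M(1) M'(1) nonneg[of M] nonneg[of M'] by (simp_all add: in_keys_iff)
  have lead: "lead_nonneg r a Q"
    using a nonneg by (simp add: lead_nonneg_def)
  obtain S where S: "finite S" "\<And>N. N \<in> S \<Longrightarrow> keys N \<subseteq> {..<r} \<and> mon_degree N = m"
    "card S \<ge> 2 * r - 1" "m \<ge> 3 \<Longrightarrow> card S \<ge> 2 * r"
    by (rule many_pure_monomials[OF r m]) blast
  let ?S = "(\<lambda>N. N + M) ` S"
  have card_S: "card ?S = card S"
    by (intro card_image inj_onI) simp
  have sub: "?S \<subseteq> pos_terms ?P"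
    using lead_nonneg_hyperplane_power[OF lead M(2) pos(1)] S(2) by (auto simp: pos_terms_def)
  show ?thesis
  proof (cases "r = 2 \<and> m = 2")
    case False
    then have "card S > r + 1"
      using S(3,4) r m by linarith
    then show ?thesis
      using card_mono[OF finite_pos_terms sub] card_S by simp
  next
    case True
    let ?x = "unit_mon 2 + (unit_mon 2 + M')"
    have t1: "b \<le> xdeg r L" if "L \<in> keys (hyperplane_form r r * Q)" for L
      using tail_hyperplane_mult(1)[of Q b r 1] b nonneg that by simp
    have t2: "lookup (hyperplane_form r r * Q) L \<le> 0" if "xdeg r L = b" for L
      using tail_hyperplane_mult(2)[of Q b r 1 L r] b nonneg that by simp
    have t3: "lookup (hyperplane_form r r * Q) (unit_mon 2 + M') < 0"
      using tail_hyperplane_mult(3)[of Q b r 1 M' 2 r] b nonneg M'(2) pos(2) True by simp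
    have "xdeg r (unit_mon 2 + M') = b"
      using M'(2) True by simp
    then have "lookup (hyperplane_form r r * (hyperplane_form r r * Q)) ?x > 0"
      using tail_hyperplane_mult(3)[of "hyperplane_form r r * Q" b r "-1" "unit_mon 2 + M'" 2 r]
        t1 t2 t3 True by simp
    then have x: "?x \<in> pos_terms ?P"
      using True by (simp add: pos_terms_def power2_eq_square mult.assoc)
    have "?x \<notin> ?S"
    proof
      assume "?x \<in> ?S"
      then obtain N where N: "N \<in> S" "?x = N + M" by blast
      then have "xdeg r N = 2"
        using S(2)[OF N(1)] mon_degree_superset[of "{..<r}" N] True by (simp add: xdeg_def)
      with arg_cong[OF N(2), of "xdeg r"] show False
        using M M' True a[OF M'(1)] by simp
    qed
    then have "card (insert ?x ?S) > r + 1"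
      using S(1,3) True card_S by simp
    then show ?thesis
      using card_mono[OF finite_pos_terms, of "insert ?x ?S" ?P] x sub by simp
  qed
qed

text \<open>
  If all the \<open>x\<close>-coefficients of a linear form \<open>Q\<close> are positive, then all pure \<open>x\<close>-monomials of the
  product are positive.  For \<open>m = 1\<close> a negative coefficient of \<open>y\<^sub>j\<close> makes \<open>y\<^sub>j\<^sup>2\<close> a further positive term.
\<close>

lemma linear_multiple_many_terms:
  assumes r: "r \<ge> 2" and m: "m \<ge> 1"
    and Q: "\<And>M. M \<in> keys Q \<Longrightarrow> mon_degree M = 1 \<and> keys M \<subseteq> {..<2*r}"
    and x: "\<And>i. i < r \<Longrightarrow> lookup Q (unit_mon i) > 0"
    and j: "r \<le> j" "j < 2 * r" "lookup Q (unit_mon j) < 0"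
  shows "card (pos_terms (hyperplane_form r r ^ m * Q)) > r + 1"
proof -
  let ?P = "hyperplane_form r r ^ m * Q"
  have xdeg_le: "xdeg r M \<le> mon_degree M" if "keys M \<subseteq> {..<2*r}" for M
  proof -
    have "mon_degree M = (\<Sum>i<2*r. lookup M i)"
      using that by (intro mon_degree_superset) auto
    moreover have "xdeg r M \<le> (\<Sum>i<2*r. lookup M i)"
      unfolding xdeg_def by (intro sum_mono2) auto
    ultimately show ?thesis by simp
  qed
  have lin: "\<exists>i<2*r. M = unit_mon i" if "M \<in> keys Q" for M
  proof -
    have "mon_degree M = Suc 0" "keys M \<subseteq> {..<2*r}"
      using Q[OF that] by auto
    then obtain i M' where "i \<in> {..<2*r}" "M = unit_mon i + M'" "mon_degree M' = 0"
      by (rule mon_degree_Suc_split) blast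
    then show ?thesis
      by (auto simp: mon_degree_0_iff)
  qed
  have lead: "lead_nonneg r 1 Q"
    unfolding lead_nonneg_def
  proof (intro conjI ballI allI impI)
    fix M assume "M \<in> keys Q"
    then show "xdeg r M \<le> 1"
      using xdeg_le Q by fastforce
  next
    fix M assume M: "xdeg r M = 1"
    show "lookup Q M \<ge> 0"
    proof (cases "M \<in> keys Q")
      case True
      then obtain i where "M = unit_mon i"
        using lin by blast
      with M x[of i] show ?thesis
        by (simp split: if_splits)
    qed (simp add: in_keys_iff)
  qed
  have m2: "Suc m \<ge> 2"
    using m by simp
  obtain S where S: "finite S" "\<And>N. N \<in> S \<Longrightarrow> keys N \<subseteq> {..<r} \<and> mon_degree N = Suc m"
    "card S \<ge> 2 * r - 1" "Suc m \<ge> 3 \<Longrightarrow> card S \<ge> 2 * r"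
    by (rule many_pure_monomials[OF r m2]) blast
  have sub: "S \<subseteq> pos_terms ?P"
  proof
    fix N assume N: "N \<in> S"
    have N': "mon_degree N = Suc m" "keys N \<subseteq> {..<r}"
      using S(2)[OF N] by auto
    then obtain i N' where i: "i \<in> {..<r}" "N = unit_mon i + N'" "mon_degree N' = m" "keys N' \<subseteq> {..<r}"
      by (rule mon_degree_Suc_split)
    then have "lookup ?P (N' + unit_mon i) > 0"
      using lead_nonneg_hyperplane_power[OF lead, of "unit_mon i" N' m r] x[of i] by simp
    then show "N \<in> pos_terms ?P"
      by (simp add: pos_terms_def i(2) add.commute)
  qed
  show ?thesis
  proof (cases "m = 1")
    case False
    then have "card S > r + 1"
      using S(4) m r by simp
    then show ?thesis
      using card_mono[OF finite_pos_terms sub] by simp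
  next
    case True
    let ?x = "unit_mon j + unit_mon j"
    have zero: "lookup (Var a * Q) ?x = 0" if "a \<noteq> j" for a
    proof (rule lookup_Var_mult_eq_0)
      fix M' assume "M' \<in> keys Q"
      show "?x \<noteq> unit_mon a + M'"
      proof
        assume eq: "?x = unit_mon a + M'"
        from mon_eq_lookup[OF eq, of a] that show False
          by (simp add: lookup_add)
      qed
    qed
    have "lookup (hyperplane_form r r * Q) ?x =
        (\<Sum>i<r. if i = j then lookup Q (unit_mon j) else 0) - (\<Sum>i=r..<r+r. if i = j then lookup Q (unit_mon j) else 0)"
      unfolding lookup_hyperplane_mult
      by (intro arg_cong2[where f = minus] sum.cong) (auto simp: zero lookup_Var_mult)
    also have "\<dots> = - lookup Q (unit_mon j)"
      using j by simp
    finally have x_pos: "?x \<in> pos_terms ?P"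
      using j True by (simp add: pos_terms_def)
    have "?x \<notin> S"
    proof
      assume "?x \<in> S"
      then have "keys ?x \<subseteq> {..<r}"
        using S(2) by blast
      then show False
        using j(1) by (simp add: keys_add_nat)
    qed
    then have "card (insert ?x S) > r + 1"
      using S(1,3) r by simp
    then show ?thesis
      using card_mono[OF finite_pos_terms, of "insert ?x S" ?P] x_pos sub by simp
  qed
qed

section \<open>Proper monomial maps\<close>

lemma eval_hyperplane_form:
  "eval_mpoly (hyperplane_form r s) x = (\<Sum>j<r. x j) - (\<Sum>j=r..<r+s. x j)"
  by (simp add: hyperplane_form_def)

lemma keys_hyperplane_mult:
  assumes "M \<in> keys (hyperplane_form r s * Q)"
  obtains a M' where "a < r + s" "M' \<in> keys Q" "M = unit_mon a + M'"
proof -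
  have "\<exists>a<r+s. lookup (Var a * Q) M \<noteq> 0"
  proof (rule ccontr)
    assume "\<not> ?thesis"
    then have "lookup (hyperplane_form r s * Q) M = 0"
      by (simp add: lookup_hyperplane_mult)
    with assms show False by (simp add: in_keys_iff)
  qed
  then obtain a where a: "a < r + s" "lookup (Var a * Q) M \<noteq> 0"
    by blast
  from a(2) obtain M' where "M' \<in> keys Q" "M = unit_mon a + M'"
    by (rule lookup_Var_mult_cases)
  with a(1) show thesis by (rule that)
qed

lemma homog_hyperplane_power_mult:
  assumes "homog_poly (r + s) e Q"
  shows "homog_poly (r + s) (m + e) (hyperplane_form r s ^ m * Q)"
proof (induction m)
  case 0
  then show ?case using assms by simp
next
  case (Suc m)
  show ?case
    unfolding homog_poly_def
  proof
    fix M assume "M \<in> keys (hyperplane_form r s ^ Suc m * Q)"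
    then have "M \<in> keys (hyperplane_form r s * (hyperplane_form r s ^ m * Q))"
      by (simp add: mult.assoc)
    then obtain a M' where "a < r + s" "M' \<in> keys (hyperplane_form r s ^ m * Q)" "M = unit_mon a + M'"
      by (rule keys_hyperplane_mult)
    with Suc.IH show "keys M \<subseteq> {..<r + s} \<and> mon_degree M = Suc m + e"
      by (simp add: homog_poly_def keys_add_nat)
  qed
qed

lemma lookup_Const_mult: "lookup (Const c * p) M = c * lookup p M"
proof -
  have "Const c * p = (\<Sum>e\<in>keys p. single e (c * lookup p e))"
    by (subst (1) mpoly_as_sum[of p, symmetric]) (simp add: Const_def sum_distrib_left mult_single)
  then show ?thesis
    by (auto simp: lookup_sum lookup_single when_def in_keys_iff sum.delta)
qed

lemma homog_1_keys:
  assumes "homog_poly n 1 Q" "M \<in> keys Q"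
  obtains a where "a < n" "M = unit_mon a"
proof -
  have "mon_degree M = Suc 0" "keys M \<subseteq> {..<n}"
    using assms by (auto simp: homog_poly_def)
  then obtain a M' where "a \<in> {..<n}" "M = unit_mon a + M'" "mon_degree M' = 0"
    by (rule mon_degree_Suc_split) blast
  then show thesis
    by (intro that[of a]) (auto simp: mon_degree_0_iff)
qed

lemma mon_eval_unit_mon [simp]: "mon_eval (unit_mon a) x = x a"
  by simp

lemma eval_homog_1:
  assumes "homog_poly n 1 Q"
  shows "eval_mpoly Q x = (\<Sum>a<n. lookup Q (unit_mon a) * x a)"
proof -
  have inj: "inj_on unit_mon {..<n}"
    by (rule inj_onI) (metis lookup_unit_mon zero_neq_one)
  have "keys Q \<subseteq> unit_mon ` {..<n}"
  proof
    fix M assume "M \<in> keys Q"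
    with assms obtain a where "a < n" "M = unit_mon a"
      by (rule homog_1_keys)
    then show "M \<in> unit_mon ` {..<n}" by simp
  qed
  then have "eval_mpoly Q x = (\<Sum>M\<in>unit_mon ` {..<n}. lookup Q M * mon_eval M x)"
    by (intro eval_mpoly_superset) auto
  also have "\<dots> = (\<Sum>a<n. lookup Q (unit_mon a) * x a)"
    by (simp add: sum.reindex[OF inj])
  finally show ?thesis .
qed

text \<open>
  A proper monomial rational map between \<open>D\<^sub>r\<^sub>,\<^sub>r\<close> and \<open>D\<^sub>r\<^sub>+\<^sub>1\<^sub>,\<^sub>r\<^sub>+\<^sub>1\<close> of degree \<open>d\<close> without common factor,
  given by the exponents and the coefficients of its components.  The exponent of a component with
  coefficient 0 is arbitrary.
\<close>

locale proper_monomial =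
  fixes r d :: nat and E :: "nat \<Rightarrow> nat \<Rightarrow>\<^sub>0 nat" and C :: "nat \<Rightarrow> complex"
  assumes r: "r \<ge> 2"
    and E: "\<And>k. k < 2 * r + 2 \<Longrightarrow> C k \<noteq> 0 \<Longrightarrow> keys (E k) \<subseteq> {..<2 * r} \<and> mon_degree (E k) = d"
    and C: "\<exists>k<2 * r + 2. C k \<noteq> 0"
    and no_factor: "no_common_factor (mono_tuple (2 * r + 2) E C)"
    and proper: "proper_gball_map r r (r + 1) (r + 1) (rat_map (2 * r) (mono_tuple (2 * r + 2) E C))"
begin

abbreviation gs where "gs \<equiv> mono_tuple (2 * r + 2) E C"
text \<open>
  The polynomial of the map in the real variables \<open>\<bar>z\<^sub>i\<bar>\<^sup>2\<close>.
\<close>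

definition P where "P = slot_poly (r + 1) (r + 1) E C"
abbreviation form where "form \<equiv> hyperplane_form r r"

lemma dims: "r + r = 2 * r" "r + 1 + (r + 1) = 2 * r + 2"
  by simp_all

lemma homog: "homog_tuple (2 * r) (2 * r + 2) d gs"
  using E C by (rule homog_mono_tuple)

text \<open>
  The vectors \<open>(\<bar>z\<^sub>i\<bar>\<^sup>2)\<^sub>i\<close> with \<open>z\<close> in \<open>cspace (2 * r)\<close>, and the preimage with real coordinates \<open>z\<^sub>i \<ge> 0\<close>.
\<close>

definition valid :: "(nat \<Rightarrow> real) \<Rightarrow> bool" where
  "valid x \<longleftrightarrow> (\<forall>i. x i \<ge> 0) \<and> (\<forall>i\<ge>2 * r. x i = 0)"

definition root_pt :: "(nat \<Rightarrow> real) \<Rightarrow> nat \<Rightarrow> complex" where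
  "root_pt x = (\<lambda>i. complex_of_real (sqrt (x i)))"

lemma cmod_root_pt: "valid x \<Longrightarrow> (cmod (root_pt x i))\<^sup>2 = x i"
  by (simp add: root_pt_def valid_def)

lemma root_pt_cspace: "valid x \<Longrightarrow> root_pt x \<in> cspace (2 * r)"
  by (simp add: root_pt_def valid_def cspace_def)

lemma hnorm_root_pt: "valid x \<Longrightarrow> hnorm r r (root_pt x) = eval_mpoly form x"
  by (simp add: hnorm_def cmod_root_pt eval_hyperplane_form)

lemma eval_P: "valid x \<Longrightarrow> eval_mpoly P x = hnorm (r + 1) (r + 1) (eval_tuple gs (root_pt x))"
  using eval_slot_poly[of "r + 1" "r + 1" E C "root_pt x"]
  by (simp only: dims cmod_root_pt P_def)

lemma P_on_hyperplane:
  assumes x: "valid x" "eval_mpoly form x = 0" "x i \<noteq> 0"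
  shows "eval_mpoly P x = 0"
proof -
  have "root_pt x \<in> punctured (2 * r)"
    using x root_pt_cspace[OF x(1)] by (auto simp: punctured_def root_pt_def intro: exI[of _ i])
  moreover have "hnorm r r (root_pt x) = 0"
    using x by (simp add: hnorm_root_pt)
  ultimately show ?thesis
    unfolding eval_P[OF x(1)]
    by (rule proper_hnorm_zero[of r r "r + 1" "r + 1" d gs "root_pt x", unfolded dims, OF homog proper])
qed

lemma P_on_ball:
  assumes x: "valid x" "eval_mpoly form x > 0"
  shows "eval_mpoly P x \<ge> 0"
    and "k < 2 * r + 2 \<Longrightarrow> C k * mon_eval (E k) (root_pt x) \<noteq> 0 \<Longrightarrow> eval_mpoly P x > 0"
proof -
  have G: "eval_tuple gs (root_pt x) \<in> cspace (2 * r + 2)"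
    using eval_tuple_cspace[of gs] by simp
  have pos: "eval_mpoly P x > 0" if "eval_tuple gs (root_pt x) \<in> punctured (2 * r + 2)"
    unfolding eval_P[OF x(1)]
  proof (rule gball_map_hnorm_pos[of r r "r + 1" "r + 1" d gs "root_pt x", unfolded dims, OF homog _ _ _ that])
    show "rational_gball_map r r (r + 1) (r + 1) (rat_map (2 * r) gs)"
      using proper by (simp only: proper_gball_map_def)
    show "root_pt x \<in> cspace (2 * r)" "hnorm r r (root_pt x) > 0"
      using x by (simp_all add: root_pt_cspace hnorm_root_pt)
  qed
  show "eval_mpoly P x \<ge> 0"
  proof (cases "eval_tuple gs (root_pt x) \<in> punctured (2 * r + 2)")
    case True
    then show ?thesis using pos by simp
  next
    case False
    then show ?thesis
      unfolding eval_P[OF x(1)]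
      using hnorm_zero_not_punctured[of "eval_tuple gs (root_pt x)" "r + 1" "r + 1", unfolded dims, OF G]
      by simp
  qed
  assume k: "k < 2 * r + 2" "C k * mon_eval (E k) (root_pt x) \<noteq> 0"
  then have "eval_tuple gs (root_pt x) k \<noteq> 0"
    by (simp add: eval_mono_tuple)
  then show "eval_mpoly P x > 0"
    using G by (intro pos) (auto simp: punctured_def)
qed

lemma homog_P: "homog_poly (2 * r) d P"
  unfolding homog_poly_def
proof
  fix M assume M: "M \<in> keys P"
  have "\<exists>k<2 * r + 2. C k \<noteq> 0 \<and> E k = M"
  proof (rule ccontr)
    assume no: "\<not> ?thesis"
    have z: "(if E k = M then (cmod (C k))\<^sup>2 else 0) = 0" if "k < 2 * r + 2" for k
      using no that by auto
    have "(\<Sum>k<r+1. if E k = M then (cmod (C k))\<^sup>2 else 0) = 0"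
      by (intro sum.neutral ballI z) simp
    moreover have "(\<Sum>k=r+1..<r+1+(r+1). if E k = M then (cmod (C k))\<^sup>2 else 0) = 0"
      by (intro sum.neutral ballI z) simp
    ultimately have "lookup P M = 0"
      unfolding P_def lookup_slot_poly by (simp only: diff_0_right)
    with M show False
      by (simp only: in_keys_iff)
  qed
  then show "keys M \<subseteq> {..<2 * r} \<and> mon_degree M = d"
    using E by blast
qed

lemma component_without_variable:
  assumes "a < 2 * r"
  shows "\<exists>k<2 * r + 2. C k \<noteq> 0 \<and> lookup (E k) a = 0"
proof (rule ccontr)
  assume no: "\<not> ?thesis"
  have "Var a dvd p" if p: "p \<in> set gs" for p
  proof -
    from p obtain k where k: "k < 2 * r + 2" "p = single (E k) (C k)"
      unfolding in_set_mono_tuple by blast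
    show ?thesis
    proof (cases "C k = 0")
      case False
      then have "lookup (E k) a > 0"
        using no k(1) by auto
      then obtain M where "E k = unit_mon a + M"
        by (rule mon_pos_split)
      then have "p = Var a * single M (C k)"
        by (simp add: k(2) Var_eq_single mult_single)
      then show ?thesis by simp
    qed (simp add: k(2))
  qed
  then have "(Var a :: complex mpoly) dvd 1"
    using no_factor by (auto simp: no_common_factor_def)
  then obtain q :: "complex mpoly" where "1 = Var a * q" ..
  moreover have "lookup (Var a * q) 0 = 0"
  proof (rule lookup_Var_mult_eq_0)
    fix M' assume "M' \<in> keys q"
    show "0 \<noteq> unit_mon a + M'"
      by (metis add_is_0 lookup_add lookup_unit_mon lookup_zero zero_neq_one)
  qed
  ultimately show False
    by (metis lookup_one_zero zero_neq_one)
qed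

text \<open>
  No variable divides \<open>P\<close>.  Some component of the map does not contain the given variable, so there is a
  point of the ball where the variable vanishes and the map is defined.  There \<open>P\<close> is positive.
\<close>

lemma P_no_variable:
  assumes a: "a < 2 * r"
  shows "\<exists>M\<in>keys P. lookup M a = 0"
proof -
  obtain k where k: "k < 2 * r + 2" "C k \<noteq> 0" "lookup (E k) a = 0"
    using component_without_variable[OF a] by blast
  \<comment> \<open>One \<open>x\<close>-coordinate other than the given one is made so large that it outweighs the \<open>y\<close>-coordinates.\<close>
  define b :: nat where "b = (if a = 0 then 1 else 0)"
  have b: "b < r" "b \<noteq> a"
    using r by (auto simp: b_def)
  define x :: "nat \<Rightarrow> real" where
    "x i = (if i = a \<or> i \<ge> 2 * r then 0 else if i = b then 2 * real r else 1)" for i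
  have valid: "valid x"
    by (simp add: valid_def x_def)
  have "(\<Sum>j=r..<r+r. x j) \<le> (\<Sum>j=r..<r+r. 1)"
    using b by (intro sum_mono) (auto simp: x_def)
  moreover have "x b \<le> (\<Sum>j<r. x j)"
    using b valid by (intro member_le_sum) (auto simp: valid_def)
  moreover have "x b = 2 * real r"
    using b by (simp add: x_def)
  ultimately have "eval_mpoly form x > 0"
    using r by (simp add: eval_hyperplane_form)
  moreover have "mon_eval (E k) (root_pt x) \<noteq> 0"
  proof -
    have "root_pt x i \<noteq> 0" if "i \<in> keys (E k)" for i
    proof -
      have "i \<in> {..<2 * r}" "i \<noteq> a"
        using that k E[OF k(1,2)] by (blast, auto simp: in_keys_iff)
      then show ?thesis
        using r by (auto simp: root_pt_def x_def)
    qed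
    then show ?thesis by simp
  qed
  ultimately have pos: "eval_mpoly P x > 0"
    using P_on_ball(2)[OF valid _ k(1)] k(2) by simp
  show ?thesis
  proof (rule ccontr)
    assume no: "\<not> ?thesis"
    have zero: "mon_eval M x = 0" if "M \<in> keys P" for M
    proof -
      have "a \<in> keys M" "lookup M a \<noteq> 0"
        using no that by (auto simp: in_keys_iff)
      moreover have "x a ^ lookup M a = 0"
        using \<open>lookup M a \<noteq> 0\<close> by (simp add: x_def)
      ultimately show ?thesis
        by (intro prod_zero) auto
    qed
    have "eval_mpoly P x = 0"
      unfolding eval_mpoly_def by (intro sum.neutral ballI) (simp only: zero mult_zero_right)
    with pos show False by simp
  qed
qed

lemma P_nonzero: "P \<noteq> 0"
  using P_no_variable[of 0] r by auto

lemma d_nonzero: "d \<noteq> 0"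
proof
  assume "d = 0"
  then have "M = 0" if "M \<in> keys P" for M
    using homog_P that by (auto simp: homog_poly_def mon_degree_0_iff)
  moreover have "keys P \<noteq> {}"
    using P_nonzero by simp
  ultimately have keys: "keys P = {0}"
    by blast
  define x :: "nat \<Rightarrow> real" where "x i = (if i = 0 \<or> i = r then 1 else 0)" for i
  have "valid x"
    using r by (auto simp: valid_def x_def)
  moreover have "(\<Sum>j<r. x j) = (\<Sum>j<r. if j = 0 then 1 else 0)"
    by (rule sum.cong) (auto simp: x_def)
  moreover have "(\<Sum>j=r..<r+r. x j) = (\<Sum>j=r..<r+r. if j = r then 1 else 0)"
    by (rule sum.cong) (use r in \<open>auto simp: x_def\<close>)
  ultimately have "valid x" "eval_mpoly form x = 0"
    using r by (simp_all add: eval_hyperplane_form)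
  then have "eval_mpoly P x = 0"
    by (rule P_on_hyperplane[of x 0]) (simp add: x_def)
  then have "lookup P 0 = 0"
    by (simp add: eval_mpoly_def keys)
  then show False
    using keys by (auto simp: in_keys_iff)
qed

lemma two_point_form:
  assumes "i < r" "r \<le> j" "j < 2 * r"
  shows "eval_mpoly form (\<lambda>k. if k = i then \<alpha> else if k = j then \<beta> else 0) = \<alpha> - \<beta>"
proof -
  let ?x = "\<lambda>k. if k = i then \<alpha> else if k = j then \<beta> else 0 :: real"
  have "(\<Sum>k<r. ?x k) = (\<Sum>k<r. if k = i then \<alpha> else 0)"
    by (rule sum.cong) (use assms in auto)
  moreover have "(\<Sum>k=r..<r+r. ?x k) = (\<Sum>k=r..<r+r. if k = j then \<beta> else 0)"
    by (rule sum.cong) (use assms in auto)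
  ultimately show ?thesis
    using assms by (simp add: eval_hyperplane_form)
qed

lemma two_point_linear:
  assumes "homog_poly (2 * r) 1 Q" "i < r" "r \<le> j" "j < 2 * r"
  shows "eval_mpoly Q (\<lambda>k. if k = i then \<alpha> else if k = j then \<beta> else 0) =
    lookup Q (unit_mon i) * \<alpha> + lookup Q (unit_mon j) * \<beta>"
proof -
  have "(\<Sum>a<2 * r. lookup Q (unit_mon a) * (if a = i then \<alpha> else if a = j then \<beta> else 0)) =
      (\<Sum>a<2 * r. (if a = i then lookup Q (unit_mon i) * \<alpha> else 0) + (if a = j then lookup Q (unit_mon j) * \<beta> else 0))"
    using assms by (intro sum.cong) auto
  also have "\<dots> = lookup Q (unit_mon i) * \<alpha> + lookup Q (unit_mon j) * \<beta>"
    using assms by (simp add: sum.distrib)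
  finally show ?thesis
    by (simp add: eval_homog_1[OF assms(1)])
qed

text \<open>
  \<open>P\<close> is nonnegative at the points \<open>x\<^sub>i = 1\<close>, \<open>y\<^sub>j = t < 1\<close>, with all other coordinates 0.
\<close>

lemma linear_factor_sign:
  assumes fac: "P = form ^ m * Q" and Q: "homog_poly (2 * r) 1 Q" and neg: "lookup Q M < 0"
  obtains j where "r \<le> j" "j < 2 * r" "lookup Q (unit_mon j) < 0" "\<And>i. i < r \<Longrightarrow> lookup Q (unit_mon i) > 0"
proof -
  have test: "lookup Q (unit_mon i) + lookup Q (unit_mon j) * t \<ge> 0"
    if ij: "i < r" "r \<le> j" "j < 2 * r" and t: "0 \<le> t" "t < 1" for i j t
  proof -
    let ?x = "\<lambda>k. if k = i then 1 else if k = j then t else 0"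
    have "valid ?x"
      using ij t by (auto simp: valid_def)
    then have "eval_mpoly P ?x \<ge> 0"
      using t by (intro P_on_ball) (auto simp: two_point_form[OF ij])
    moreover have "(1 - t) ^ m > 0"
      using t by simp
    ultimately have "(1 - t) ^ m * (lookup Q (unit_mon i) + lookup Q (unit_mon j) * t) \<ge> 0"
      unfolding fac by (simp add: two_point_form[OF ij] two_point_linear[OF Q ij])
    then show ?thesis
      using \<open>(1 - t) ^ m > 0\<close> by (simp add: zero_le_mult_iff)
  qed
  have "M \<in> keys Q"
    using neg by (simp add: in_keys_iff)
  with Q obtain a where a: "a < 2 * r" "M = unit_mon a"
    by (rule homog_1_keys)
  have "r \<le> a"
  proof (rule ccontr)
    assume "\<not> r \<le> a"
    then show False
      using test[of a r 0] neg a r by simp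
  qed
  moreover have "lookup Q (unit_mon i) > 0" if "i < r" for i
    using test[OF that \<open>r \<le> a\<close> a(1), of "1 / 2"] neg a(2) by simp
  ultimately show thesis
    using a neg by (intro that[of a]) auto
qed

text \<open>
  The heart of the classification: if \<open>P\<close> has degree at least 2 and factors in the prescribed way, then
  the factor \<open>Q\<close> is a positive multiple of one of two linear forms, up to the numbering of the variables.
\<close>

theorem factor_classification:
  assumes fac: "P = form ^ m * Q" and "m \<ge> 1" and Q: "homog_poly (2 * r) e Q"
    and "e = 1 \<or> (\<forall>M. lookup Q M \<ge> 0)" and "m + e \<ge> 2"
  shows "m = 1 \<and> r = 2 \<and> ((\<exists>i j c. i < 2 \<and> 2 \<le> j \<and> j < 4 \<and> c > 0 \<and>
      (\<forall>M. lookup Q M = (if M = unit_mon i \<or> M = unit_mon j then c else 0))) \<or>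
    (\<exists>c>0. \<forall>M. lookup Q M = (if \<exists>a<4. M = unit_mon a then c else 0)))"
proof -
  have card_pos: "card (pos_terms (form ^ m * Q)) \<le> r + 1"
    and card_neg: "card (neg_terms (form ^ m * Q)) \<le> r + 1"
    using card_pos_terms_slot_poly[of "r + 1" "r + 1" E C] card_neg_terms_slot_poly[of "r + 1" "r + 1" E C]
    by (simp_all only: fac[symmetric] P_def)
  have "Q \<noteq> 0"
    using P_nonzero fac by auto
  have nonneg: "lookup Q M \<ge> 0" for M
  proof (rule ccontr)
    assume "\<not> lookup Q M \<ge> 0"
    then have neg: "lookup Q M < 0" and "e = 1"
      using assms(4) by auto
    then have Q1: "homog_poly (2 * r) 1 Q"
      using Q by simp
    from fac Q1 neg obtain j where j: "r \<le> j" "j < 2 * r" "lookup Q (unit_mon j) < 0"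
      "\<And>i. i < r \<Longrightarrow> lookup Q (unit_mon i) > 0"
      by (rule linear_factor_sign) blast
    have "card (pos_terms (form ^ m * Q)) > r + 1"
      using Q1 by (intro linear_multiple_many_terms[OF r \<open>m \<ge> 1\<close> _ j(4) j(1-3)]) (auto simp: homog_poly_def)
    with card_pos show False by simp
  qed
  have "m = 1"
  proof (rule ccontr)
    assume "m \<noteq> 1"
    then have "card (pos_terms (form ^ m * Q)) > r + 1"
      using \<open>m \<ge> 1\<close> \<open>Q \<noteq> 0\<close> nonneg by (intro power_multiple_many_terms[OF r]) auto
    with card_pos show False by simp
  qed
  interpret few_term_multiple r Q
  proof
    show "r \<ge> 2" by (rule r)
    show "lookup Q M \<ge> 0" for M by (rule nonneg)
    show "card (pos_terms (form * Q)) \<le> r + 1" "card (neg_terms (form * Q)) \<le> r + 1"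
      using card_pos card_neg \<open>m = 1\<close> by simp_all
    show "keys M \<subseteq> {..<2 * r}" if "M \<in> keys Q" for M
      using Q that by (simp add: homog_poly_def)
    show "\<exists>M\<in>keys Q. lookup M a = 0" if a: "a < 2 * r" for a
    proof -
      obtain M where M: "M \<in> keys (form * Q)" "lookup M a = 0"
        using P_no_variable[OF a] fac \<open>m = 1\<close> by auto
      from M(1) obtain b M' where "b < r + r" "M' \<in> keys Q" "M = unit_mon b + M'"
        by (rule keys_hyperplane_mult)
      with M(2) show ?thesis
        by (intro bexI[of _ M']) (simp_all add: lookup_add)
    qed
    show "keys Q \<noteq> {}" using \<open>Q \<noteq> 0\<close> by simp
    show "keys Q \<noteq> {0}"
    proof
      assume "keys Q = {0}"
      then have "e = 0"
        using Q by (auto simp: homog_poly_def mon_degree_def)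
      with \<open>m = 1\<close> \<open>m + e \<ge> 2\<close> show False by simp
    qed
  qed
  show ?thesis
    using classification \<open>m = 1\<close> by blast
qed

lemma factor_degree:
  assumes fac: "P = form ^ m * Q" and Q: "homog_poly (2 * r) e Q"
  shows "d = m + e"
proof -
  obtain M where M: "M \<in> keys P"
    using P_nonzero by fastforce
  have "homog_poly (r + r) (m + e) (form ^ m * Q)"
    using Q by (intro homog_hyperplane_power_mult) (simp add: dims)
  with M have "mon_degree M = m + e"
    by (simp add: homog_poly_def fac)
  with M homog_P show ?thesis
    by (simp add: homog_poly_def)
qed

theorem no_factorization_of_high_degree:
  assumes "d \<ge> 3"
  shows "\<not> (\<exists>P' m Q. is_assoc_poly r r (r + 1) (r + 1) gs P' \<and> is_Q_decomp r r P' m Q \<and>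
            (total_degree Q = 1 \<or> nonneg_coeffs Q))"
proof
  assume "\<exists>P' m Q. is_assoc_poly r r (r + 1) (r + 1) gs P' \<and> is_Q_decomp r r P' m Q \<and>
            (total_degree Q = 1 \<or> nonneg_coeffs Q)"
  then obtain P' m Q where P': "is_assoc_poly r r (r + 1) (r + 1) gs P'" and Q: "is_Q_decomp r r P' m Q"
    and or: "total_degree Q = 1 \<or> nonneg_coeffs Q"
    by blast
  have "P' = P"
  proof (rule mpoly_eqI_nonneg_orthant)
    show "keys e \<subseteq> {..<2 * r}" if "e \<in> keys P'" for e
      using P' that by (auto simp: is_assoc_poly_def homog_poly_def dims)
    show "keys e \<subseteq> {..<2 * r}" if "e \<in> keys P" for e
      using homog_P that by (simp add: homog_poly_def)
    fix x :: "nat \<Rightarrow> real" assume "\<And>i. 0 \<le> x i" "\<And>i. 2 * r \<le> i \<Longrightarrow> x i = 0"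
    then have x: "valid x" by (simp add: valid_def)
    have "eval_mpoly P' (\<lambda>i. (cmod (root_pt x i))\<^sup>2) =
        (\<Sum>k<r+1. (cmod (eval_mpoly (gs ! k) (root_pt x)))\<^sup>2) -
        (\<Sum>k=r+1..<r+1+(r+1). (cmod (eval_mpoly (gs ! k) (root_pt x)))\<^sup>2)"
      using P' root_pt_cspace[OF x] by (simp add: is_assoc_poly_def dims)
    also have "\<dots> = hnorm (r + 1) (r + 1) (eval_tuple gs (root_pt x))"
      unfolding hnorm_def by (intro arg_cong2[where f = minus] sum.cong) (auto simp: eval_tuple_def)
    also have "\<dots> = eval_mpoly P x"
      by (simp only: eval_P[OF x])
    finally show "eval_mpoly P' x = eval_mpoly P x"
      by (simp only: cmod_root_pt[OF x])
  qed
  with Q obtain e where fac: "P = form ^ m * Q" and m: "m \<ge> 1" and e: "homog_poly (2 * r) e Q"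
    by (auto simp: is_Q_decomp_def dims)
  have de: "d = m + e"
    using fac e by (rule factor_degree)
  have "e = 1 \<or> (\<forall>M. lookup Q M \<ge> 0)"
    using or
  proof
    assume "total_degree Q = 1"
    then have "Max (insert 0 (mon_degree ` keys Q)) = 1"
      by (simp add: total_degree_def)
    then have "1 \<in> insert 0 (mon_degree ` keys Q)"
      by (metis Max_in finite_imageI finite_insert finite_keys insert_not_empty)
    then have "e = 1"
      using e by (auto simp: homog_poly_def)
    then show ?thesis ..
  qed (simp add: nonneg_coeffs_def)
  moreover have "m + e \<ge> 2"
    using de assms by simp
  ultimately have "m = 1" and shape: "(\<exists>i j c. i < 2 \<and> 2 \<le> j \<and> j < 4 \<and> c > 0 \<and>
      (\<forall>M. lookup Q M = (if M = unit_mon i \<or> M = unit_mon j then c else 0))) \<or>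
    (\<exists>c>0. \<forall>M. lookup Q M = (if \<exists>a<4. M = unit_mon a then c else 0))"
    using factor_classification[OF fac m e] by blast+
  from shape have "\<exists>a. unit_mon a \<in> keys Q"
  proof (elim disjE exE conjE)
    fix i j :: nat and c :: real
    assume "c > 0" "\<forall>M. lookup Q M = (if M = unit_mon i \<or> M = unit_mon j then c else 0)"
    then show ?thesis by (intro exI[of _ i]) (simp add: in_keys_iff)
  next
    fix c :: real
    assume "c > 0" "\<forall>M. lookup Q M = (if \<exists>a<4. M = unit_mon a then c else 0)"
    then have "lookup Q (unit_mon 0) = c"
      by (auto intro: exI[of _ 0])
    with \<open>c > 0\<close> show ?thesis by (intro exI[of _ 0]) (simp add: in_keys_iff)
  qed
  then obtain a where "unit_mon a \<in> keys Q" by blast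
  then have "mon_degree (unit_mon a) = e"
    using e unfolding homog_poly_def by blast
  then have "e = 1" by simp
  with de \<open>m = 1\<close> assms show False by simp
qed

end

section \<open>Normal forms in degrees one and two\<close>

lemma unit_mon_eq_iff: "unit_mon a = unit_mon b \<longleftrightarrow> a = b"
  by (metis lookup_unit_mon zero_neq_one)

lemma unit_pair_eq_iff:
  "unit_mon a + unit_mon b = unit_mon c + unit_mon d \<longleftrightarrow> (a = c \<and> b = d) \<or> (a = d \<and> b = c)"
proof
  assume eq: "unit_mon a + unit_mon b = unit_mon c + unit_mon d"
  show "(a = c \<and> b = d) \<or> (a = d \<and> b = c)"
  proof -
    consider "a = c" | "a = d" | "a \<noteq> c" "a \<noteq> d" by blast
    then show ?thesis
    proof cases
      case 1
      then show ?thesis using eq by (simp add: unit_mon_eq_iff)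
    next
      case 2
      then have "unit_mon a + unit_mon b = unit_mon a + unit_mon c"
        using eq by (simp add: add.commute)
      then show ?thesis using 2 by (simp add: unit_mon_eq_iff)
    next
      case 3
      then show ?thesis
        using mon_eq_lookup[OF eq, of a] by (simp add: lookup_add)
    qed
  qed
qed (auto simp: add.commute)

lemma mon_degree_2_cases:
  assumes "mon_degree M = 2" "keys M \<subseteq> I"
  obtains a b where "a \<in> I" "b \<in> I" "M = unit_mon a + unit_mon b"
proof -
  from assms(1) have "mon_degree M = Suc 1" by simp
  from this assms(2) obtain a M' where a: "a \<in> I" "M = unit_mon a + M'" "mon_degree M' = 1" "keys M' \<subseteq> I"
    by (rule mon_degree_Suc_split)
  from a(3) have "mon_degree M' = Suc 0" by simp
  from this a(4) obtain b M'' where "b \<in> I" "M' = unit_mon b + M''" "mon_degree M'' = 0" "keys M'' \<subseteq> I"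
    by (rule mon_degree_Suc_split)
  then show thesis
    using a by (intro that[of a b]) (auto simp: mon_degree_0_iff)
qed

lemma sum_over_pairs:
  fixes f :: "(nat \<Rightarrow>\<^sub>0 nat) \<Rightarrow> real"
  assumes "a \<noteq> b" "a \<noteq> c" "b \<noteq> c"
  shows "sum f {unit_mon a + unit_mon a, unit_mon b + unit_mon b, unit_mon c + unit_mon c,
      unit_mon a + unit_mon b, unit_mon a + unit_mon c, unit_mon b + unit_mon c} =
    f (unit_mon a + unit_mon a) + f (unit_mon b + unit_mon b) + f (unit_mon c + unit_mon c) +
    f (unit_mon a + unit_mon b) + f (unit_mon a + unit_mon c) + f (unit_mon b + unit_mon c)"
proof -
  have "b \<noteq> a" "c \<noteq> a" "c \<noteq> b"
    using assms by auto
  then show ?thesis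
    using assms by (subst sum.insert; simp only: finite_insert finite.emptyI insert_iff unit_pair_eq_iff
        empty_iff simp_thms add.assoc)+ (simp add: add.assoc)
qed

text \<open>
  Evaluation of a quadratic form at vectors with at most three nonzero coordinates.
\<close>

lemma eval_quadratic_three_points:
  fixes P :: "real mpoly"
  assumes P: "homog_poly n 2 P" and dist: "a \<noteq> b" "a \<noteq> c" "b \<noteq> c"
    and x: "\<And>i. i \<noteq> a \<Longrightarrow> i \<noteq> b \<Longrightarrow> i \<noteq> c \<Longrightarrow> x i = 0"
  defines "p \<equiv> \<lambda>i j. lookup P (unit_mon i + unit_mon j)"
  shows "eval_mpoly P x = p a a * x a * x a + p b b * x b * x b + p c c * x c * x c +
    p a b * x a * x b + p a c * x a * x c + p b c * x b * x c"
proof -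
  let ?u = "\<lambda>i j. unit_mon i + unit_mon j"
  let ?A = "{?u a a, ?u b b, ?u c c, ?u a b, ?u a c, ?u b c}"
  have zero: "mon_eval M x = 0" if "M \<in> keys P" "M \<notin> ?A" for M
  proof -
    have "mon_degree M = 2" "keys M \<subseteq> UNIV"
      using P that by (auto simp: homog_poly_def)
    then obtain i j where M: "M = ?u i j"
      by (rule mon_degree_2_cases)
    have "x i = 0 \<or> x j = 0"
    proof (rule ccontr)
      assume "\<not> ?thesis"
      then have "i = a \<or> i = b \<or> i = c" "j = a \<or> j = b \<or> j = c"
        using x[of i] x[of j] by blast+
      then have "M \<in> ?A"
        unfolding M by (elim disjE) (simp_all add: add.commute)
      with that(2) show False by blast
    qed
    then show ?thesis
      by (auto simp only: M mon_eval_add mon_eval_unit_mon mult_zero_left mult_zero_right)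
  qed
  have "eval_mpoly P x = (\<Sum>M\<in>keys P \<union> ?A. lookup P M * mon_eval M x)"
    by (rule eval_mpoly_superset) auto
  also have "\<dots> = (\<Sum>M\<in>?A. lookup P M * mon_eval M x)"
    using zero by (intro sum.mono_neutral_right) auto
  also have "\<dots> = p a a * mon_eval (?u a a) x + p b b * mon_eval (?u b b) x + p c c * mon_eval (?u c c) x +
    p a b * mon_eval (?u a b) x + p a c * mon_eval (?u a c) x + p b c * mon_eval (?u b c) x"
    unfolding p_def by (rule sum_over_pairs[OF dist])
  finally show ?thesis
    by (simp only: mon_eval_add mon_eval_unit_mon mult.assoc)
qed

lemma lookup_Var_mult_linear:
  fixes L :: "real mpoly"
  assumes L: "homog_poly n 1 L"
  shows "lookup (Var c * L) (unit_mon a + unit_mon b) =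
    (if c = a then lookup L (unit_mon b) else if c = b then lookup L (unit_mon a) else 0)"
proof -
  consider "c = a" | "c \<noteq> a" "c = b" | "c \<noteq> a" "c \<noteq> b" by blast
  then show ?thesis
  proof cases
    case 1
    then show ?thesis by (simp add: lookup_Var_mult)
  next
    case 2
    then show ?thesis
      using lookup_Var_mult[of b L "unit_mon a"] by (simp add: add.commute)
  next
    case 3
    have "lookup (Var c * L) (unit_mon a + unit_mon b) = 0"
    proof (rule lookup_Var_mult_eq_0)
      fix M' assume "M' \<in> keys L"
      show "unit_mon a + unit_mon b \<noteq> unit_mon c + M'"
      proof
        assume eq: "unit_mon a + unit_mon b = unit_mon c + M'"
        from mon_eq_lookup[OF eq, of c] 3 show False by (simp add: lookup_add)
      qed
    qed
    with 3 show ?thesis by simp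
  qed
qed

lemma lookup_hyperplane_mult_linear:
  assumes L: "homog_poly (r + s) 1 L" and "a \<noteq> b" "a < r + s" "b < r + s"
  defines "\<epsilon> \<equiv> \<lambda>i. if i < r then 1 else - 1 :: real"
  shows "lookup (hyperplane_form r s * L) (unit_mon a + unit_mon b) =
      \<epsilon> a * lookup L (unit_mon b) + \<epsilon> b * lookup L (unit_mon a)"
    and "lookup (hyperplane_form r s * L) (unit_mon a + unit_mon a) = \<epsilon> a * lookup L (unit_mon a)"
proof -
  have eq: "lookup (Var c * L) (unit_mon a + unit_mon b) =
      (if c = a then lookup L (unit_mon b) else 0) + (if c = b then lookup L (unit_mon a) else 0)" for c
    using \<open>a \<noteq> b\<close> by (simp add: lookup_Var_mult_linear[OF L])
  show "lookup (hyperplane_form r s * L) (unit_mon a + unit_mon b) =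
      \<epsilon> a * lookup L (unit_mon b) + \<epsilon> b * lookup L (unit_mon a)"
    using assms by (simp add: lookup_hyperplane_mult eq sum.distrib \<epsilon>_def)
  have eq': "lookup (Var c * L) (unit_mon a + unit_mon a) = (if c = a then lookup L (unit_mon a) else 0)" for c
    by (simp add: lookup_Var_mult_linear[OF L])
  show "lookup (hyperplane_form r s * L) (unit_mon a + unit_mon a) = \<epsilon> a * lookup L (unit_mon a)"
    using assms by (simp add: lookup_hyperplane_mult eq' \<epsilon>_def)
qed

context proper_monomial
begin

text \<open>
  A linear \<open>P\<close> vanishes at \<open>x\<^sub>i = y\<^sub>j = 1\<close>, so that its coefficients are \<open>c\<close> and \<open>- c\<close>.
\<close>

lemma degree_1_factor:
  assumes "d = 1"
  obtains c where "c > 0" "P = Const c * form"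
proof -
  have P1: "homog_poly (2 * r) 1 P"
    using homog_P assms by simp
  have rel: "lookup P (unit_mon i) + lookup P (unit_mon j) = 0" if ij: "i < r" "r \<le> j" "j < 2 * r" for i j
  proof -
    let ?x = "\<lambda>k. if k = i then 1 else if k = j then 1 else 0 :: real"
    have "valid ?x"
      using ij by (auto simp: valid_def)
    then have "eval_mpoly P ?x = 0"
      by (rule P_on_hyperplane[of _ i]) (simp_all add: two_point_form[OF ij])
    then show ?thesis
      by (simp add: two_point_linear[OF P1 ij])
  qed
  define c where "c = lookup P (unit_mon 0)"
  have y: "lookup P (unit_mon j) = - c" if "r \<le> j" "j < 2 * r" for j
    using rel[of 0 j] that r by (simp add: c_def)
  have x: "lookup P (unit_mon i) = c" if "i < r" for i
    using rel[OF that, of r] y[of r] r by simp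
  have eval: "eval_mpoly P x = c * eval_mpoly form x" for x
  proof -
    have "eval_mpoly P x = (\<Sum>a<2*r. lookup P (unit_mon a) * x a)"
      by (rule eval_homog_1[OF P1])
    also have "\<dots> = (\<Sum>a<r. lookup P (unit_mon a) * x a) + (\<Sum>a=r..<r+r. lookup P (unit_mon a) * x a)"
      using sum.atLeastLessThan_concat[of 0 r "r + r" "\<lambda>a. lookup P (unit_mon a) * x a"]
      by (simp add: lessThan_atLeast0 mult_2)
    also have "\<dots> = (\<Sum>a<r. c * x a) + (\<Sum>a=r..<r+r. - c * x a)"
      by (intro arg_cong2[where f = plus] sum.cong) (auto simp: x y)
    finally show ?thesis
      by (simp add: eval_hyperplane_form right_diff_distrib sum_distrib_left sum_negf)
  qed
  have "P = Const c * form"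
  proof (rule mpoly_eqI_nonneg_orthant)
    show "keys e \<subseteq> {..<2 * r}" if "e \<in> keys P" for e
      using homog_P that by (simp add: homog_poly_def)
    show "keys e \<subseteq> {..<2 * r}" if "e \<in> keys (Const c * form)" for e
    proof -
      have "e \<in> keys (form * 1)"
        using that by (auto simp: in_keys_iff lookup_Const_mult)
      then obtain a M' where "a < r + r" "M' \<in> keys (1 :: real mpoly)" "e = unit_mon a + M'"
        by (rule keys_hyperplane_mult)
      then show ?thesis by simp
    qed
  qed (simp add: eval)
  moreover have "c > 0"
  proof -
    let ?x = "\<lambda>k. if k = 0 then 1 else if k = r then 0 else 0 :: real"
    have "0 < r" "r < 2 * r" "valid ?x"
      using r by (auto simp: valid_def)
    then have "eval_mpoly P ?x \<ge> 0"
      by (intro P_on_ball) (auto simp: two_point_form[of 0 r 1 0])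
    then have "c \<ge> 0"
      using \<open>0 < r\<close> \<open>r < 2 * r\<close> by (simp add: eval two_point_form[of 0 r 1 0])
    moreover have "c \<noteq> 0"
      using P_nonzero \<open>P = Const c * form\<close> by (auto simp: Const_def)
    ultimately show ?thesis by simp
  qed
  ultimately show thesis
    using that by blast
qed

text \<open>
  A quadratic \<open>P\<close> is determined by its coefficients at the squares: the other ones follow from its
  vanishing at \<open>x\<^sub>i = y\<^sub>j = 1\<close>, at \<open>x\<^sub>i = x\<^sub>k = 1\<close>, \<open>y\<^sub>j = 2\<close>, and at \<open>x\<^sub>i = 2\<close>, \<open>y\<^sub>j = y\<^sub>k = 1\<close>, with all
  other coordinates 0.
\<close>

lemma degree_2_factor:
  assumes "d = 2"
  obtains L where "homog_poly (2 * r) 1 L" "P = form * L"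
proof -
  have P2: "homog_poly (2 * r) 2 P"
    using homog_P assms by simp
  define p where "p i j = lookup P (unit_mon i + unit_mon j)" for i j
  have p_comm: "p i j = p j i" for i j
    by (simp add: p_def add.commute)
  have eq0: "p a a * \<alpha> * \<alpha> + p b b * \<beta> * \<beta> + p c c * \<gamma> * \<gamma> + p a b * \<alpha> * \<beta> + p a c * \<alpha> * \<gamma> + p b c * \<beta> * \<gamma> = 0"
    if abc: "a < 2 * r" "b < 2 * r" "c < 2 * r" "a \<noteq> b" "a \<noteq> c" "b \<noteq> c"
      and nonneg: "\<alpha> > 0" "\<beta> \<ge> 0" "\<gamma> \<ge> 0"
      and bal: "(if a < r then \<alpha> else - \<alpha>) + (if b < r then \<beta> else - \<beta>) + (if c < r then \<gamma> else - \<gamma>) = 0"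
    for a b c \<alpha> \<beta> \<gamma>
  proof -
    define x where "x k = (if k = a then \<alpha> else 0) + (if k = b then \<beta> else 0) + (if k = c then \<gamma> else 0)" for k
    have "valid x"
      using abc nonneg by (auto simp: valid_def x_def)
    moreover have "eval_mpoly form x = 0"
      using abc bal by (auto simp: eval_hyperplane_form x_def sum.distrib split: if_splits)
    moreover have "x a \<noteq> 0"
      using abc nonneg by (simp add: x_def)
    ultimately have "eval_mpoly P x = 0"
      by (rule P_on_hyperplane)
    then show ?thesis
      using abc by (subst (asm) eval_quadratic_three_points[OF P2 abc(4-6)]) (auto simp: x_def p_def)
  qed
  have xy: "p i j = - p i i - p j j" if ij: "i < r" "r \<le> j" "j < 2 * r" for i j
  proof -
    obtain k where k: "k < r" "k \<noteq> i"
      using r by (metis less_le_trans one_less_numeral_iff pos2 semiring_norm(76) zero_neq_one)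
    show ?thesis
      using eq0[of i j k 1 1 0] ij k by simp
  qed
  have xx: "p i k = p i i + p k k" if ik: "i < r" "k < r" "i \<noteq> k" for i k
  proof -
    have r': "r < 2 * r" using r by simp
    have "p i i + p k k + p r r * 4 + p i k + p i r * 2 + p k r * 2 = 0"
      using eq0[of i k r 1 1 2] ik r' by simp
    then show ?thesis
      using xy[OF ik(1) _ r'] xy[OF ik(2) _ r'] by simp
  qed
  have yy: "p j k = - p j j * - 1 + p k k" if jk: "r \<le> j" "j < 2 * r" "r \<le> k" "k < 2 * r" "j \<noteq> k" for j k
  proof -
    have r': "0 < r" using r by simp
    have "p j j + p k k + p 0 0 * 4 + p j k + p j 0 * 2 + p k 0 * 2 = 0"
      using eq0[of j k 0 1 1 2] jk r' by simp
    then show ?thesis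
      using xy[OF r' jk(1,2)] xy[OF r' jk(3,4)] by (simp add: p_comm)
  qed
  define L :: "real mpoly" where "L = (\<Sum>a<2*r. single (unit_mon a) (if a < r then p a a else - p a a))"
  have lookup_L: "lookup L (unit_mon a) = (if a < r then p a a else - p a a)" if "a < 2 * r" for a
    using that by (simp add: L_def lookup_sum lookup_single when_def unit_mon_eq_iff)
  have L: "homog_poly (2 * r) 1 L"
    unfolding homog_poly_def
  proof
    fix M assume "M \<in> keys L"
    then have "\<exists>a<2*r. M = unit_mon a"
      by (rule contrapos_pp) (auto simp: in_keys_iff L_def lookup_sum lookup_single when_def intro!: sum.neutral)
    then show "keys M \<subseteq> {..<2 * r} \<and> mon_degree M = 1"
      by auto
  qed
  then have L': "homog_poly (r + r) 1 L"
    by (simp add: dims)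
  have hom: "homog_poly (2 * r) 2 (form * L)"
    using homog_hyperplane_power_mult[OF L', of 1] by (simp only: dims power_one_right one_add_one)
  have "P = form * L"
  proof (rule poly_mapping_eqI)
    fix M
    show "lookup P M = lookup (form * L) M"
    proof (cases "mon_degree M = 2 \<and> keys M \<subseteq> {..<2 * r}")
      case False
      then have "M \<notin> keys P" "M \<notin> keys (form * L)"
        using P2 hom by (auto simp: homog_poly_def)
      then show ?thesis by (simp add: in_keys_iff)
    next
      case True
      then obtain a b where ab: "a < 2 * r" "b < 2 * r" "M = unit_mon a + unit_mon b"
        by (elim conjE mon_degree_2_cases) auto
      have ab': "a < r + r" "b < r + r"
        using ab by simp_all
      show ?thesis
      proof (cases "a = b")
        case True
        have "\<exists>b'. a \<noteq> b' \<and> b' < r + r"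
          using r by (intro exI[of _ "if a = 0 then 1 else 0"]) auto
        then obtain b' where "a \<noteq> b'" "b' < r + r" by blast
        from lookup_hyperplane_mult_linear(2)[OF L' this(1) ab'(1) this(2)] show ?thesis
          by (simp add: ab(3) True[symmetric] lookup_L[OF ab(1)] p_def)
      next
        case False
        have "p a b = lookup (form * L) M"
          unfolding ab(3) lookup_hyperplane_mult_linear(1)[OF L' False ab'] lookup_L[OF ab(1)] lookup_L[OF ab(2)]
          using xx[of a b] xy[of a b] xy[of b a] yy[of a b] ab(1,2) False p_comm[of a b] by auto
        then show ?thesis by (simp add: ab(3) p_def)
      qed
    qed
  qed
  with L show thesis by (rule that)
qed

lemma equivalent_to_monomial:
  assumes c: "c > 0" and P_eq: "P = Const c * slot_poly (r + 1) (r + 1) E' C'"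
    and nz: "\<And>k. k < 2 * r + 2 \<Longrightarrow> C k \<noteq> 0 \<Longrightarrow> lookup P (E k) \<noteq> 0"
    and nz': "\<And>k. k < 2 * r + 2 \<Longrightarrow> C' k \<noteq> 0 \<Longrightarrow> lookup P (E' k) \<noteq> 0"
    and S: "pseudo_unitary r r S" and hs: "homog_tuple (2 * r) (2 * r + 2) e hs"
    and eq: "\<And>z. z \<in> cspace (2 * r) \<Longrightarrow> eval_tuple (mono_tuple (2 * r + 2) E' C') (S z) = eval_tuple hs z"
  shows "\<exists>A \<in> Aut (2 * r + 2) (gball (r + 1) (r + 1)). \<exists>B \<in> Aut (2 * r) (gball r r).
    rationally_equivalent (2 * r) (2 * r + 2) (A \<circ>\<^sub>m rat_map (2 * r) gs \<circ>\<^sub>m B) (rat_map (2 * r) hs)"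
proof -
  have lookup_P: "lookup (slot_poly (r + 1) (r + 1) E C) M = c * lookup (slot_poly (r + 1) (r + 1) E' C') M" for M
    using P_eq by (simp only: P_def lookup_Const_mult)
  have "\<exists>T. pseudo_unitary (r + 1) (r + 1) T \<and> (\<forall>z. T (eval_tuple (mono_tuple (r + 1 + (r + 1)) E C) z) =
      (\<lambda>i. of_real (sqrt c) * eval_tuple (mono_tuple (r + 1 + (r + 1)) E' C') z i))"
  proof (rule mono_tuples_isometric[OF c lookup_P])
    fix k assume k: "k < r + 1 + (r + 1)"
    show "lookup (slot_poly (r + 1) (r + 1) E C) (E k) \<noteq> 0" if "C k \<noteq> 0"
      using nz[of k] that k unfolding P_def dims by blast
    have "lookup (slot_poly (r + 1) (r + 1) E C) (E' k) \<noteq> 0" if "C' k \<noteq> 0"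
      using nz'[of k] that k unfolding P_def dims by blast
    then show "lookup (slot_poly (r + 1) (r + 1) E' C') (E' k) \<noteq> 0" if "C' k \<noteq> 0"
      using that c by (auto simp only: lookup_P mult_eq_0_iff)
  qed
  then obtain T where T: "pseudo_unitary (r + 1) (r + 1) T" and
    Teq: "\<And>z. T (eval_tuple gs z) = (\<lambda>i. of_real (sqrt c) * eval_tuple (mono_tuple (2 * r + 2) E' C') z i)"
    unfolding dims by blast
  show ?thesis
  proof (intro bexI)
    show "induced_map (r + 1) (r + 1) T \<in> Aut (2 * r + 2) (gball (r + 1) (r + 1))"
      using induced_map_Aut[OF T] by (simp only: dims)
    show "induced_map r r S \<in> Aut (2 * r) (gball r r)"
      using induced_map_Aut[OF S] by (simp only: dims)
    show "rationally_equivalent (2 * r) (2 * r + 2)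
        (induced_map (r + 1) (r + 1) T \<circ>\<^sub>m rat_map (2 * r) gs \<circ>\<^sub>m induced_map r r S) (rat_map (2 * r) hs)"
    proof (rule rationally_equivalent_by_isometries[of r r "r + 1" "r + 1", unfolded dims, OF homog hs])
      show "form_isometry (r + 1) (r + 1) T" "form_isometry r r S"
        using T S by (simp_all only: pseudo_unitary_def)
      show "complex_of_real (sqrt c) \<noteq> 0"
        using c by simp
      show "T (eval_tuple gs (S z)) = (\<lambda>i. of_real (sqrt c) * eval_tuple hs z i)" if "z \<in> cspace (2 * r)" for z
        by (simp only: Teq eq[OF that])
    qed
  qed
qed

end

lemma lookup_hyperplane_form_unit_mon:
  assumes "a < r + s"
  shows "lookup (hyperplane_form r s) (unit_mon a) = (if a < r then 1 else -1)"
  using assms by (simp add: hyperplane_form_def lookup_minus lookup_sum Var_eq_single lookup_single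
      when_def unit_mon_eq_iff)

lemma single_unit_pair: "single (unit_mon a + unit_mon b) c = Const c * Var a * Var b"
  by (simp add: Const_def Var_eq_single mult_single)

lemma homog_unit_pair:
  "\<lbrakk>a < n; b < n\<rbrakk> \<Longrightarrow> homog_poly n 2 (single (unit_mon a + unit_mon b) c)"
  by (simp add: homog_poly_def keys_add_nat)

lemma Const_one: "Const 1 = 1"
  by (simp add: Const_def)

context proper_monomial
begin

text \<open>
  If the components of the target tuple have distinct exponents and nonzero coefficients, then
  comparing the numbers of terms shows that the same holds for the given map.
\<close>

lemma equivalent_to_injective_monomial:
  assumes c: "c > 0" and P_eq: "P = Const c * slot_poly (r + 1) (r + 1) E' C'"
    and inj: "inj_on E' {..<2 * r + 2}" and C': "\<And>k. k < 2 * r + 2 \<Longrightarrow> C' k \<noteq> 0"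
    and S: "pseudo_unitary r r S" and hs: "homog_tuple (2 * r) (2 * r + 2) e hs"
    and eq: "\<And>z. z \<in> cspace (2 * r) \<Longrightarrow> eval_tuple (mono_tuple (2 * r + 2) E' C') (S z) = eval_tuple hs z"
  shows "\<exists>A \<in> Aut (2 * r + 2) (gball (r + 1) (r + 1)). \<exists>B \<in> Aut (2 * r) (gball r r).
    rationally_equivalent (2 * r) (2 * r + 2) (A \<circ>\<^sub>m rat_map (2 * r) gs \<circ>\<^sub>m B) (rat_map (2 * r) hs)"
proof (rule equivalent_to_monomial[OF c P_eq _ _ S hs eq])
  let ?P' = "slot_poly (r + 1) (r + 1) E' C'"
  have terms: "pos_terms P = pos_terms ?P'" "neg_terms P = neg_terms ?P'"
    unfolding P_eq pos_terms_def neg_terms_def lookup_Const_mult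
    using c by (simp_all add: zero_less_mult_iff mult_less_0_iff)
  have "card (pos_terms ?P') \<ge> r + 1" "card (neg_terms ?P') \<ge> r + 1"
    using card_terms_slot_poly_inj[of E' "r + 1" "r + 1" C', unfolded dims, OF inj C'] by simp_all
  then have card: "card (pos_terms (slot_poly (r + 1) (r + 1) E C)) \<ge> r + 1"
    "card (neg_terms (slot_poly (r + 1) (r + 1) E C)) \<ge> r + 1"
    unfolding terms[symmetric] P_def by simp_all
  fix k assume k: "k < 2 * r + 2"
  show "lookup P (E k) \<noteq> 0"
    using slot_poly_all_used[OF card, of k] k unfolding P_def dims by blast
  have "lookup ?P' (E' k) \<noteq> 0"
    using lookup_slot_poly_inj[of E' "r + 1" "r + 1" k C', unfolded dims, OF inj k] C'[OF k] by auto
  then show "lookup P (E' k) \<noteq> 0"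
    using c by (simp only: P_eq lookup_Const_mult mult_eq_0_iff) simp
qed

text \<open>
  Witt's theorem permits to choose \<open>\<phi> = 0\<close>.
\<close>

theorem degree_1_normal_form:
  assumes "d = 1"
  shows "\<exists>A \<in> Aut (2 * r + 2) (gball (r + 1) (r + 1)). \<exists>B \<in> Aut (2 * r) (gball r r).
    rationally_equivalent (2 * r) (2 * r + 2) (A \<circ>\<^sub>m rat_map (2 * r) gs \<circ>\<^sub>m B)
      (rat_map (2 * r) (map Var [0..<r] @ [0] @ map Var [r..<2 * r] @ [0]))"
proof -
  obtain c where c: "c > 0" "P = Const c * form"
    using degree_1_factor[OF assms] by blast
  define E' where "E' k = unit_mon (if k < r then k else k - 1)" for k
  define C' :: "nat \<Rightarrow> complex" where "C' k = (if k = r \<or> k = 2 * r + 1 then 0 else 1)" for k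
  let ?hs = "map Var [0..<r] @ [0] @ map Var [r..<2 * r] @ [0] :: complex mpoly list"
  have hs: "?hs = mono_tuple (2 * r + 2) E' C'"
  proof (rule nth_equalityI)
    show "length ?hs = length (mono_tuple (2 * r + 2) E' C')"
      using r by simp
    fix k assume "k < length ?hs"
    then have k: "k < 2 * r + 2"
      using r by simp
    then have "mono_tuple (2 * r + 2) E' C' ! k = single (E' k) (C' k)"
      by (simp add: mono_tuple_def del: upt_Suc)
    also have "\<dots> = ?hs ! k"
    proof -
      consider "k < r" | "k = r" | "r < k" "k < 2 * r + 1" | "k = 2 * r + 1"
        using k by linarith
      then show ?thesis
      proof cases
        case 3
        then have "k - Suc r < length [r..<2 * r]" "r + (k - Suc r) = k - 1"
          by auto
        then show ?thesis
          using 3 by (simp add: E'_def C'_def nth_append Var_eq_single nth_Cons')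
      qed (auto simp: E'_def C'_def nth_append Var_eq_single)
    qed
    finally show "?hs ! k = mono_tuple (2 * r + 2) E' C' ! k" ..
  qed
  have "slot_poly (r + 1) (r + 1) E' C' = form"
  proof -
    have "(\<Sum>k<r+1. single (E' k) ((cmod (C' k))\<^sup>2)) = (\<Sum>k<r. Var k)"
      by (simp add: E'_def C'_def Var_eq_single)
    moreover have "(\<Sum>k=r+1..<r+1+(r+1). single (E' k) ((cmod (C' k))\<^sup>2)) = (\<Sum>k=Suc r..<Suc (r + r). Var (k - 1))"
    proof -
      have "r + 1 + (r + 1) = Suc (Suc (r + r))" by simp
      then show ?thesis
        by (simp add: E'_def C'_def Var_eq_single)
    qed
    then have "(\<Sum>k=r+1..<r+1+(r+1). single (E' k) ((cmod (C' k))\<^sup>2)) = (\<Sum>k=r..<r+r. Var k)"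
      by (simp only: sum.shift_bounds_Suc_ivl diff_Suc_1)
    ultimately show ?thesis
      by (simp only: slot_poly_def hyperplane_form_def)
  qed
  then have P_eq: "P = Const c * slot_poly (r + 1) (r + 1) E' C'"
    using c(2) by simp
  have unit: "lookup P (unit_mon a) \<noteq> 0" if "a < 2 * r" for a
    using that c by (simp add: lookup_Const_mult lookup_hyperplane_form_unit_mon)
  show ?thesis
  proof (rule equivalent_to_monomial[OF c(1) P_eq])
    show "lookup P (E k) \<noteq> 0" if k: "k < 2 * r + 2" "C k \<noteq> 0" for k
    proof -
      have "mon_degree (E k) = Suc 0" "keys (E k) \<subseteq> {..<2 * r}"
        using E[OF k] assms by auto
      then obtain a M where "a \<in> {..<2 * r}" "E k = unit_mon a + M" "mon_degree M = 0"
        by (rule mon_degree_Suc_split) blast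
      then show ?thesis
        using unit[of a] by (simp add: mon_degree_0_iff)
    qed
    show "lookup P (E' k) \<noteq> 0" if k: "k < 2 * r + 2" "C' k \<noteq> 0" for k
      unfolding E'_def using k r by (intro unit) (auto simp: C'_def split: if_splits)
    show "pseudo_unitary r r (\<lambda>x. x)"
      by (rule pseudo_unitary_id)
    show "homog_tuple (2 * r) (2 * r + 2) 1 ?hs"
      unfolding hs
    proof (rule homog_mono_tuple)
      show "keys (E' k) \<subseteq> {..<2 * r} \<and> mon_degree (E' k) = 1" if "k < 2 * r + 2" "C' k \<noteq> 0" for k
        using that r by (auto simp: E'_def C'_def split: if_splits)
      show "\<exists>k<2 * r + 2. C' k \<noteq> 0"
        using r by (intro exI[of _ 0]) (auto simp: C'_def)
    qed
  qed (simp only: hs)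
qed

lemma form_r2:
  assumes "r = 2"
  shows "form = Var 0 + Var 1 - (Var 2 + Var 3)"
proof -
  have "{..<2::nat} = {0, 1}" "{2..<2+2::nat} = {2, 3}"
    by auto
  then show ?thesis
    by (simp add: assms hyperplane_form_def)
qed

lemma slot_poly_3_3:
  "slot_poly 3 3 E' C' =
    single (E' 0) ((cmod (C' 0))\<^sup>2) + single (E' 1) ((cmod (C' 1))\<^sup>2) + single (E' 2) ((cmod (C' 2))\<^sup>2)
    - (single (E' 3) ((cmod (C' 3))\<^sup>2) + single (E' 4) ((cmod (C' 4))\<^sup>2) + single (E' 5) ((cmod (C' 5))\<^sup>2))"
proof -
  have "{..<3::nat} = {0, 1, 2}" "{3..<3+3::nat} = {3, 4, 5}"
    by auto
  then show ?thesis
    by (simp add: slot_poly_def add.assoc)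
qed

lemma less_6_cases: "k < (6::nat) \<longleftrightarrow> k = 0 \<or> k = 1 \<or> k = 2 \<or> k = 3 \<or> k = 4 \<or> k = 5"
  by auto

theorem degree_2_normal_form:
  assumes "d = 2"
  shows "r = 2 \<and> (\<exists>A \<in> Aut (2 * r + 2) (gball (r + 1) (r + 1)). \<exists>B \<in> Aut (2 * r) (gball r r).
    rationally_equivalent (2 * r) (2 * r + 2) (A \<circ>\<^sub>m rat_map (2 * r) gs \<circ>\<^sub>m B)
      (rat_map (2 * r) [Var 0 ^ 2, Var 0 * Var 1, Var 1 * Var 2, Var 2 ^ 2, Var 0 * Var 3, Var 2 * Var 3]) \<or>
    rationally_equivalent (2 * r) (2 * r + 2) (A \<circ>\<^sub>m rat_map (2 * r) gs \<circ>\<^sub>m B)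
      (rat_map (2 * r)
        [Var 0 ^ 2, Const (complex_of_real (sqrt 2)) * Var 0 * Var 1, Var 1 ^ 2,
         Var 2 ^ 2, Const (complex_of_real (sqrt 2)) * Var 2 * Var 3, Var 3 ^ 2]))"
proof -
  obtain L where L: "homog_poly (2 * r) 1 L" and P_eq: "P = form * L"
    using degree_2_factor[OF assms] by blast
  have "P = form ^ 1 * L"
    using P_eq by simp
  from factor_classification[OF this _ L] have r2: "r = 2" and
    shape: "(\<exists>i j c. i < 2 \<and> 2 \<le> j \<and> j < 4 \<and> c > 0 \<and>
      (\<forall>M. lookup L M = (if M = unit_mon i \<or> M = unit_mon j then c else 0))) \<or>
    (\<exists>c>0. \<forall>M. lookup L M = (if \<exists>a<4. M = unit_mon a then c else 0))"
    by simp_all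
  have dim: "2 * r = 4" "2 * r + 2 = 6" "r + 1 = 3"
    using r2 by simp_all
  from shape show ?thesis
  proof (elim disjE exE conjE)
    fix i j :: nat and c :: real
    assume i: "i < 2" and j: "2 \<le> j" "j < 4" and c: "c > 0"
      and L_eq: "\<forall>M. lookup L M = (if M = unit_mon i \<or> M = unit_mon j then c else 0)"
    define i' where "i' = 1 - i"
    define j' where "j' = 5 - j"
    \<comment> \<open>The permutation \<open>S\<close> of the variables reduces to the case \<open>i = 0\<close>, \<open>j = 2\<close>.\<close>
    have i_cases: "i = 0 \<and> i' = 1 \<or> i = 1 \<and> i' = 0"
      using i unfolding i'_def by presburger
    have j_cases: "j = 2 \<and> j' = 3 \<or> j = 3 \<and> j' = 2"
      using j unfolding j'_def by presburger
    let ?u = "\<lambda>a b. unit_mon a + unit_mon b"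
    define E' where "E' k = [?u i i, ?u i i', ?u i' j, ?u j j, ?u i j', ?u j j'] ! k" for k
    let ?hs = "[Var 0 ^ 2, Var 0 * Var 1, Var 1 * Var 2, Var 2 ^ 2, Var 0 * Var 3, Var 2 * Var 3] :: complex mpoly list"
    define S :: "(nat \<Rightarrow> complex) \<Rightarrow> nat \<Rightarrow> complex" where
      "S z k = (if k = 0 then z i else if k = 1 then z i' else if k = 2 then z j
        else if k = 3 then z j' else z k)" for z k
    have S_at: "S z i = z 0" "S z i' = z 1" "S z j = z 2" "S z j' = z 3" for z
      using i_cases j_cases by (elim disjE conjE; simp add: S_def)+
    have S_iso: "form_isometry r r S"
    proof -
      have "{..<2::nat} = {0, 1}" "{2..<2+2::nat} = {2, 3}"
        by auto
      then have "hform r r (S x) (S y) = hform r r x y" for x y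
        using i_cases j_cases by (elim disjE conjE) (simp_all add: hform_def r2 S_def)
      moreover have "linear_map (r + r) S"
        using i_cases j_cases
        by (elim disjE conjE) (simp_all add: linear_map_def cspace_def S_def r2 fun_eq_iff)
      ultimately show ?thesis
        by (simp add: form_isometry_def)
    qed
    have "S (S z) = z" for z
      by (rule ext, use i_cases j_cases in \<open>elim disjE conjE\<close>) (simp_all add: S_def)
    with S_iso have S: "pseudo_unitary r r S"
      by (auto simp: pseudo_unitary_def)
    have L': "L = Const c * (Var i + Var j)"
    proof (rule poly_mapping_eqI)
      fix M
      have "unit_mon i \<noteq> unit_mon j"
        using i j by (simp add: unit_mon_eq_iff)
      then show "lookup L M = lookup (Const c * (Var i + Var j)) M"
        by (auto simp: L_eq lookup_Const_mult lookup_add Var_eq_single lookup_single when_def)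
    qed
    have form: "form = Var i + Var i' - (Var j + Var j')"
      using i_cases j_cases by (auto simp: form_r2[OF r2] algebra_simps)
    have P_eq': "P = Const c * slot_poly (r + 1) (r + 1) E' (\<lambda>_. 1)"
      unfolding P_eq L' dim slot_poly_3_3 form
      by (simp add: E'_def single_unit_pair Const_one algebra_simps)
    have "\<exists>A \<in> Aut (2 * r + 2) (gball (r + 1) (r + 1)). \<exists>B \<in> Aut (2 * r) (gball r r).
      rationally_equivalent (2 * r) (2 * r + 2) (A \<circ>\<^sub>m rat_map (2 * r) gs \<circ>\<^sub>m B) (rat_map (2 * r) ?hs)"
    proof (rule equivalent_to_injective_monomial[OF c P_eq' _ _ S])
      show "inj_on E' {..<2 * r + 2}"
        unfolding dim using i_cases j_cases
        by (auto simp: inj_on_def less_6_cases E'_def unit_pair_eq_iff unit_mon_eq_iff)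
      have "homog_poly 4 2 p" if "p \<in> set ?hs" for p
        using that homog_unit_pair[of _ 4 _ "1 :: complex"]
        by (auto simp: single_unit_pair Const_one power2_eq_square)
      moreover have "(Var 0 ^ 2 :: complex mpoly) \<noteq> 0"
        by (simp add: Var_eq_single power2_eq_square mult_single single_eq_0_iff)
      ultimately show "homog_tuple (2 * r) (2 * r + 2) 2 ?hs"
        unfolding dim homog_tuple_def by simp
      show "eval_tuple (mono_tuple (2 * r + 2) E' (\<lambda>_. 1)) (S z) = eval_tuple ?hs z" for z
      proof
        fix k
        show "eval_tuple (mono_tuple (2 * r + 2) E' (\<lambda>_. 1)) (S z) k = eval_tuple ?hs z k"
        proof (cases "k < 6")
          case True
          have "mon_eval (?u a b) (S z) = S z a * S z b" for a b
            by (simp only: mon_eval_add mon_eval_unit_mon)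
          with True show ?thesis
            unfolding dim eval_mono_tuple less_6_cases
            by (auto simp: eval_tuple_def E'_def S_at power2_eq_square)
        qed (simp add: dim eval_mono_tuple eval_tuple_def)
      qed
    qed simp
    with r2 show ?thesis by blast
  next
    fix c :: real
    assume c: "c > 0" and L_eq: "\<forall>M. lookup L M = (if \<exists>a<4. M = unit_mon a then c else 0)"
    let ?u = "\<lambda>a b. unit_mon a + unit_mon b"
    define E' where "E' k = [?u 0 0, ?u 0 1, ?u 1 1, ?u 2 2, ?u 2 3, ?u 3 3] ! k" for k
    define C' :: "nat \<Rightarrow> complex" where "C' k = (if k = 1 \<or> k = 4 then complex_of_real (sqrt 2) else 1)" for k
    let ?hs = "[Var 0 ^ 2, Const (complex_of_real (sqrt 2)) * Var 0 * Var 1, Var 1 ^ 2,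
      Var 2 ^ 2, Const (complex_of_real (sqrt 2)) * Var 2 * Var 3, Var 3 ^ 2] :: complex mpoly list"
    have L': "L = Const c * (Var 0 + Var 1 + Var 2 + Var 3)"
    proof (rule poly_mapping_eqI)
      fix M
      have "(\<exists>a<4. M = unit_mon a) \<longleftrightarrow> M = unit_mon 0 \<or> M = unit_mon 1 \<or> M = unit_mon 2 \<or> M = unit_mon 3"
        by (auto simp: numeral_eq_Suc less_Suc_eq)
      then show "lookup L M = lookup (Const c * (Var 0 + Var 1 + Var 2 + Var 3)) M"
        by (auto simp: L_eq lookup_Const_mult lookup_add Var_eq_single lookup_single when_def unit_mon_eq_iff)
    qed
    have Const_2: "(Const 2 :: real mpoly) = 1 + 1"
      by (simp add: Const_def single_numeral)
    have P_eq': "P = Const c * slot_poly (r + 1) (r + 1) E' C'"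
      unfolding P_eq L' dim slot_poly_3_3 form_r2[OF r2]
      by (simp add: E'_def C'_def single_unit_pair Const_one Const_2 algebra_simps)
    have "\<exists>A \<in> Aut (2 * r + 2) (gball (r + 1) (r + 1)). \<exists>B \<in> Aut (2 * r) (gball r r).
      rationally_equivalent (2 * r) (2 * r + 2) (A \<circ>\<^sub>m rat_map (2 * r) gs \<circ>\<^sub>m B) (rat_map (2 * r) ?hs)"
    proof (rule equivalent_to_injective_monomial[OF c P_eq' _ _ pseudo_unitary_id])
      show "inj_on E' {..<2 * r + 2}"
        unfolding dim by (auto simp: inj_on_def less_6_cases E'_def unit_pair_eq_iff unit_mon_eq_iff)
      show "C' k \<noteq> 0" for k
        by (simp add: C'_def)
      have "homog_poly 4 2 p" if "p \<in> set ?hs" for p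
        using that homog_unit_pair[of _ 4 _ "1 :: complex"] homog_unit_pair[of _ 4 _ "complex_of_real (sqrt 2)"]
        by (auto simp: single_unit_pair Const_one power2_eq_square)
      moreover have "(Var 0 ^ 2 :: complex mpoly) \<noteq> 0"
        by (simp add: Var_eq_single power2_eq_square mult_single single_eq_0_iff)
      ultimately show "homog_tuple (2 * r) (2 * r + 2) 2 ?hs"
        unfolding dim homog_tuple_def by simp
      show "eval_tuple (mono_tuple (2 * r + 2) E' C') z = eval_tuple ?hs z" for z
      proof
        fix k
        show "eval_tuple (mono_tuple (2 * r + 2) E' C') z k = eval_tuple ?hs z k"
        proof (cases "k < 6")
          case True
          have "mon_eval (?u a b) z = z a * z b" for a b
            by (simp only: mon_eval_add mon_eval_unit_mon)
          with True show ?thesis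
            unfolding dim eval_mono_tuple less_6_cases
            by (auto simp: eval_tuple_def E'_def C'_def power2_eq_square)
        qed (simp add: dim eval_mono_tuple eval_tuple_def)
      qed
    qed
    with r2 show ?thesis by blast
  qed
qed

end

section \<open>The classification\<close>

theorem theorem1p2:
  fixes r d :: nat and gs :: "complex mpoly list"
  assumes "r \<ge> 2"
    and "monomial_tuple (2 * r) (2 * r + 2) d gs"
    and "no_common_factor gs"
    and "proper_gball_map r r (r + 1) (r + 1) (rat_map (2 * r) gs)"
  shows
    "(d = 1 \<and>
       (\<exists>A \<in> Aut (2 * r + 2) (gball (r + 1) (r + 1)). \<exists>B \<in> Aut (2 * r) (gball r r).
        \<exists>\<phi>. homog_poly (2 * r) 1 \<phi> \<and>
          rationally_equivalent (2 * r) (2 * r + 2) (A \<circ>\<^sub>m rat_map (2 * r) gs \<circ>\<^sub>m B)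
            (rat_map (2 * r) (map Var [0..<r] @ [\<phi>] @ map Var [r..<2 * r] @ [\<phi>])))) \<or>
     (d = 2 \<and> r = 2 \<and>
       (\<exists>A \<in> Aut (2 * r + 2) (gball (r + 1) (r + 1)). \<exists>B \<in> Aut (2 * r) (gball r r).
          rationally_equivalent (2 * r) (2 * r + 2) (A \<circ>\<^sub>m rat_map (2 * r) gs \<circ>\<^sub>m B)
            (rat_map (2 * r)
              [Var 0 ^ 2, Var 0 * Var 1, Var 1 * Var 2,
               Var 2 ^ 2, Var 0 * Var 3, Var 2 * Var 3]) \<or>
          rationally_equivalent (2 * r) (2 * r + 2) (A \<circ>\<^sub>m rat_map (2 * r) gs \<circ>\<^sub>m B)
            (rat_map (2 * r)
              [Var 0 ^ 2, Const (complex_of_real (sqrt 2)) * Var 0 * Var 1, Var 1 ^ 2,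
               Var 2 ^ 2, Const (complex_of_real (sqrt 2)) * Var 2 * Var 3, Var 3 ^ 2]))) \<or>
     (d \<ge> 3 \<and>
       \<not> (\<exists>P m Q. is_assoc_poly r r (r + 1) (r + 1) gs P \<and> is_Q_decomp r r P m Q \<and>
            (total_degree Q = 1 \<or> nonneg_coeffs Q)))"
proof -
  from assms(2) obtain E C where gs: "gs = mono_tuple (2 * r + 2) E C"
    and E: "\<And>k. k < 2 * r + 2 \<Longrightarrow> C k \<noteq> 0 \<Longrightarrow> keys (E k) \<subseteq> {..<2 * r} \<and> mon_degree (E k) = d"
    and C: "\<exists>k<2 * r + 2. C k \<noteq> 0"
    by (rule monomial_tuple_cases) blast
  interpret proper_monomial r d E C
    by (rule proper_monomial.intro) (use assms E C in \<open>simp_all only: gs\<close>)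
  have "d = 0 \<or> d = 1 \<or> d = 2 \<or> d \<ge> 3"
    by linarith
  then show ?thesis
  proof (elim disjE)
    assume "d = 0"
    with d_nonzero show ?thesis by simp
  next
    assume "d = 1"
    have "homog_poly (2 * r) 1 (0 :: complex mpoly)"
      by (simp add: homog_poly_def)
    with \<open>d = 1\<close> degree_1_normal_form show ?thesis
      unfolding gs by blast
  next
    assume "d = 2"
    with degree_2_normal_form show ?thesis
      unfolding gs by blast
  next
    assume "d \<ge> 3"
    with no_factorization_of_high_degree show ?thesis
      unfolding gs by blast
  qed
qed

end
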